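(* Let $P$ be a smooth manifold. The following statements hold: (i) There is a one-to-one correspondence between regular almost Dirac structures $L\subset TP\oplus T^*P$ and pairs $(F,\Omega_F)$, where $F$ is a regular distribution on $P$ and $\Omega_F\in\Gamma(\bigwedge^2F^* )$. (ii) Let $F\subset TP$ be a regular distribution on $P$. Given a section $\Omega_F\in\Gamma(\bigwedge^2F^* )$, there exists a 2-form $\Omega$ on $P$ such that $\Omega|_F=\Omega_F$.
   Context: An almost Dirac structure on $P$ is a subbundle $L\subset TP\oplus T^*P$ that is maximal isotropic with respect to the pairing $\langle(X,\alpha),(Y,\beta)\rangle=\alpha(Y)+\beta(X)$. $\mathrm{pr}_1:TP\oplus T^*P\to TP$ is the projection onto the first factor. $L$ is regular if the distribution $\mathrm{pr}_1(L)$ on $P$ has constant rank. A regular distribution is a smooth constant-rank subbundle of $TP$ (not necessarily integrable). $\Omega|_F$ denotes the point-wise restriction of $\Omega$ to $F$. *)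

theory Defs
  imports "HOL-Analysis.Analysis" "HOL-Library.Function_Algebras"
begin

section \<open>Functions as a real vector space\<close>

text \<open>With the pointwise operations; this makes \<^const>\<open>subspace\<close>, \<^const>\<open>span\<close>, \<^const>\<open>independent\<close>
  and \<^const>\<open>dim\<close> available for tangent and cotangent spaces, which are subsets of function types.\<close>

instantiation "fun" :: (type, scaleR) scaleR
begin

definition scaleR_fun :: "real \<Rightarrow> ('a \<Rightarrow> 'b) \<Rightarrow> 'a \<Rightarrow> 'b"
  where "scaleR_fun r f = (\<lambda>x. r *\<^sub>R f x)"

instance ..

end

instance "fun" :: (type, real_vector) real_vector
  by standard (auto simp: scaleR_fun_def fun_eq_iff plus_fun_def algebra_simps)

section \<open>Smooth functions of n real variables\<close>

text \<open>Points of n-dimensional space are functions from nat to real that vanish at all indices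
  from n on, as in \<^const>\<open>Euclidean_space\<close>; coordinates are numbered from 0, and n may be 0.\<close>

definition partial :: "nat \<Rightarrow> ((nat \<Rightarrow> real) \<Rightarrow> real) \<Rightarrow> (nat \<Rightarrow> real) \<Rightarrow> real"
  where "partial i f x = deriv (\<lambda>t. f (x(i := t))) (x i)"

text \<open>All iterated partial derivatives exist and are continuous on the open set V. The list is
  the sequence of differentiations already carried out.\<close>

definition smooth_on :: "nat \<Rightarrow> (nat \<Rightarrow> real) set \<Rightarrow> ((nat \<Rightarrow> real) \<Rightarrow> real) \<Rightarrow> bool"
  where "smooth_on n V f \<longleftrightarrow>
    (\<forall>js. set js \<subseteq> {..<n} \<longrightarrow>
       continuous_map (subtopology (Euclidean_space n) V) euclideanreal (foldr partial js f) \<and>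
       (\<forall>x\<in>V. \<forall>i<n. (\<lambda>t. foldr partial js f (x(i := t))) field_differentiable (at (x i))))"

section \<open>Smooth manifolds\<close>

text \<open>A chart consists of its domain and its coordinate map; the values of the map outside the
  domain are irrelevant.\<close>

type_synonym 'a chart = "'a set \<times> ('a \<Rightarrow> nat \<Rightarrow> real)"

definition transition :: "'a chart \<Rightarrow> 'a chart \<Rightarrow> (nat \<Rightarrow> real) \<Rightarrow> nat \<Rightarrow> real"
  where "transition c d x = snd d (inv_into (fst c) (snd c) x)"

text \<open>The atlas need not be maximal.\<close>

definition smooth_manifold :: "'a topology \<Rightarrow> nat \<Rightarrow> 'a chart set \<Rightarrow> bool"
  where "smooth_manifold X n A \<longleftrightarrow>
    Hausdorff_space X \<and> second_countable X \<and>
    topspace X = (\<Union>c\<in>A. fst c) \<and>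
    (\<forall>c\<in>A. openin X (fst c) \<and>
       (\<exists>V. openin (Euclidean_space n) V \<and>
            homeomorphic_map (subtopology X (fst c)) (subtopology (Euclidean_space n) V) (snd c))) \<and>
    (\<forall>c\<in>A. \<forall>d\<in>A. \<forall>i<n. smooth_on n (snd c ` (fst c \<inter> fst d)) (\<lambda>x. transition c d x i))"

definition smooth_fun :: "nat \<Rightarrow> 'a chart set \<Rightarrow> 'a set \<Rightarrow> ('a \<Rightarrow> real) \<Rightarrow> bool"
  where "smooth_fun n A W f \<longleftrightarrow>
    (\<forall>c\<in>A. smooth_on n (snd c ` (fst c \<inter> W)) (\<lambda>x. f (inv_into (fst c) (snd c) x)))"

section \<open>Tangent and cotangent spaces\<close>

text \<open>A tangent vector at p assigns to every chart around p its components in that chart, which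
  transform by the Jacobian matrices of the coordinate changes. Charts not containing p and
  indices from n on get the value 0, so that equality and addition of tangent vectors are
  those of the function type.\<close>

type_synonym 'a tvec = "'a chart \<Rightarrow> nat \<Rightarrow> real"

definition tangent_space :: "nat \<Rightarrow> 'a chart set \<Rightarrow> 'a \<Rightarrow> 'a tvec set"
  where "tangent_space n A p =
    {v. (\<forall>c i. c \<notin> A \<or> p \<notin> fst c \<or> n \<le> i \<longrightarrow> v c i = 0) \<and>
        (\<forall>c\<in>A. \<forall>d\<in>A. p \<in> fst c \<and> p \<in> fst d \<longrightarrow>
           (\<forall>i<n. v d i = (\<Sum>j<n. partial j (\<lambda>x. transition c d x i) (snd c p) * v c j)))}"

definition linear_functional_on :: "'v::real_vector set \<Rightarrow> ('v \<Rightarrow> real) \<Rightarrow> bool"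
  where "linear_functional_on S f \<longleftrightarrow>
    (\<forall>v\<in>S. \<forall>w\<in>S. f (v + w) = f v + f w) \<and> (\<forall>r. \<forall>v\<in>S. f (r *\<^sub>R v) = r * f v)"

text \<open>Covectors are extended by 0 outside the tangent space, again to make equality extensional.\<close>

type_synonym 'a covec = "'a tvec \<Rightarrow> real"

definition cotangent_space :: "nat \<Rightarrow> 'a chart set \<Rightarrow> 'a \<Rightarrow> 'a covec set"
  where "cotangent_space n A p =
    {\<alpha>. linear_functional_on (tangent_space n A p) \<alpha> \<and> (\<forall>v. v \<notin> tangent_space n A p \<longrightarrow> \<alpha> v = 0)}"

definition tangent_bundle :: "'a topology \<Rightarrow> nat \<Rightarrow> 'a chart set \<Rightarrow> ('a \<times> 'a tvec) set"
  where "tangent_bundle X n A = Sigma (topspace X) (tangent_space n A)"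

section \<open>Smooth sections and subbundles\<close>

definition smooth_vector_field :: "nat \<Rightarrow> 'a chart set \<Rightarrow> 'a set \<Rightarrow> ('a \<Rightarrow> 'a tvec) \<Rightarrow> bool"
  where "smooth_vector_field n A W V \<longleftrightarrow>
    (\<forall>p\<in>W. V p \<in> tangent_space n A p) \<and>
    (\<forall>c\<in>A. \<forall>i<n. smooth_fun n A (W \<inter> fst c) (\<lambda>p. V p c i))"

text \<open>A field of covectors is smooth if it is smooth on all local smooth vector fields, in
  particular on the coordinate vector fields.\<close>

definition smooth_one_form ::
    "'a topology \<Rightarrow> nat \<Rightarrow> 'a chart set \<Rightarrow> 'a set \<Rightarrow> ('a \<Rightarrow> 'a covec) \<Rightarrow> bool"
  where "smooth_one_form X n A W \<alpha> \<longleftrightarrow>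
    (\<forall>p\<in>W. \<alpha> p \<in> cotangent_space n A p) \<and>
    (\<forall>W' V. openin X W' \<and> W' \<subseteq> W \<and> smooth_vector_field n A W' V \<longrightarrow>
       smooth_fun n A W' (\<lambda>p. \<alpha> p (V p)))"

definition smooth_generalized_section ::
    "'a topology \<Rightarrow> nat \<Rightarrow> 'a chart set \<Rightarrow> 'a set \<Rightarrow> ('a \<Rightarrow> 'a tvec \<times> 'a covec) \<Rightarrow> bool"
  where "smooth_generalized_section X n A W s \<longleftrightarrow>
    smooth_vector_field n A W (\<lambda>p. fst (s p)) \<and> smooth_one_form X n A W (\<lambda>p. snd (s p))"

text \<open>A subset of a bundle is a set of pairs (base point, vector), so that its fibre over p is the
  relational image of {p}. The predicate sec describes the smooth sections of the ambient bundle
  over an open set. Every point must have a neighbourhood with k smooth sections that form a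
  basis of the fibre at each point.\<close>

definition smooth_subbundle ::
    "'a topology \<Rightarrow> ('a set \<Rightarrow> ('a \<Rightarrow> 'v::real_vector) \<Rightarrow> bool) \<Rightarrow> nat \<Rightarrow> ('a \<times> 'v) set \<Rightarrow> bool"
  where "smooth_subbundle X sec k F \<longleftrightarrow>
    F \<subseteq> topspace X \<times> UNIV \<and>
    (\<forall>p\<in>topspace X. \<exists>W s. openin X W \<and> p \<in> W \<and> (\<forall>i<k. sec W (s i)) \<and>
       (\<forall>q\<in>W. inj_on (\<lambda>i. s i q) {..<k} \<and> independent ((\<lambda>i. s i q) ` {..<k}) \<and>
               span ((\<lambda>i. s i q) ` {..<k}) = F `` {q}))"

definition regular_distribution :: "'a topology \<Rightarrow> nat \<Rightarrow> 'a chart set \<Rightarrow> ('a \<times> 'a tvec) set \<Rightarrow> bool"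
  where "regular_distribution X n A F \<longleftrightarrow>
    (\<exists>k. smooth_subbundle X (smooth_vector_field n A) k F)"

section \<open>Almost Dirac structures\<close>

definition pairing :: "'a tvec \<times> 'a covec \<Rightarrow> 'a tvec \<times> 'a covec \<Rightarrow> real"
  where "pairing = (\<lambda>(v, \<alpha>) (w, \<beta>). \<alpha> w + \<beta> v)"

definition isotropic_subspace ::
    "('a tvec \<times> 'a covec) set \<Rightarrow> ('a tvec \<times> 'a covec) set \<Rightarrow> bool"
  where "isotropic_subspace E S \<longleftrightarrow>
    subspace S \<and> S \<subseteq> E \<and> (\<forall>u\<in>S. \<forall>w\<in>S. pairing u w = 0)"

definition maximal_isotropic ::
    "('a tvec \<times> 'a covec) set \<Rightarrow> ('a tvec \<times> 'a covec) set \<Rightarrow> bool"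
  where "maximal_isotropic E S \<longleftrightarrow>
    isotropic_subspace E S \<and> (\<forall>S'. isotropic_subspace E S' \<and> S \<subseteq> S' \<longrightarrow> S' = S)"

definition almost_dirac ::
    "'a topology \<Rightarrow> nat \<Rightarrow> 'a chart set \<Rightarrow> ('a \<times> 'a tvec \<times> 'a covec) set \<Rightarrow> bool"
  where "almost_dirac X n A L \<longleftrightarrow>
    (\<exists>k. smooth_subbundle X (smooth_generalized_section X n A) k L) \<and>
    (\<forall>p\<in>topspace X. maximal_isotropic (tangent_space n A p \<times> cotangent_space n A p) (L `` {p}))"

definition pr1 :: "('a \<times> 'a tvec \<times> 'a covec) set \<Rightarrow> ('a \<times> 'a tvec) set"
  where "pr1 L = (\<lambda>(p, v, \<alpha>). (p, v)) ` L"

definition regular_almost_dirac ::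
    "'a topology \<Rightarrow> nat \<Rightarrow> 'a chart set \<Rightarrow> ('a \<times> 'a tvec \<times> 'a covec) set \<Rightarrow> bool"
  where "regular_almost_dirac X n A L \<longleftrightarrow>
    almost_dirac X n A L \<and> (\<exists>r. \<forall>p\<in>topspace X. dim (pr1 L `` {p}) = r)"

section \<open>Two-forms on a distribution\<close>

text \<open>Smooth sections of the second exterior power of the dual of F. For F the tangent bundle these
  are the 2-forms on the manifold. The value 0 is taken when an argument is not in F.\<close>

type_synonym 'a form2 = "'a \<Rightarrow> 'a tvec \<Rightarrow> 'a tvec \<Rightarrow> real"

definition two_forms_on ::
    "'a topology \<Rightarrow> nat \<Rightarrow> 'a chart set \<Rightarrow> ('a \<times> 'a tvec) set \<Rightarrow> 'a form2 set"
  where "two_forms_on X n A F =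
    {\<Omega>. (\<forall>p v w. (p, v) \<notin> F \<or> (p, w) \<notin> F \<longrightarrow> \<Omega> p v w = 0) \<and>
        (\<forall>p\<in>topspace X. \<forall>v\<in>F `` {p}.
           \<Omega> p v v = 0 \<and>
           linear_functional_on (F `` {p}) (\<lambda>w. \<Omega> p v w) \<and>
           linear_functional_on (F `` {p}) (\<lambda>w. \<Omega> p w v)) \<and>
        (\<forall>W V V'. openin X W \<and> smooth_vector_field n A W V \<and> smooth_vector_field n A W V' \<and>
           (\<forall>p\<in>W. (p, V p) \<in> F \<and> (p, V' p) \<in> F) \<longrightarrow>
           smooth_fun n A W (\<lambda>p. \<Omega> p (V p) (V' p)))}"

definition restrict_form :: "'a form2 \<Rightarrow> ('a \<times> 'a tvec) set \<Rightarrow> 'a form2"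
  where "restrict_form \<Omega> F = (\<lambda>p v w. if (p, v) \<in> F \<and> (p, w) \<in> F then \<Omega> p v w else 0)"

end

theory Submission
  imports Defs
begin

text \<open>A maximal isotropic subspace L of \<open>T \<oplus> T*\<close> is determined by its projection F to T and the
  2-form \<open>\<Omega>(v, w) = \<alpha>(w)\<close> for \<open>(v, \<alpha>) \<in> L\<close> and \<open>w \<in> F\<close>: it is contained in the isotropic
  subspace of all \<open>(v, \<alpha>)\<close> with \<open>v \<in> F\<close> and \<open>\<alpha>|F = \<Omega>(v, \<cdot>)\<close>, hence equal to it. Smoothness in both
  directions comes from local dual frames \<open>(t, \<sigma>)\<close> of the tangent bundle whose first members span F.
  They are obtained from a coordinate frame by exchanging one vector at a time, which also shows
  that coefficients with respect to a smooth frame are smooth. For the extension of a form, a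
  partition of unity turns the local projections \<open>v \<mapsto> (\<Sum>i<r. \<sigma> i v *\<^sub>R t i)\<close> into
  a smooth projection P of the tangent bundle onto F; then \<open>\<Omega>(v, w) = \<Omega>\<^sub>F(P v, P w)\<close>.\<close>

section \<open>Calculus with iterated partial derivatives\<close>

text \<open>The delicate point is that the distribution and the form of a regular \<open>L\<close>
  are smooth, because regularity is only a pointwise condition on dimensions. A smooth frame of
  \<open>L\<close> projects to vector fields that span \<open>pr1 L\<close> but are in general
  dependent. At a point p some r of them form a basis; independence is an open condition, and the
  constant dimension r keeps the fibre from growing, so the same r fields span \<open>pr1 L\<close>
  nearby. Their covector parts belong to the same sections, so they are smooth and compute the form.
  Openness of independence would ordinarily be read off a determinant; here the dual covectors
  witness it. They also describe F by equations and give the Dirac structure of a form a frame of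
  rank n, whatever the rank of F. Local projections onto F are far from unique, but the two
  conditions that P takes values in F and fixes F survive every combination with weights of sum 1,
  so projections can be glued where frames could not.\<close>

lemma Euclidean_space_eq_top_of_set: "Euclidean_space n = top_of_set {x. \<forall>i\<ge>n. x i = 0}"
  by (simp add: Euclidean_space_def euclidean_product_topology)

lemma openin_Euclidean_space_zero:
  "openin (Euclidean_space n) V \<Longrightarrow> x \<in> V \<Longrightarrow> i \<ge> n \<Longrightarrow> x i = 0"
  using openin_subset[of "Euclidean_space n" V] by (auto simp: topspace_Euclidean_space)

lemma continuous_map_Euclidean_subspace:
  assumes "openin (Euclidean_space n) V"
  shows "continuous_map (subtopology (Euclidean_space n) V) euclideanreal f \<longleftrightarrow> continuous_on V f"
proof -
  have "V \<subseteq> {x. \<forall>i\<ge>n. x i = 0}"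
    using openin_Euclidean_space_zero[OF assms] by blast
  then have "subtopology (Euclidean_space n) V = top_of_set V"
    by (simp add: Euclidean_space_eq_top_of_set subtopology_subtopology inf.absorb2)
  then show ?thesis by simp
qed

text \<open>Only the coordinates below n are constrained: the others vanish at x and at every
  admissible y, so they lie in their factors automatically. Hence a finite minimum of radii suffices
  although the ambient product is infinite.\<close>

lemma Euclidean_space_open_box:
  assumes V: "openin (Euclidean_space n) V" and x: "x \<in> V"
  shows "\<exists>e>0. \<forall>y. (\<forall>i\<ge>n. y i = 0) \<and> (\<forall>i<n. \<bar>y i - x i\<bar> < e) \<longrightarrow> y \<in> V"
proof -
  obtain T where T: "openin (powertop_real UNIV) T" and VT: "V = T \<inter> {x. \<forall>i\<ge>n. x i = 0}"
    using V unfolding Euclidean_space_def openin_subtopology by auto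
  obtain B where B: "x \<in> (\<Pi>\<^sub>E i\<in>UNIV. B i)" "\<And>i. openin euclideanreal (B i)" "(\<Pi>\<^sub>E i\<in>UNIV. B i) \<subseteq> T"
    using product_topology_open_contains_basis[OF T, of x] x VT by auto
  have "\<exists>e>0. \<forall>t. \<bar>t - x i\<bar> < e \<longrightarrow> t \<in> B i" for i
  proof -
    have "x i \<in> B i" "open (B i)" using B by (auto simp: PiE_iff)
    then show ?thesis unfolding open_dist dist_real_def by blast
  qed
  then obtain d where d: "\<And>i. d i > 0" "\<And>i t. \<bar>t - x i\<bar> < d i \<Longrightarrow> t \<in> B i" by metis
  \<comment> \<open>The extra element 1 keeps the set nonempty when n = 0.\<close>
  define e where "e = Min (insert 1 (d ` {..<n}))"
  have "e > 0" unfolding e_def using d(1) by (subst Min_gr_iff) auto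
  moreover have "e \<le> d i" if "i < n" for i unfolding e_def using that by (intro Min_le) auto
  moreover have "y \<in> V" if "\<forall>i\<ge>n. y i = 0" "\<forall>i<n. \<bar>y i - x i\<bar> < e" for y
  proof -
    have "y i \<in> B i" for i
    proof (cases "i < n")
      case True
      then show ?thesis using that(2) \<open>\<And>i. i < n \<Longrightarrow> e \<le> d i\<close> by (intro d(2)) force
    next
      case False
      then have "y i = x i" using that(1) openin_Euclidean_space_zero[OF V x] by simp
      then show ?thesis by (intro d(2)) (simp add: d(1))
    qed
    then have "y \<in> T" using B(3) by (auto simp: PiE_iff)
    then show ?thesis using VT that by simp
  qed
  ultimately show ?thesis by blast
qed

lemma eventually_update_in_open:
  assumes "openin (Euclidean_space n) V" "x \<in> V" "i < n"
  shows "\<forall>\<^sub>F t in nhds (x i). x(i := t) \<in> V"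
proof -
  obtain e where "e > 0" and e: "\<And>y. (\<forall>i\<ge>n. y i = 0) \<and> (\<forall>i<n. \<bar>y i - x i\<bar> < e) \<Longrightarrow> y \<in> V"
    using Euclidean_space_open_box[OF assms(1,2)] by blast
  have "x(i := t) \<in> V" if "dist t (x i) < e" for t
    using that assms openin_Euclidean_space_zero[OF assms(1,2)] \<open>e > 0\<close>
    by (intro e) (auto simp: dist_real_def)
  then show ?thesis unfolding eventually_nhds_metric using \<open>e > 0\<close> by blast
qed

text \<open>A coordinate line through a point of \<open>V\<close> stays in \<open>V\<close> for a
  while, so the derivative sees only values on \<open>V\<close>. Functions transported by charts are
  controlled only there.\<close>

lemma DERIV_update_cong:
  assumes "openin (Euclidean_space n) V" "x \<in> V" "i < n" "\<And>y. y \<in> V \<Longrightarrow> f y = g y"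
  shows "DERIV (\<lambda>t. f (x(i := t))) (x i) :> D \<longleftrightarrow> DERIV (\<lambda>t. g (x(i := t))) (x i) :> D"
  by (rule DERIV_cong_ev)
    (use eventually_update_in_open[OF assms(1-3)] assms(4) in \<open>auto elim: eventually_mono\<close>)

lemma partial_cong:
  assumes "openin (Euclidean_space n) V" "x \<in> V" "i < n" "\<And>y. y \<in> V \<Longrightarrow> f y = g y"
  shows "partial i f x = partial i g x"
  unfolding partial_def
  by (rule deriv_cong_ev)
    (use eventually_update_in_open[OF assms(1-3)] assms(4) in \<open>auto elim: eventually_mono\<close>)

lemma DERIV_partial:
  "(\<lambda>t. f (x(i := t))) field_differentiable (at (x i)) \<longleftrightarrow>
     DERIV (\<lambda>t. f (x(i := t))) (x i) :> partial i f x"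
  unfolding partial_def by (simp add: DERIV_deriv_iff_field_differentiable)

lemma partial_eqI: "DERIV (\<lambda>t. f (x(i := t))) (x i) :> D \<Longrightarrow> partial i f x = D"
  unfolding partial_def by (rule DERIV_imp_deriv)

section \<open>Differentiability of finite order\<close>

text \<open>Lists of differentiations do not suit the product and chain rules, where one derivative
  produces several terms. The order k allows an induction with one differentiation per step; all k
  together give smoothness.\<close>

primrec Ck_on :: "nat \<Rightarrow> (nat \<Rightarrow> real) set \<Rightarrow> nat \<Rightarrow> ((nat \<Rightarrow> real) \<Rightarrow> real) \<Rightarrow> bool" where
  "Ck_on n V 0 f \<longleftrightarrow> continuous_on V f"
| "Ck_on n V (Suc k) f \<longleftrightarrow> continuous_on V f \<and>
     (\<forall>i<n. (\<forall>x\<in>V. DERIV (\<lambda>t. f (x(i := t))) (x i) :> partial i f x) \<and> Ck_on n V k (partial i f))"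

lemma Ck_on_imp_continuous: "Ck_on n V k f \<Longrightarrow> continuous_on V f"
  by (cases k) auto

lemma Ck_on_Suc_imp: "Ck_on n V (Suc k) f \<Longrightarrow> Ck_on n V k f"
proof (induction k arbitrary: f)
  case (Suc k)
  then show ?case by (metis Ck_on.simps(2))
qed simp

lemma Ck_on_cong:
  assumes "openin (Euclidean_space n) V" "\<And>x. x \<in> V \<Longrightarrow> f x = g x"
  shows "Ck_on n V k f \<longleftrightarrow> Ck_on n V k g"
  using assms(2)
proof (induction k arbitrary: f g)
  case 0
  then show ?case by (simp cong: continuous_on_cong)
next
  case (Suc k)
  have p: "partial i f x = partial i g x" if "x \<in> V" "i < n" for i x
    using partial_cong[OF assms(1) that Suc.prems] .
  have c: "continuous_on V f \<longleftrightarrow> continuous_on V g"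
    using Suc.prems by (simp cong: continuous_on_cong)
  have "(\<forall>x\<in>V. DERIV (\<lambda>t. f (x(i := t))) (x i) :> partial i f x) \<longleftrightarrow>
        (\<forall>x\<in>V. DERIV (\<lambda>t. g (x(i := t))) (x i) :> partial i g x)" if "i < n" for i
  proof (intro ball_cong refl)
    fix x assume x: "x \<in> V"
    show "(DERIV (\<lambda>t. f (x(i := t))) (x i) :> partial i f x) \<longleftrightarrow>
        (DERIV (\<lambda>t. g (x(i := t))) (x i) :> partial i g x)"
      unfolding p[OF x that] by (rule DERIV_update_cong[OF assms(1) x that Suc.prems])
  qed
  moreover have "Ck_on n V k (partial i f) \<longleftrightarrow> Ck_on n V k (partial i g)" if "i < n" for i
    by (intro Suc.IH p that)
  ultimately show ?case
    unfolding Ck_on.simps c by blast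
qed

text \<open>Formulas for \<open>partial i f\<close> hold only on \<open>V\<close>. This rule lets a
  candidate \<open>g i\<close> stand for it, so that each closure property reduces to a
  \<open>DERIV\<close> fact and the order k of the candidate.\<close>

lemma Ck_on_SucI:
  assumes "openin (Euclidean_space n) V" "continuous_on V f"
    and D: "\<And>i x. i < n \<Longrightarrow> x \<in> V \<Longrightarrow> DERIV (\<lambda>t. f (x(i := t))) (x i) :> g i x"
    and "\<And>i. i < n \<Longrightarrow> Ck_on n V k (g i)"
  shows "Ck_on n V (Suc k) f"
proof -
  have "partial i f x = g i x" if "i < n" "x \<in> V" for i x
    using D[OF that] by (rule partial_eqI)
  moreover from this have "Ck_on n V k (partial i f)" if "i < n" for i
    using that assms(4)[OF that] Ck_on_cong[OF assms(1), of "partial i f" "g i" k] by simp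
  ultimately show ?thesis
    using assms(2) D by simp
qed

text \<open>\<open>foldr\<close> applies the last entry of the list first, so the recursion of
  \<open>Ck_on\<close> peels the list from its end. The condition \<open>length js < k\<close>
  reflects that derivatives of order k need only be continuous.\<close>

lemma Ck_on_iff_foldr:
  "Ck_on n V k f \<longleftrightarrow> (\<forall>js. set js \<subseteq> {..<n} \<and> length js \<le> k \<longrightarrow>
     continuous_on V (foldr partial js f) \<and>
     (length js < k \<longrightarrow> (\<forall>x\<in>V. \<forall>i<n.
        DERIV (\<lambda>t. foldr partial js f (x(i := t))) (x i) :> partial i (foldr partial js f) x)))"
    (is "_ \<longleftrightarrow> ?R k f")
proof (induction k arbitrary: f)
  case 0
  show ?case by auto
next
  case (Suc k)
  show ?case
  proof
    assume L: "Ck_on n V (Suc k) f"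
    show "?R (Suc k) f"
    proof (intro allI impI, elim conjE)
      fix js assume js: "set js \<subseteq> {..<n}" "length js \<le> Suc k"
      show "continuous_on V (foldr partial js f) \<and>
        (length js < Suc k \<longrightarrow> (\<forall>x\<in>V. \<forall>i<n.
        DERIV (\<lambda>t. foldr partial js f (x(i := t))) (x i) :> partial i (foldr partial js f) x))"
      proof (cases js rule: rev_cases)
        case Nil
        then show ?thesis using L by auto
      next
        case (snoc js' j)
        then have "?R k (partial j f)" using L Suc.IH js by auto
        from this[rule_format, of js'] show ?thesis using js snoc by simp
      qed
    qed
  next
    assume R: "?R (Suc k) f"
    have "Ck_on n V k (partial j f)" if "j < n" for j
      unfolding Suc.IH
    proof (intro allI impI, elim conjE)
      fix js assume "set js \<subseteq> {..<n}" "length js \<le> k"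
      then show "continuous_on V (foldr partial js (partial j f)) \<and>
        (length js < k \<longrightarrow> (\<forall>x\<in>V. \<forall>i<n.
        DERIV (\<lambda>t. foldr partial js (partial j f) (x(i := t))) (x i) :>
          partial i (foldr partial js (partial j f)) x))"
        using R[rule_format, of "js @ [j]"] that by simp
    qed
    then show "Ck_on n V (Suc k) f" using R[rule_format, of "[]"] by simp
  qed
qed

lemma smooth_on_iff_Ck_on:
  assumes "openin (Euclidean_space n) V"
  shows "smooth_on n V f \<longleftrightarrow> (\<forall>k. Ck_on n V k f)"
  unfolding smooth_on_def continuous_map_Euclidean_subspace[OF assms] DERIV_partial Ck_on_iff_foldr
  by (meson lessI less_imp_le)

lemma smooth_on_cong:
  assumes "openin (Euclidean_space n) V" "\<And>x. x \<in> V \<Longrightarrow> f x = g x"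
  shows "smooth_on n V f \<longleftrightarrow> smooth_on n V g"
  using Ck_on_cong[OF assms] by (simp add: smooth_on_iff_Ck_on assms(1))

lemma smooth_on_eq:
  assumes "openin (Euclidean_space n) V" "smooth_on n V f" "\<And>x. x \<in> V \<Longrightarrow> g x = f x"
  shows "smooth_on n V g"
  using smooth_on_cong[OF assms(1), of g f] assms(2,3) by blast

lemma smooth_on_partial:
  assumes "smooth_on n V f" "i < n"
  shows "smooth_on n V (partial i f)"
  unfolding smooth_on_def
proof (intro allI impI)
  fix js assume "set js \<subseteq> {..<n}"
  then show "continuous_map (subtopology (Euclidean_space n) V) euclideanreal (foldr partial js (partial i f)) \<and>
       (\<forall>x\<in>V. \<forall>j<n. (\<lambda>t. foldr partial js (partial i f) (x(j := t))) field_differentiable (at (x j)))"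
    using assms(1)[unfolded smooth_on_def, rule_format, of "js @ [i]"] assms(2) by simp
qed

lemma smooth_on_imp_continuous_on:
  assumes "openin (Euclidean_space n) V" "smooth_on n V f"
  shows "continuous_on V f"
  using assms smooth_on_iff_Ck_on[OF assms(1)] Ck_on_imp_continuous by blast

lemma smooth_on_subset:
  assumes "smooth_on n V f" "openin (Euclidean_space n) W" "W \<subseteq> V" 
  shows "smooth_on n W f"
  using assms unfolding smooth_on_def
  by (meson continuous_map_from_subtopology_mono subsetD)

lemma smooth_on_local:
  assumes V: "openin (Euclidean_space n) V"
    and loc: "\<And>x. x \<in> V \<Longrightarrow> \<exists>W. openin (Euclidean_space n) W \<and> x \<in> W \<and> smooth_on n W f"
  shows "smooth_on n V f"
  unfolding smooth_on_def
proof (intro allI impI conjI ballI)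
  fix js assume js: "set js \<subseteq> {..<n}"
  let ?g = "foldr partial js f"
  show "(\<lambda>t. ?g (x(i := t))) field_differentiable (at (x i))" if "x \<in> V" "i < n" for x i
    using loc[OF that(1)] js that(2) unfolding smooth_on_def by blast
  have "continuous_on V ?g"
    unfolding continuous_on_topological
  proof (intro ballI allI impI)
    fix x and B :: "real set" assume x: "x \<in> V" and B: "open B" "?g x \<in> B"
    obtain W where W: "openin (Euclidean_space n) W" "x \<in> W" "smooth_on n W f"
      using loc[OF x] by blast
    then have "continuous_on W ?g"
      using js continuous_map_Euclidean_subspace[OF W(1)] unfolding smooth_on_def by blast
    then obtain C where C: "open C" "x \<in> C" "\<forall>y\<in>W. y \<in> C \<longrightarrow> ?g y \<in> B"
      using B W(2) unfolding continuous_on_topological by blast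
    obtain T where T: "open T" "W = {x. \<forall>i\<ge>n. x i = 0} \<inter> T"
      using W(1) unfolding Euclidean_space_eq_top_of_set openin_open by blast
    \<comment> \<open>\<open>T\<close> is an open set of the full function space with trace
      \<open>W\<close>; intersecting with it turns continuity relative to \<open>W\<close> into
      continuity relative to \<open>V\<close>.\<close>
    have "\<forall>y\<in>V. y \<in> C \<inter> T \<longrightarrow> ?g y \<in> B"
      using C(3) T(2) openin_Euclidean_space_zero[OF V] by blast
    then show "\<exists>A. open A \<and> x \<in> A \<and> (\<forall>y\<in>V. y \<in> A \<longrightarrow> ?g y \<in> B)"
      using C T W(2) by (intro exI[of _ "C \<inter> T"]) auto
  qed
  then show "continuous_map (subtopology (Euclidean_space n) V) euclideanreal ?g"
    using continuous_map_Euclidean_subspace[OF V] by blast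
qed

lemma Ck_on_const:
  assumes "openin (Euclidean_space n) V"
  shows "Ck_on n V k (\<lambda>x. c)"
proof (induction k arbitrary: c)
  case (Suc k)
  show ?case
    by (rule Ck_on_SucI[OF assms, where g = "\<lambda>_ _. 0"]) (use Suc in auto)
qed simp

lemma Ck_on_coordinate:
  assumes "openin (Euclidean_space n) V" "j < n"
  shows "Ck_on n V k (\<lambda>x. x j)"
proof (cases k)
  case 0
  then show ?thesis using continuous_on_product_then_coordinatewise[OF continuous_on_id] by simp
next
  case (Suc k)
  show ?thesis unfolding Suc
  proof (rule Ck_on_SucI[OF assms(1), where g = "\<lambda>i _. if i = j then 1 else 0"])
    show "DERIV (\<lambda>t. (x(i := t)) j) (x i) :> (if i = j then 1 else 0)" for i x
      by (cases "i = j") (auto intro!: derivative_eq_intros)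
  qed (use continuous_on_product_then_coordinatewise[OF continuous_on_id] Ck_on_const[OF assms(1)] in auto)
qed

lemma Ck_on_add:
  assumes V: "openin (Euclidean_space n) V" and "Ck_on n V k f" "Ck_on n V k g"
  shows "Ck_on n V k (\<lambda>x. f x + g x)"
  using assms(2,3)
proof (induction k arbitrary: f g)
  case 0
  then show ?case by (auto intro: continuous_intros)
next
  case (Suc k)
  show ?case
  proof (rule Ck_on_SucI[OF V, where g = "\<lambda>i x. partial i f x + partial i g x"])
    show "continuous_on V (\<lambda>x. f x + g x)" using Suc.prems by (auto intro: continuous_intros)
    show "Ck_on n V k (\<lambda>x. partial i f x + partial i g x)" if "i < n" for i
      using Suc.IH Suc.prems that by auto
    show "DERIV (\<lambda>t. f (x(i := t)) + g (x(i := t))) (x i) :> partial i f x + partial i g x"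
      if "i < n" "x \<in> V" for i x
      using Suc.prems that by (intro derivative_intros) auto
  qed
qed

lemma Ck_on_mult:
  assumes V: "openin (Euclidean_space n) V" and "Ck_on n V k f" "Ck_on n V k g"
  shows "Ck_on n V k (\<lambda>x. f x * g x)"
  using assms(2,3)
proof (induction k arbitrary: f g)
  case 0
  then show ?case by (auto intro: continuous_intros)
next
  case (Suc k)
  show ?case
  proof (rule Ck_on_SucI[OF V, where g = "\<lambda>i x. partial i f x * g x + partial i g x * f x"])
    show "continuous_on V (\<lambda>x. f x * g x)" using Suc.prems by (auto intro: continuous_intros)
    show "Ck_on n V k (\<lambda>x. partial i f x * g x + partial i g x * f x)" if "i < n" for i
      using Suc.IH Suc.prems that Ck_on_Suc_imp by (intro Ck_on_add[OF V]) auto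
    show "DERIV (\<lambda>t. f (x(i := t)) * g (x(i := t))) (x i) :> partial i f x * g x + partial i g x * f x"
      if "i < n" "x \<in> V" for i x
    proof -
      have "DERIV (\<lambda>t. f (x(i := t))) (x i) :> partial i f x" 
           "DERIV (\<lambda>t. g (x(i := t))) (x i) :> partial i g x"
        using Suc.prems that by auto
      from DERIV_mult[OF this] show ?thesis by simp
    qed
  qed
qed

lemma Ck_on_sum:
  assumes V: "openin (Euclidean_space n) V" and "finite I" "\<And>i. i \<in> I \<Longrightarrow> Ck_on n V k (f i)"
  shows "Ck_on n V k (\<lambda>x. \<Sum>i\<in>I. f i x)"
  using assms(2,3)
  by (induction I) (auto intro: Ck_on_const[OF V] Ck_on_add[OF V])

text \<open>The one-variable function is given together with all its derivatives.\<close>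

lemma Ck_on_compose_real:
  fixes h :: "nat \<Rightarrow> real \<Rightarrow> real"
  assumes V: "openin (Euclidean_space n) V" and f: "Ck_on n V k f"
    and h: "\<And>m x. x \<in> V \<Longrightarrow> DERIV (h m) (f x) :> h (Suc m) (f x)"
  shows "Ck_on n V k (\<lambda>x. h m (f x))"
  using f h
proof (induction k arbitrary: m)
  case 0
  have "isCont (h m) (f x)" if "x \<in> V" for x using 0(2)[OF that] by (rule DERIV_isCont)
  then have "continuous_on (f ` V) (h m)" by (auto intro!: continuous_at_imp_continuous_on)
  then show ?case using 0 continuous_on_compose[of V f "h m"] by (simp add: comp_def)
next
  case (Suc k)
  have "continuous_on (f ` V) (h m)"
    using Suc.prems(2) by (intro continuous_at_imp_continuous_on) (auto intro: DERIV_isCont)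
  then have c: "continuous_on V (\<lambda>x. h m (f x))"
    using Suc.prems(1) continuous_on_compose[of V f "h m"] by (simp add: comp_def)
  show ?case
  proof (rule Ck_on_SucI[OF V c, where g = "\<lambda>i x. h (Suc m) (f x) * partial i f x"])
    show "DERIV (\<lambda>t. h m (f (x(i := t)))) (x i) :> h (Suc m) (f x) * partial i f x"
      if "i < n" "x \<in> V" for i x
    proof (rule DERIV_chain2[where f = "h m"])
      show "DERIV (h m) (f (x(i := x i))) :> h (Suc m) (f x)" using Suc.prems(2) that by simp
    qed (use Suc.prems(1) that in auto)
    show "Ck_on n V k (\<lambda>x. h (Suc m) (f x) * partial i f x)" if "i < n" for i
      using Suc.prems that Ck_on_Suc_imp[OF Suc.prems(1)]
      by (intro Ck_on_mult[OF V] Suc.IH) auto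
  qed
qed

section \<open>Mean value theorem and chain rule\<close>

text \<open>Increments along a curve may have either sign or vanish; the absolute values spare the
  user that case distinction, and for \<open>a = b\<close> the point a itself serves.\<close>

lemma mean_value_segment:
  fixes g :: "real \<Rightarrow> real"
  assumes "\<And>s. \<bar>s - a\<bar> \<le> \<bar>b - a\<bar> \<Longrightarrow> DERIV g s :> g' s"
  shows "\<exists>\<xi>. \<bar>\<xi> - a\<bar> \<le> \<bar>b - a\<bar> \<and> g b - g a = g' \<xi> * (b - a)"
proof -
  consider "a < b" | "b < a" | "a = b" by linarith
  then show ?thesis
  proof cases
    case 1
    obtain \<xi> where "a < \<xi>" "\<xi> < b" "g b - g a = (b - a) * g' \<xi>"
      using MVT2[OF 1, of g g'] assms by force
    then show ?thesis by (intro exI[of _ \<xi>]) (auto simp: mult.commute)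
  next
    case 2
    obtain \<xi> where "b < \<xi>" "\<xi> < a" "g a - g b = (a - b) * g' \<xi>"
      using MVT2[OF 2, of g g'] assms by force
    then show ?thesis by (intro exI[of _ \<xi>]) (auto simp: algebra_simps)
  qed auto
qed

text \<open>Moving from \<open>\<gamma> t0\<close> to \<open>\<gamma> t\<close> one coordinate at a time reduces the chain rule to the
  mean value theorem in each coordinate.\<close>

lemma DERIV_along_curve:
  assumes V: "openin (Euclidean_space n) V" and f: "Ck_on n V (Suc 0) f"
    and \<gamma>V: "\<forall>\<^sub>F t in nhds t0. \<gamma> t \<in> V"
    and \<gamma>': "\<And>j. j < n \<Longrightarrow> DERIV (\<lambda>t. \<gamma> t j) t0 :> \<gamma>' j"
  shows "DERIV (\<lambda>t. f (\<gamma> t)) t0 :> (\<Sum>j<n. partial j f (\<gamma> t0) * \<gamma>' j)"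
proof -
  define y where "y = \<gamma> t0"
  have yV: "y \<in> V" unfolding y_def using \<gamma>V by (rule eventually_nhds_x_imp_x)
  \<comment> \<open>\<open>z j t\<close> is the corner after j moves: new coordinates below j, those
    of \<open>y\<close> from j on, in particular 0 from n on.\<close>
  define z where "z j t = (\<lambda>i. if i < j then \<gamma> t i else y i)" for j t
  have near: "\<forall>\<^sub>F t in nhds t0. \<forall>i\<in>{..<n}. \<bar>\<gamma> t i - y i\<bar> < d" if "d > 0" for d
  proof (intro eventually_ball_finite ballI)
    fix i assume "i \<in> {..<n}"
    then have "((\<lambda>t. \<gamma> t i) \<longlongrightarrow> y i) (nhds t0)"
      using DERIV_isCont[OF \<gamma>'] tendsto_at_iff_tendsto_nhds[of "\<lambda>t. \<gamma> t i" t0]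
      unfolding y_def isCont_def by simp
    then have "\<forall>\<^sub>F t in nhds t0. dist (\<gamma> t i) (y i) < d"
      using that by (rule tendstoD)
    then show "\<forall>\<^sub>F t in nhds t0. \<bar>\<gamma> t i - y i\<bar> < d" by (simp add: dist_real_def)
  qed simp
  have y0: "y i = 0" if "i \<ge> n" for i using openin_Euclidean_space_zero[OF V yV that] .
  have "DERIV (\<lambda>t. f (z j t)) t0 :> (\<Sum>l<j. partial l f y * \<gamma>' l)" if "j \<le> n" for j
    using that
  proof (induction j)
    case 0
    then show ?case by (simp add: z_def)
  next
    case (Suc j)
    then have j: "j < n" by simp
    define D where "D t = f (z (Suc j) t) - f (z j t)" for t
    obtain e where e: "e > 0" "\<And>x. (\<forall>i\<ge>n. x i = 0) \<and> (\<forall>i<n. \<bar>x i - y i\<bar> < e) \<Longrightarrow> x \<in> V"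
      using Euclidean_space_open_box[OF V yV] by blast
    have "\<exists>\<xi>. \<bar>\<xi> - y j\<bar> \<le> \<bar>\<gamma> t j - y j\<bar> \<and> D t = partial j f ((z j t)(j := \<xi>)) * (\<gamma> t j - y j)"
      if t: "\<forall>i\<in>{..<n}. \<bar>\<gamma> t i - y i\<bar> < e" for t
    proof -
      have "DERIV (\<lambda>s. f ((z j t)(j := s))) s :> partial j f ((z j t)(j := s))"
        if s: "\<bar>s - y j\<bar> \<le> \<bar>\<gamma> t j - y j\<bar>" for s
      proof -
        have "(z j t)(j := s) \<in> V"
        proof (intro e(2) conjI allI impI)
          show "((z j t)(j := s)) i = 0" if "i \<ge> n" for i using that j y0 by (simp add: z_def)
          show "\<bar>((z j t)(j := s)) i - y i\<bar> < e" if "i < n" for i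
            using that t s e(1) order.strict_trans1[OF s, of e] j by (auto simp: z_def)
        qed
        with f j show ?thesis by force
      qed
      from mean_value_segment[OF this]
      obtain \<xi> where \<xi>: "\<bar>\<xi> - y j\<bar> \<le> \<bar>\<gamma> t j - y j\<bar>"
        "f ((z j t)(j := \<gamma> t j)) - f ((z j t)(j := y j)) = partial j f ((z j t)(j := \<xi>)) * (\<gamma> t j - y j)"
        by blast
      moreover have "(z j t)(j := \<gamma> t j) = z (Suc j) t" "(z j t)(j := y j) = z j t"
        by (auto simp: z_def fun_eq_iff)
      ultimately show ?thesis unfolding D_def by metis
    qed
    \<comment> \<open>\<open>\<xi>\<close> is chosen separately for each t, without any continuity.
      It is only known to be as close to \<open>y j\<close> as \<open>\<gamma> t j\<close> is;
      continuity of \<open>partial j f\<close> at \<open>y\<close> does the rest.\<close>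
    then obtain \<xi> where \<xi>: "\<And>t. \<forall>i\<in>{..<n}. \<bar>\<gamma> t i - y i\<bar> < e \<Longrightarrow> \<bar>\<xi> t - y j\<bar> \<le> \<bar>\<gamma> t j - y j\<bar>"
       "\<And>t. \<forall>i\<in>{..<n}. \<bar>\<gamma> t i - y i\<bar> < e \<Longrightarrow> D t = partial j f ((z j t)(j := \<xi> t)) * (\<gamma> t j - y j)"
      by metis
    have lim: "((\<lambda>t. partial j f ((z j t)(j := \<xi> t))) \<longlongrightarrow> partial j f y) (nhds t0)"
    proof (rule tendstoI)
      fix \<epsilon> :: real assume "\<epsilon> > 0"
      define U where "U = V \<inter> partial j f -` ball (partial j f y) \<epsilon>"
      have "continuous_on V (partial j f)" using f j by auto
      then have "openin (top_of_set V) U"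
        unfolding U_def by (intro continuous_openin_preimage_gen) auto
      then have "openin (Euclidean_space n) U"
        using V by (metis (no_types, lifting) Euclidean_space_eq_top_of_set openin_trans)
      moreover have "y \<in> U" using yV \<open>\<epsilon> > 0\<close> by (simp add: U_def)
      ultimately obtain d where d: "d > 0"
          "\<And>x. (\<forall>i\<ge>n. x i = 0) \<and> (\<forall>i<n. \<bar>x i - y i\<bar> < d) \<Longrightarrow> x \<in> U"
        using Euclidean_space_open_box by blast
      show "\<forall>\<^sub>F t in nhds t0. dist (partial j f ((z j t)(j := \<xi> t))) (partial j f y) < \<epsilon>"
        using near[OF e(1)] near[OF d(1)]
      proof eventually_elim
        case (elim t)
        have "(z j t)(j := \<xi> t) \<in> U"
        proof (intro d(2) conjI allI impI)
          show "((z j t)(j := \<xi> t)) i = 0" if "i \<ge> n" for i using that j y0 by (simp add: z_def)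
          have "\<bar>\<xi> t - y j\<bar> < d" using \<xi>(1)[OF elim(1)] elim(2) j by force
          then show "\<bar>((z j t)(j := \<xi> t)) i - y i\<bar> < d" if "i < n" for i
            using that elim(2) d(1) by (auto simp: z_def)
        qed
        then show ?case by (simp add: U_def dist_commute)
      qed
    qed
    have "((\<lambda>t. (D t - D t0) / (t - t0)) \<longlongrightarrow> partial j f y * \<gamma>' j) (at t0)"
    proof (rule Lim_transform_eventually)
      have "((\<lambda>t. (\<gamma> t j - y j) / (t - t0)) \<longlongrightarrow> \<gamma>' j) (at t0)"
        using \<gamma>'[OF j] unfolding has_field_derivative_iff y_def .
      then show "((\<lambda>t. partial j f ((z j t)(j := \<xi> t)) * ((\<gamma> t j - y j) / (t - t0))) \<longlongrightarrow>
          partial j f y * \<gamma>' j) (at t0)"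
        by (intro tendsto_mult) (use filterlim_mono[OF lim order.refl at_within_le_nhds] in auto)
      have "z (Suc j) t0 = z j t0" by (auto simp: z_def y_def fun_eq_iff)
      then have "D t0 = 0" by (simp add: D_def)
      have "\<forall>\<^sub>F t in at t0. \<forall>i\<in>{..<n}. \<bar>\<gamma> t i - y i\<bar> < e"
        using near[OF e(1)] filter_leD[OF at_within_le_nhds] by blast
      then show "\<forall>\<^sub>F t in at t0. partial j f ((z j t)(j := \<xi> t)) * ((\<gamma> t j - y j) / (t - t0)) =
          (D t - D t0) / (t - t0)"
        by eventually_elim (use \<open>D t0 = 0\<close> \<xi>(2) in auto)
    qed
    then have "DERIV D t0 :> partial j f y * \<gamma>' j" by (simp add: has_field_derivative_iff)
    from DERIV_add[OF Suc.IH this] j show ?case by (simp add: D_def)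
  qed
  from this[OF order.refl] have *: "DERIV (\<lambda>t. f (z n t)) t0 :> (\<Sum>j<n. partial j f (\<gamma> t0) * \<gamma>' j)"
    by (simp add: y_def)
  have "\<forall>\<^sub>F t in nhds t0. f (z n t) = f (\<gamma> t)"
    using \<gamma>V
  proof eventually_elim
    case (elim t)
    have "z n t = \<gamma> t"
      using y0 openin_Euclidean_space_zero[OF V elim] by (auto simp: z_def fun_eq_iff)
    then show ?case by simp
  qed
  from DERIV_cong_ev[OF refl this refl] * show ?thesis by blast
qed

lemma DERIV_compose_map:
  assumes U: "openin (Euclidean_space n) U" and V: "openin (Euclidean_space n) V"
    and G: "\<And>x. x \<in> U \<Longrightarrow> G x \<in> V" and f: "Ck_on n V (Suc 0) f"
    and dG: "\<And>j. j < n \<Longrightarrow> Ck_on n U (Suc 0) (\<lambda>x. G x j)"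
    and i: "i < n" and x: "x \<in> U"
  shows "DERIV (\<lambda>t. f (G (x(i := t)))) (x i) :> (\<Sum>j<n. partial j f (G x) * partial i (\<lambda>x. G x j) x)"
proof -
  have "\<forall>\<^sub>F t in nhds (x i). G (x(i := t)) \<in> V"
    using eventually_update_in_open[OF U x i] by eventually_elim (rule G)
  from DERIV_along_curve[OF V f this, of "\<lambda>j. partial i (\<lambda>x. G x j) x"]
  show ?thesis using dG i x by simp
qed

text \<open>By the chain rule each partial derivative of the composite is a sum of products of
  \<open>partial j f\<close> after G, covered by the induction hypothesis, with first partial
  derivatives of G, whose order is one less than that of G.\<close>

lemma Ck_on_compose_map:
  assumes U: "openin (Euclidean_space n) U" and V: "openin (Euclidean_space n) V"
    and G: "\<And>x. x \<in> U \<Longrightarrow> G x \<in> V" and "Ck_on n V k f"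
    and "\<And>j. j < n \<Longrightarrow> Ck_on n U k (\<lambda>x. G x j)"
  shows "Ck_on n U k (\<lambda>x. f (G x))"
proof -
  have cont: "continuous_on U (\<lambda>x. f (G x))"
    if f: "continuous_on V f" and dG: "\<And>j. j < n \<Longrightarrow> continuous_on U (\<lambda>x. G x j)" for f
  proof -
    have "continuous_on U (\<lambda>x. G x j)" for j
    proof (cases "j < n")
      case False
      \<comment> \<open>Continuity into the product topology concerns all coordinates; from index n
        on they are constantly 0, since \<open>G\<close> takes values in \<open>V\<close>.\<close>
      then have "continuous_on U (\<lambda>x. G x j) \<longleftrightarrow> continuous_on U (\<lambda>x. 0::real)"
        using openin_Euclidean_space_zero[OF V G] by (intro continuous_on_cong) auto
      then show ?thesis by simp
    qed (rule dG)
    then have "continuous_on U G" by (rule continuous_on_coordinatewise_then_product)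
    then show ?thesis using continuous_on_compose2[OF f] G by blast
  qed
  show ?thesis using assms(4,5)
  proof (induction k arbitrary: f)
    case 0
    then show ?case using cont by simp
  next
    case (Suc k)
    have dG1: "Ck_on n U (Suc 0) (\<lambda>x. G x j)" if "j < n" for j
      using Suc.prems(2)[OF that] Ck_on_imp_continuous by auto
    have f1: "Ck_on n V (Suc 0) f"
      using Suc.prems(1) Ck_on_imp_continuous by auto
    show ?case
    proof (rule Ck_on_SucI[OF U, where g = "\<lambda>i x. \<Sum>j<n. partial j f (G x) * partial i (\<lambda>x. G x j) x"])
      show "continuous_on U (\<lambda>x. f (G x))"
        using Suc.prems cont Ck_on_imp_continuous by blast
      show "DERIV (\<lambda>t. f (G (x(i := t)))) (x i) :> (\<Sum>j<n. partial j f (G x) * partial i (\<lambda>x. G x j) x)"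
        if "i < n" "x \<in> U" for i x
        using DERIV_compose_map[OF U V G f1 dG1 that] .
      show "Ck_on n U k (\<lambda>x. \<Sum>j<n. partial j f (G x) * partial i (\<lambda>x. G x j) x)" if "i < n" for i
      proof (rule Ck_on_sum[OF U finite_lessThan], rule Ck_on_mult[OF U])
        fix j assume j: "j \<in> {..<n}"
        show "Ck_on n U k (\<lambda>x. partial j f (G x))"
        proof (rule Suc.IH)
          show "Ck_on n V k (partial j f)" using Suc.prems(1) j by simp
          show "Ck_on n U k (\<lambda>x. G x l)" if "l < n" for l
            using Suc.prems(2)[OF that] by (rule Ck_on_Suc_imp)
        qed
        show "Ck_on n U k (partial i (\<lambda>x. G x j))"
          using Suc.prems(2) that j by simp
      qed
    qed
  qed
qed

lemma smooth_on_const: "openin (Euclidean_space n) V \<Longrightarrow> smooth_on n V (\<lambda>x. c)"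
  by (simp add: smooth_on_iff_Ck_on Ck_on_const)

lemma smooth_on_coordinate: "openin (Euclidean_space n) V \<Longrightarrow> j < n \<Longrightarrow> smooth_on n V (\<lambda>x. x j)"
  by (simp add: smooth_on_iff_Ck_on Ck_on_coordinate)

lemma smooth_on_add:
  "openin (Euclidean_space n) V \<Longrightarrow> smooth_on n V f \<Longrightarrow> smooth_on n V g \<Longrightarrow> smooth_on n V (\<lambda>x. f x + g x)"
  by (simp add: smooth_on_iff_Ck_on Ck_on_add)

lemma smooth_on_mult:
  "openin (Euclidean_space n) V \<Longrightarrow> smooth_on n V f \<Longrightarrow> smooth_on n V g \<Longrightarrow> smooth_on n V (\<lambda>x. f x * g x)"
  by (simp add: smooth_on_iff_Ck_on Ck_on_mult)

lemma smooth_on_diff: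
  assumes "openin (Euclidean_space n) V" "smooth_on n V f" "smooth_on n V g"
  shows "smooth_on n V (\<lambda>x. f x - g x)"
  using smooth_on_add[OF assms(1,2) smooth_on_mult[OF assms(1) smooth_on_const[OF assms(1), of "-1"] assms(3)]]
  by simp

lemma smooth_on_prod:
  assumes V: "openin (Euclidean_space n) V" and "finite I" "\<And>i. i \<in> I \<Longrightarrow> smooth_on n V (f i)"
  shows "smooth_on n V (\<lambda>x. \<Prod>i\<in>I. f i x)"
  using assms(2,3)
  by (induction I) (auto intro: smooth_on_const[OF V] smooth_on_mult[OF V])

lemma smooth_on_compose_real:
  assumes "openin (Euclidean_space n) V" "smooth_on n V f"
    and "\<And>m x. x \<in> V \<Longrightarrow> DERIV (h m) (f x) :> h (Suc m) (f x)"
  shows "smooth_on n V (\<lambda>x. h m (f x))"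
  using assms Ck_on_compose_real[OF assms(1), of _ f h m] by (simp add: smooth_on_iff_Ck_on)

lemma smooth_on_compose_map:
  assumes U: "openin (Euclidean_space n) U" and V: "openin (Euclidean_space n) V"
    and "\<And>x. x \<in> U \<Longrightarrow> G x \<in> V" "smooth_on n V f" "\<And>j. j < n \<Longrightarrow> smooth_on n U (\<lambda>x. G x j)"
  shows "smooth_on n U (\<lambda>x. f (G x))"
  using assms Ck_on_compose_map[OF U V] by (simp add: smooth_on_iff_Ck_on)

lemma partial_compose_map:
  assumes U: "openin (Euclidean_space n) U" and V: "openin (Euclidean_space n) V"
    and "\<And>x. x \<in> U \<Longrightarrow> G x \<in> V" "smooth_on n V f" "\<And>j. j < n \<Longrightarrow> smooth_on n U (\<lambda>x. G x j)"
    and "i < n" "x \<in> U"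
  shows "partial i (\<lambda>x. f (G x)) x = (\<Sum>j<n. partial j f (G x) * partial i (\<lambda>x. G x j) x)"
  using assms by (intro partial_eqI DERIV_compose_map[OF U V]) (auto simp only: smooth_on_iff_Ck_on)

lemma smooth_on_inverse:
  assumes V: "openin (Euclidean_space n) V" and f: "smooth_on n V f" and nz: "\<And>x. x \<in> V \<Longrightarrow> f x \<noteq> 0"
  shows "smooth_on n V (\<lambda>x. inverse (f x))"
proof -
  \<comment> \<open>\<open>h m\<close> is the m-th derivative of \<open>1 / t\<close>.\<close>
  define h :: "nat \<Rightarrow> real \<Rightarrow> real" where "h m t = (-1) ^ m * fact m * inverse t ^ Suc m" for m t
  have "DERIV (h m) t :> h (Suc m) t" if "t \<noteq> 0" for m t
    using DERIV_cmult[OF DERIV_power[OF DERIV_inverse[OF that]], of "(-1) ^ m * fact m" "Suc m"]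
    unfolding h_def by (simp add: algebra_simps)
  then have "smooth_on n V (\<lambda>x. h 0 (f x))"
    using nz by (intro smooth_on_compose_real[OF V f]) auto
  then show ?thesis by (simp add: h_def)
qed

section \<open>Flat functions and smooth cutoffs\<close>

text \<open>The classical function \<open>exp (- (1 / t))\<close>, extended by 0 to t \<le> 0, is
  not reproduced by differentiation; its multiples by polynomials in \<open>1 / t\<close> form a
  family that is.\<close>

definition flat :: "real poly \<Rightarrow> real \<Rightarrow> real" where
  "flat q t = (if t > 0 then poly q (1 / t) * exp (- (1 / t)) else 0)"

lemma tendsto_poly_mult_exp_neg:
  "((\<lambda>u::real. poly q u * exp (- u)) \<longlongrightarrow> 0) at_top"
proof -
  have "((\<lambda>u::real. \<Sum>i\<le>degree q. coeff q i * (u ^ i / exp u)) \<longlongrightarrow> (\<Sum>i\<le>degree q. coeff q i * 0)) at_top"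
    by (intro tendsto_intros tendsto_power_div_exp_0)
  then show ?thesis
    by (simp add: poly_altdef exp_minus sum_distrib_right divide_inverse mult.assoc)
qed

text \<open>With u = 1/t one has du/dt = -u^2, so the derivative of q(u) exp(-u) is u^2 (q(u) -
  q'(u)) exp(-u), which explains the polynomial. At 0 the right difference quotient is u q(u)
  exp(-u), written with \<open>pCons 0 q\<close>, and tends to 0 as u grows.\<close>

lemma DERIV_flat: "DERIV (flat q) t :> flat ([:0, 0, 1:] * (q - pderiv q)) t"
proof -
  consider "t > 0" | "t < 0" | "t = 0" by linarith
  then show ?thesis
  proof cases
    case 1
    have "DERIV (\<lambda>t. poly q (1 / t) * exp (- (1 / t))) t :>
        poly ([:0, 0, 1:] * (q - pderiv q)) (1 / t) * exp (- (1 / t))"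
      using 1 by (auto intro!: derivative_eq_intros DERIV_chain2[OF poly_DERIV]
          simp: field_simps power2_eq_square)
    moreover have "\<forall>\<^sub>F s in nhds t. poly q (1 / s) * exp (- (1 / s)) = flat q s"
      using eventually_nhds_in_open[of "{0<..}" t] 1 by (auto simp: flat_def elim!: eventually_mono)
    ultimately show ?thesis
      using DERIV_cong_ev[OF refl _ refl, of "\<lambda>t. poly q (1 / t) * exp (- (1 / t))" "flat q" t] 1
      by (simp add: flat_def)
  next
    case 2
    have *: "\<forall>\<^sub>F s in nhds t. 0 = flat q s"
      using eventually_nhds_in_open[of "{..<0}" t] 2 by (auto simp: flat_def elim!: eventually_mono)
    have "DERIV (flat q) t :> 0"
      using DERIV_cong_ev[OF refl * refl] DERIV_const by blast
    then show ?thesis using 2 by (simp add: flat_def)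
  next
    case 3
    have "((\<lambda>t. poly (pCons 0 q) (inverse t) * exp (- inverse t)) \<longlongrightarrow> 0) (at_right (0::real))"
      using filterlim_compose[OF tendsto_poly_mult_exp_neg filterlim_inverse_at_top_right] .
    then have "((\<lambda>s. (flat q s - flat q 0) / (s - 0)) \<longlongrightarrow> 0) (at_right 0)"
      by (rule Lim_transform_eventually)
        (auto simp: eventually_at_filter flat_def field_simps)
    moreover have "((\<lambda>s. (flat q s - flat q 0) / (s - 0)) \<longlongrightarrow> 0) (at_left 0)"
      by (rule tendsto_eventually) (auto simp: eventually_at_filter flat_def)
    ultimately have "DERIV (flat q) 0 :> 0"
      unfolding has_field_derivative_iff by (rule filterlim_split_at[rotated])
    then show ?thesis using 3 by (simp add: flat_def)
  qed
qed

text \<open>The quotient h(u) / (h(u) + h(r - u)) with h the flat exponential works: its denominator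
  is positive because u and r - u are never both nonpositive. Smoothness is stated through
  composition, because \<open>smooth_on\<close> speaks of functions of points of
  \<open>Euclidean_space n\<close>.\<close>

lemma smooth_cutoff_exists:
  assumes "r > 0"
  shows "\<exists>\<theta> :: real \<Rightarrow> real. (\<forall>u\<le>0. \<theta> u = 0) \<and> (\<forall>u\<ge>r. \<theta> u = 1) \<and>
    (\<forall>n V f. openin (Euclidean_space n) V \<longrightarrow> smooth_on n V f \<longrightarrow> smooth_on n V (\<lambda>x. \<theta> (f x)))"
proof -
  \<comment> \<open>Iterating the polynomial map of \<open>DERIV_flat\<close> from 1 yields all
    derivatives of the flat exponential at once, as \<open>smooth_on_compose_real\<close>
    requires.\<close>
  define h where "h m = flat (((\<lambda>q. [:0, 0, 1:] * (q - pderiv q)) ^^ m) 1)" for m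
  have h': "DERIV (h m) t :> h (Suc m) t" for m t
    unfolding h_def using DERIV_flat by simp
  have h0: "h 0 t = (if t > 0 then exp (- (1 / t)) else 0)" for t
    by (simp add: h_def flat_def)
  then have pos: "h 0 u + h 0 (r - u) > 0" for u
    using assms by (auto intro: add_pos_nonneg)
  define \<theta> where "\<theta> u = h 0 u * inverse (h 0 u + h 0 (r - u))" for u
  have "smooth_on n V (\<lambda>x. \<theta> (f x))" if V: "openin (Euclidean_space n) V" and f: "smooth_on n V f" for n V f
    unfolding \<theta>_def using pos h'
    by (intro smooth_on_mult[OF V] smooth_on_inverse[OF V] smooth_on_add[OF V] smooth_on_const[OF V]
        smooth_on_compose_real[OF V, where h = h] smooth_on_diff[OF V] f) (auto simp: less_imp_neq[symmetric])
  moreover have "\<theta> u = 0" if "u \<le> 0" for u using that by (simp add: \<theta>_def h0)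
  moreover have "\<theta> u = 1" if "u \<ge> r" for u using that assms by (simp add: \<theta>_def h0)
  ultimately show ?thesis by blast
qed

section \<open>Linear functionals and dual families\<close>

lemma sum_fun_apply: "(\<Sum>i\<in>I. f i) x = (\<Sum>i\<in>I. f i x)"
  by (induction I rule: infinite_finite_induct) auto

lemma linear_functional_on_sum:
  assumes S: "subspace S" and f: "linear_functional_on S f" and v: "\<And>i. i \<in> I \<Longrightarrow> v i \<in> S"
  shows "f (\<Sum>i\<in>I. a i *\<^sub>R v i) = (\<Sum>i\<in>I. a i * f (v i))"
proof -
  have f0: "f 0 = 0"
    using f subspace_0[OF S] unfolding linear_functional_on_def
    by (metis mult_zero_left scaleR_zero_left)
  show ?thesis using v
  proof (induction I rule: infinite_finite_induct)
    case (insert i I)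
    have "a i *\<^sub>R v i \<in> S" "(\<Sum>i\<in>I. a i *\<^sub>R v i) \<in> S"
      using insert.prems by (auto intro: subspace_scale[OF S] subspace_sum[OF S])
    moreover have "f (a i *\<^sub>R v i) = a i * f (v i)"
      using f insert.prems unfolding linear_functional_on_def by blast
    ultimately show ?case
      using f insert unfolding linear_functional_on_def by simp
  qed (simp_all add: f0)
qed

text \<open>Applying \<open>l j\<close> to a vanishing combination isolates its j-th coefficient.
  Linearity is asked only on \<open>S\<close>, since covectors are cut off to 0 outside the tangent
  space.\<close>

lemma dual_family_independent:
  fixes v :: "nat \<Rightarrow> 'v::real_vector"
  assumes S: "subspace S" and v: "\<And>i. i < r \<Longrightarrow> v i \<in> S"
    and l: "\<And>j. j < r \<Longrightarrow> linear_functional_on S (l j)"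
    and dual: "\<And>i j. i < r \<Longrightarrow> j < r \<Longrightarrow> l j (v i) = (if j = i then 1 else 0)"
  shows "inj_on v {..<r}" "independent (v ` {..<r})"
proof -
  show inj: "inj_on v {..<r}"
  proof (rule inj_onI)
    fix i j assume "i \<in> {..<r}" "j \<in> {..<r}" "v i = v j"
    then show "i = j" using dual[of i i] dual[of j i] by (metis lessThan_iff zero_neq_one)
  qed
  show "independent (v ` {..<r})"
  proof (rule independent_if_scalars_zero)
    fix f x assume 0: "(\<Sum>x\<in>v ` {..<r}. f x *\<^sub>R x) = 0" and "x \<in> v ` {..<r}"
    then obtain j where j: "j < r" "x = v j" by blast
    \<comment> \<open>Writing 0 as an empty sum lets the sum rule supply
      \<open>l j 0 = 0\<close>.\<close>
    have "0 = l j (\<Sum>i\<in>{}. 0 *\<^sub>R v i)"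
      using linear_functional_on_sum[OF S l[OF j(1)], of "{}" v] by simp
    also have "\<dots> = l j (\<Sum>i<r. f (v i) *\<^sub>R v i)"
      using 0 by (simp add: sum.reindex[OF inj] comp_def)
    also have "\<dots> = (\<Sum>i<r. f (v i) * l j (v i))"
      using v by (intro linear_functional_on_sum[OF S l[OF j(1)]]) auto
    also have "\<dots> = (\<Sum>i<r. if j = i then f (v i) else 0)"
      using dual j by (intro sum.cong) auto
    also have "\<dots> = f x" using j by simp
    finally show "f x = 0" by simp
  qed simp
qed

text \<open>Coefficients are attached to indices, not to vectors, so the family may contain
  repetitions.\<close>

lemma span_image_finite:
  fixes v :: "'i \<Rightarrow> 'v::real_vector"
  assumes "finite I"
  shows "x \<in> span (v ` I) \<longleftrightarrow> (\<exists>a. x = (\<Sum>i\<in>I. a i *\<^sub>R v i))"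
proof
  assume "x \<in> span (v ` I)"
  then show "\<exists>a. x = (\<Sum>i\<in>I. a i *\<^sub>R v i)"
  proof (induction rule: span_induct_alt)
    case base
    show ?case by (rule exI[of _ "\<lambda>_. 0"]) simp
  next
    case (step c x y)
    then obtain i a where i: "i \<in> I" "x = v i" and a: "y = (\<Sum>i\<in>I. a i *\<^sub>R v i)" by blast
    have "(\<Sum>j\<in>I. (a j + (if j = i then c else 0)) *\<^sub>R v j) =
        (\<Sum>j\<in>I. a j *\<^sub>R v j) + (\<Sum>j\<in>I. if j = i then c *\<^sub>R v j else 0)"
      by (subst sum.distrib[symmetric]) (auto intro!: sum.cong simp: scaleR_add_left)
    also have "\<dots> = c *\<^sub>R x + y" using i a assms by simp
    finally show ?case by metis
  qed
next
  assume "\<exists>a. x = (\<Sum>i\<in>I. a i *\<^sub>R v i)"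
  then show "x \<in> span (v ` I)" by (auto intro!: span_sum span_scale intro: span_base)
qed

text \<open>The difference between x and its expansion is annihilated by every \<open>l j\<close>,
  so \<open>sep\<close> makes it 0. This takes the place of a dimension count.\<close>

lemma dual_family_span:
  fixes v :: "nat \<Rightarrow> 'v::real_vector"
  assumes S: "subspace S" and v: "\<And>i. i < r \<Longrightarrow> v i \<in> S"
    and l: "\<And>j. j < r \<Longrightarrow> linear_functional_on S (l j)"
    and dual: "\<And>i j. i < r \<Longrightarrow> j < r \<Longrightarrow> l j (v i) = (if j = i then 1 else 0)"
    and sep: "\<And>u. u \<in> S \<Longrightarrow> (\<And>j. j < r \<Longrightarrow> l j u = 0) \<Longrightarrow> u = 0"
  shows "span (v ` {..<r}) = S"
proof
  show "span (v ` {..<r}) \<subseteq> S" using v S by (intro span_minimal) auto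
  show "S \<subseteq> span (v ` {..<r})"
  proof
    fix x assume x: "x \<in> S"
    define y where "y = (\<Sum>i<r. l i x *\<^sub>R v i)"
    have y: "y \<in> S" unfolding y_def using v by (intro subspace_sum[OF S] subspace_scale[OF S]) auto
    have "l j (x + (-1) *\<^sub>R y) = 0" if j: "j < r" for j
    proof -
      have "l j y = (\<Sum>i<r. l i x * l j (v i))"
        unfolding y_def using v by (intro linear_functional_on_sum[OF S l[OF j]]) auto
      also have "\<dots> = (\<Sum>i<r. if j = i then l i x else 0)"
        using dual j by (intro sum.cong) auto
      also have "\<dots> = l j x" using j by simp
      finally have ly: "l j y = l j x" .
      have "l j (x + (-1) *\<^sub>R y) = l j x + (-1) * l j y"
        using l[OF j] x y subspace_scale[OF S y, of "-1"] unfolding linear_functional_on_def by metis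
      then show ?thesis using ly by simp
    qed
    then have "x + (-1) *\<^sub>R y = 0"
      using sep[OF subspace_add[OF S x subspace_scale[OF S y]]] by blast
    then have "x = y" by simp
    then show "x \<in> span (v ` {..<r})"
      unfolding span_image_finite[OF finite_lessThan] y_def by (rule exI[of _ "\<lambda>i. l i x"])
  qed
qed

text \<open>The function types used later are infinite-dimensional, so finiteness has to come from
  \<open>T\<close>: a vector outside \<open>span B\<close> would yield an independent set larger
  than a basis selected from \<open>T\<close>.\<close>

lemma independent_card_eq_dim_span:
  fixes B T :: "'v::real_vector set"
  assumes "finite T" "independent B" "B \<subseteq> span T" "card B = dim (span T)"
  shows "span B = span T"
proof
  show "span B \<subseteq> span T" using assms(3) by (rule span_minimal) simp
  obtain T' where T': "T' \<subseteq> T" "independent T'" "T \<subseteq> span T'" "card T' = dim T"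
    using basis_exists by blast
  have fT': "finite T'" using T'(1) assms(1) finite_subset by blast
  have spT: "span T' = span T"
    by (metis T'(1,3) span_eq span_superset subset_trans)
  have fB: "finite B" using independent_span_bound[OF fT' assms(2)] assms(3) spT by simp
  show "span T \<subseteq> span B"
  proof (rule ccontr)
    assume "\<not> ?thesis"
    then obtain x where x: "x \<in> span T" "x \<notin> span B" by blast
    then have "independent (insert x B)" using assms(2) by (simp add: independent_insert)
    then have "card (insert x B) \<le> card T'"
      using independent_span_bound[OF fT'] x assms(3) spT by simp
    moreover have "x \<notin> B" using x span_base by blast
    ultimately show False using fB T'(4) assms(4) by simp
  qed
qed

lemma linear_functional_on_subset: "linear_functional_on S f \<Longrightarrow> T \<subseteq> S \<Longrightarrow> linear_functional_on T f"
  unfolding linear_functional_on_def by blast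

lemma linear_functional_on_zero: "linear_functional_on S f \<Longrightarrow> subspace S \<Longrightarrow> f 0 = 0"
  using linear_functional_on_sum[of S f "{}"] by simp

lemma smooth_subbundle_frame:
  assumes "smooth_subbundle X sec k F" "p \<in> topspace X"
  obtains W s where "openin X W" "p \<in> W" "\<And>i. i < k \<Longrightarrow> sec W (s i)"
    "\<And>q. q \<in> W \<Longrightarrow> inj_on (\<lambda>i. s i q) {..<k}" "\<And>q. q \<in> W \<Longrightarrow> independent ((\<lambda>i. s i q) ` {..<k})"
    "\<And>q. q \<in> W \<Longrightarrow> span ((\<lambda>i. s i q) ` {..<k}) = F `` {q}"
proof -
  from assms(1)[unfolded smooth_subbundle_def, THEN conjunct2, THEN bspec, OF assms(2)]
  obtain W s where "openin X W" "p \<in> W" "\<forall>i<k. sec W (s i)"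
    "\<forall>q\<in>W. inj_on (\<lambda>i. s i q) {..<k} \<and> independent ((\<lambda>i. s i q) ` {..<k}) \<and>
      span ((\<lambda>i. s i q) ` {..<k}) = F `` {q}"
    by (elim exE conjE) (rule that)
  then show ?thesis by (intro that[of W s]) simp_all
qed

section \<open>Smooth functions on a manifold\<close>

locale smooth_mfd =
  fixes X :: "'a topology" and n :: nat and A :: "'a chart set"
  assumes mfd: "smooth_manifold X n A"
begin

lemma openin_chart [simp]: "c \<in> A \<Longrightarrow> openin X (fst c)"
  using mfd unfolding smooth_manifold_def by blast

lemma openin_chart_Int [simp]:
  "c \<in> A \<Longrightarrow> openin X W \<Longrightarrow> openin X (fst c \<inter> W)" "c \<in> A \<Longrightarrow> openin X W \<Longrightarrow> openin X (W \<inter> fst c)"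
  by (simp_all add: openin_Int)

lemma chart_around: "p \<in> topspace X \<Longrightarrow> \<exists>c\<in>A. p \<in> fst c"
  using mfd unfolding smooth_manifold_def by blast

lemma chart_homeomorphic:
  assumes "c \<in> A"
  obtains V where "openin (Euclidean_space n) V"
    "homeomorphic_map (subtopology X (fst c)) (subtopology (Euclidean_space n) V) (snd c)"
  using mfd assms unfolding smooth_manifold_def by blast

lemma topspace_subtopology_chart: "c \<in> A \<Longrightarrow> topspace (subtopology X (fst c)) = fst c"
  using openin_subset[OF openin_chart, of c] by (simp add: inf.absorb2)

lemma inj_on_chart: "c \<in> A \<Longrightarrow> inj_on (snd c) (fst c)"
  using chart_homeomorphic[of c] topspace_subtopology_chart[of c]
  by (metis homeomorphic_imp_injective_map)

lemma inv_chart [simp]: "c \<in> A \<Longrightarrow> p \<in> fst c \<Longrightarrow> inv_into (fst c) (snd c) (snd c p) = p"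
  using inj_on_chart by simp

lemma openin_chart_image:
  assumes "c \<in> A" "openin X W" "W \<subseteq> fst c"
  shows "openin (Euclidean_space n) (snd c ` W)"
proof -
  obtain V where V: "openin (Euclidean_space n) V"
    "homeomorphic_map (subtopology X (fst c)) (subtopology (Euclidean_space n) V) (snd c)"
    using chart_homeomorphic[OF assms(1)] .
  have "openin (subtopology X (fst c)) W"
    using assms openin_open_subtopology[OF openin_chart[OF assms(1)]] by simp
  then have "openin (subtopology (Euclidean_space n) V) (snd c ` W)"
    using homeomorphic_imp_open_map[OF V(2)] unfolding open_map_def by blast
  then show ?thesis using openin_trans_full V(1) by blast
qed

lemma openin_chart_preimage:
  assumes "c \<in> A" "openin (Euclidean_space n) T"
  shows "openin X {p \<in> fst c. snd c p \<in> T}"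
proof -
  obtain V where V: "openin (Euclidean_space n) V"
    "homeomorphic_map (subtopology X (fst c)) (subtopology (Euclidean_space n) V) (snd c)"
    using chart_homeomorphic[OF assms(1)] .
  have "continuous_map (subtopology X (fst c)) (Euclidean_space n) (snd c)"
    using homeomorphic_imp_continuous_map[OF V(2)] continuous_map_into_fulltopology by blast
  from openin_continuous_map_preimage[OF this assms(2)]
  have "openin (subtopology X (fst c)) {p \<in> fst c. snd c p \<in> T}"
    by (simp only: topspace_subtopology_chart[OF assms(1)])
  then show ?thesis
    by (rule openin_trans_full[OF _ openin_chart[OF assms(1)]])
qed

lemma transition_chart [simp]: "c \<in> A \<Longrightarrow> p \<in> fst c \<Longrightarrow> transition c d (snd c p) = snd d p"
  unfolding transition_def by simp

lemma smooth_on_transition: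
  "c \<in> A \<Longrightarrow> d \<in> A \<Longrightarrow> i < n \<Longrightarrow> smooth_on n (snd c ` (fst c \<inter> fst d)) (\<lambda>x. transition c d x i)"
  using mfd unfolding smooth_manifold_def by blast

lemma smooth_on_transition_subset:
  assumes "c \<in> A" "d \<in> A" "i < n" "openin X W" "W \<subseteq> fst c \<inter> fst d"
  shows "smooth_on n (snd c ` W) (\<lambda>x. transition c d x i)"
  using assms by (intro smooth_on_subset[OF smooth_on_transition[OF assms(1-3)]] openin_chart_image) auto

text \<open>The expression of f in the chart d is its expression in c after the transition from d to
  c, so smoothness of composites applies.\<close>

lemma smooth_on_chart_change:
  assumes c: "c \<in> A" and d: "d \<in> A" and W: "openin X W" "W \<subseteq> fst c \<inter> fst d"
    and f: "smooth_on n (snd c ` W) (\<lambda>x. f (inv_into (fst c) (snd c) x))"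
  shows "smooth_on n (snd d ` W) (\<lambda>x. f (inv_into (fst d) (snd d) x))"
proof -
  have oc: "openin (Euclidean_space n) (snd c ` W)" and od: "openin (Euclidean_space n) (snd d ` W)"
    by (rule openin_chart_image; use assms in auto)+
  have "smooth_on n (snd d ` W) (\<lambda>x. f (inv_into (fst c) (snd c) (transition d c x)))"
  proof (rule smooth_on_compose_map[OF od oc _ f])
    show "transition d c x \<in> snd c ` W" if "x \<in> snd d ` W" for x
      using that W(2) d by auto
    show "smooth_on n (snd d ` W) (\<lambda>x. transition d c x j)" if "j < n" for j
      using W that by (intro smooth_on_transition_subset c d) auto
  qed
  moreover have "f (inv_into (fst d) (snd d) x) = f (inv_into (fst c) (snd c) (transition d c x))"
    if "x \<in> snd d ` W" for x
  proof -
    obtain p where "p \<in> W" "x = snd d p" using \<open>x \<in> snd d ` W\<close> by blast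
    then show ?thesis using W(2) c d by (auto simp: subset_iff)
  qed
  ultimately show ?thesis by (rule smooth_on_eq[OF od])
qed

text \<open>\<open>smooth_fun\<close> quantifies over all charts, yet one chart near each point is
  enough: \<open>smooth_on_chart_change\<close> carries the local statement to every other chart,
  and \<open>smooth_on_local\<close> glues.\<close>

lemma smooth_fun_local_chart:
  assumes W: "openin X W"
    and loc: "\<And>p. p \<in> W \<Longrightarrow> \<exists>c\<in>A. \<exists>W'. openin X W' \<and> p \<in> W' \<and> W' \<subseteq> fst c \<and>
         smooth_on n (snd c ` W') (\<lambda>x. f (inv_into (fst c) (snd c) x))"
  shows "smooth_fun n A W f"
  unfolding smooth_fun_def
proof
  fix d assume d: "d \<in> A"
  show "smooth_on n (snd d ` (fst d \<inter> W)) (\<lambda>x. f (inv_into (fst d) (snd d) x))"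
  proof (rule smooth_on_local)
    show "openin (Euclidean_space n) (snd d ` (fst d \<inter> W))"
      using W d by (intro openin_chart_image) auto
    fix x assume "x \<in> snd d ` (fst d \<inter> W)"
    then obtain p where p: "p \<in> fst d" "p \<in> W" "x = snd d p" by blast
    obtain c W' where c: "c \<in> A" and W': "openin X W'" "p \<in> W'" "W' \<subseteq> fst c"
         "smooth_on n (snd c ` W') (\<lambda>x. f (inv_into (fst c) (snd c) x))"
      using loc[OF p(2)] by blast
    define U where "U = W' \<inter> fst d"
    have U: "openin X U" "U \<subseteq> fst c \<inter> fst d" "p \<in> U" using W' d p by (auto simp: U_def)
    have "smooth_on n (snd c ` U) (\<lambda>x. f (inv_into (fst c) (snd c) x))"
      using U c by (intro smooth_on_subset[OF W'(4)] openin_chart_image) (auto simp: U_def)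
    from smooth_on_chart_change[OF c d U(1,2) this]
    show "\<exists>T. openin (Euclidean_space n) T \<and> x \<in> T \<and> smooth_on n T (\<lambda>x. f (inv_into (fst d) (snd d) x))"
      using U d p by (intro exI[of _ "snd d ` U"]) (auto intro: openin_chart_image)
  qed
qed

lemma smooth_fun_chart:
  assumes "c \<in> A" "openin X W" "W \<subseteq> fst c"
    "smooth_on n (snd c ` W) (\<lambda>x. f (inv_into (fst c) (snd c) x))"
  shows "smooth_fun n A W f"
  using assms by (intro smooth_fun_local_chart) auto

lemma smooth_fun_subset:
  assumes "smooth_fun n A W f" "openin X W'" "W' \<subseteq> W"
  shows "smooth_fun n A W' f"
  unfolding smooth_fun_def
proof
  fix c assume c: "c \<in> A"
  show "smooth_on n (snd c ` (fst c \<inter> W')) (\<lambda>x. f (inv_into (fst c) (snd c) x))"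
  proof (rule smooth_on_subset)
    show "smooth_on n (snd c ` (fst c \<inter> W)) (\<lambda>x. f (inv_into (fst c) (snd c) x))"
      using assms(1) c unfolding smooth_fun_def by blast
    show "openin (Euclidean_space n) (snd c ` (fst c \<inter> W'))"
      using assms(2) c by (intro openin_chart_image) auto
  qed (use assms(3) in auto)
qed

lemma smooth_fun_local:
  assumes W: "openin X W"
    and loc: "\<And>p. p \<in> W \<Longrightarrow> \<exists>W'. openin X W' \<and> p \<in> W' \<and> smooth_fun n A W' f"
  shows "smooth_fun n A W f"
proof (rule smooth_fun_local_chart[OF W])
  fix p assume p: "p \<in> W"
  obtain W' where W': "openin X W'" "p \<in> W'" "smooth_fun n A W' f" using loc[OF p] by blast
  obtain c where c: "c \<in> A" "p \<in> fst c" using chart_around p W openin_subset by blast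
  then show "\<exists>c\<in>A. \<exists>W'. openin X W' \<and> p \<in> W' \<and> W' \<subseteq> fst c \<and>
         smooth_on n (snd c ` W') (\<lambda>x. f (inv_into (fst c) (snd c) x))"
    using W' by (intro bexI[of _ c] exI[of _ "fst c \<inter> W'"]) (auto simp: smooth_fun_def)
qed

lemma openin_chart_inter_image:
  "c \<in> A \<Longrightarrow> openin X W \<Longrightarrow> openin (Euclidean_space n) (snd c ` (fst c \<inter> W))"
  by (intro openin_chart_image) auto

lemma smooth_fun_cong:
  assumes W: "openin X W" and "\<And>p. p \<in> W \<Longrightarrow> f p = g p"
  shows "smooth_fun n A W f \<longleftrightarrow> smooth_fun n A W g"
  unfolding smooth_fun_def
proof (rule ball_cong[OF refl])
  fix c assume c: "c \<in> A"
  show "smooth_on n (snd c ` (fst c \<inter> W)) (\<lambda>x. f (inv_into (fst c) (snd c) x)) \<longleftrightarrow>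
    smooth_on n (snd c ` (fst c \<inter> W)) (\<lambda>x. g (inv_into (fst c) (snd c) x))"
    using assms c by (intro smooth_on_cong openin_chart_inter_image) auto
qed

lemma smooth_fun_eq:
  assumes "openin X W" "smooth_fun n A W f" "\<And>p. p \<in> W \<Longrightarrow> g p = f p"
  shows "smooth_fun n A W g"
  using smooth_fun_cong[OF assms(1), of g f] assms(2,3) by blast

lemma smooth_fun_const: "openin X W \<Longrightarrow> smooth_fun n A W (\<lambda>p. r)"
  unfolding smooth_fun_def using openin_chart_inter_image smooth_on_const by blast

lemma smooth_fun_add:
  "openin X W \<Longrightarrow> smooth_fun n A W f \<Longrightarrow> smooth_fun n A W g \<Longrightarrow> smooth_fun n A W (\<lambda>p. f p + g p)"
  unfolding smooth_fun_def by (intro ballI smooth_on_add openin_chart_inter_image) auto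

lemma smooth_fun_mult:
  "openin X W \<Longrightarrow> smooth_fun n A W f \<Longrightarrow> smooth_fun n A W g \<Longrightarrow> smooth_fun n A W (\<lambda>p. f p * g p)"
  unfolding smooth_fun_def by (intro ballI smooth_on_mult openin_chart_inter_image) auto

lemma smooth_fun_diff:
  "openin X W \<Longrightarrow> smooth_fun n A W f \<Longrightarrow> smooth_fun n A W g \<Longrightarrow> smooth_fun n A W (\<lambda>p. f p - g p)"
  unfolding smooth_fun_def by (intro ballI smooth_on_diff openin_chart_inter_image) auto

lemma smooth_fun_inverse:
  assumes "openin X W" "smooth_fun n A W f" "\<And>p. p \<in> W \<Longrightarrow> f p \<noteq> 0"
  shows "smooth_fun n A W (\<lambda>p. inverse (f p))"
  unfolding smooth_fun_def
proof
  fix c assume c: "c \<in> A"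
  show "smooth_on n (snd c ` (fst c \<inter> W)) (\<lambda>x. inverse (f (inv_into (fst c) (snd c) x)))"
    using assms c by (intro smooth_on_inverse openin_chart_inter_image) (auto simp: smooth_fun_def)
qed

lemma smooth_fun_sum:
  assumes "openin X W" "finite I" "\<And>i. i \<in> I \<Longrightarrow> smooth_fun n A W (f i)"
  shows "smooth_fun n A W (\<lambda>p. \<Sum>i\<in>I. f i p)"
  using assms(2,3)
  by (induction I) (auto intro: smooth_fun_const smooth_fun_add assms(1))

lemma smooth_fun_prod:
  assumes "openin X W" "finite I" "\<And>i. i \<in> I \<Longrightarrow> smooth_fun n A W (f i)"
  shows "smooth_fun n A W (\<lambda>p. \<Prod>i\<in>I. f i p)"
  using assms(2,3)
  by (induction I) (auto intro: smooth_fun_const smooth_fun_mult assms(1))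

text \<open>A smooth function is continuous in each chart, and open coordinate sets pull back to
  open sets of \<open>X\<close>. This supplies the shrunken domains when frame vectors are
  exchanged.\<close>

lemma openin_smooth_fun_nonzero:
  assumes W: "openin X W" and f: "smooth_fun n A W f"
  shows "openin X {p \<in> W. f p \<noteq> 0}"
proof (subst openin_subopen, intro ballI)
  fix p assume p: "p \<in> {p \<in> W. f p \<noteq> 0}"
  obtain c where c: "c \<in> A" "p \<in> fst c" using chart_around p W openin_subset by blast
  let ?V = "snd c ` (fst c \<inter> W)" and ?g = "\<lambda>x. f (inv_into (fst c) (snd c) x)"
  have V: "openin (Euclidean_space n) ?V" using openin_chart_inter_image[OF c(1) W] .
  have "smooth_on n ?V ?g" using f c unfolding smooth_fun_def by blast
  then have "continuous_on ?V ?g" by (rule smooth_on_imp_continuous_on[OF V])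
  then have "openin (top_of_set ?V) (?V \<inter> ?g -` (- {0}))"
    by (intro continuous_openin_preimage_gen) auto
  then have "openin (Euclidean_space n) (?V \<inter> ?g -` (- {0}))"
    using V by (metis (no_types, lifting) Euclidean_space_eq_top_of_set openin_trans)
  then have "openin X {q \<in> fst c. snd c q \<in> ?V \<inter> ?g -` (- {0})}"
    by (rule openin_chart_preimage[OF c(1)])
  moreover have "{q \<in> fst c. snd c q \<in> ?V \<inter> ?g -` (- {0})} = {q \<in> fst c \<inter> W. f q \<noteq> 0}"
    using c(1) inj_on_chart[OF c(1)] by (auto simp: inj_on_def)
  ultimately show "\<exists>T. openin X T \<and> p \<in> T \<and> T \<subseteq> {p \<in> W. f p \<noteq> 0}"
    using p c by (intro exI[of _ "{q \<in> fst c \<inter> W. f q \<noteq> 0}"]) auto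
qed

section \<open>Tangent vectors in coordinates\<close>

definition jac :: "'a chart \<Rightarrow> 'a chart \<Rightarrow> 'a \<Rightarrow> nat \<Rightarrow> nat \<Rightarrow> real" where
  "jac c d p i j = partial j (\<lambda>x. transition c d x i) (snd c p)"

lemma smooth_fun_jac:
  assumes "c \<in> A" "d \<in> A" "i < n" "j < n"
  shows "smooth_fun n A (fst c \<inter> fst d) (\<lambda>p. jac c d p i j)"
proof (rule smooth_fun_chart[OF assms(1)])
  show o: "openin X (fst c \<inter> fst d)" using assms by simp
  have "smooth_on n (snd c ` (fst c \<inter> fst d)) (partial j (\<lambda>x. transition c d x i))"
    using assms by (intro smooth_on_partial smooth_on_transition)
  moreover have "jac c d (inv_into (fst c) (snd c) x) i j = partial j (\<lambda>x. transition c d x i) x"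
    if "x \<in> snd c ` (fst c \<inter> fst d)" for x
    using that assms(1) by (auto simp: jac_def)
  ultimately show "smooth_on n (snd c ` (fst c \<inter> fst d)) (\<lambda>x. jac c d (inv_into (fst c) (snd c) x) i j)"
    by (rule smooth_on_eq[OF openin_chart_image[OF assms(1) o inf_le1]])
qed auto

lemma jac_self:
  assumes c: "c \<in> A" and p: "p \<in> fst c" and ij: "i < n" "j < n"
  shows "jac c c p i j = (if i = j then 1 else 0)"
proof -
  have o: "openin (Euclidean_space n) (snd c ` fst c)"
    using openin_chart_image[OF c openin_chart[OF c]] by simp
  have "jac c c p i j = partial j (\<lambda>x. x i) (snd c p)"
    unfolding jac_def by (rule partial_cong[OF o]) (use p c ij in auto)
  also have "\<dots> = (if i = j then 1 else 0)"
    by (rule partial_eqI, cases "i = j") (auto intro!: derivative_eq_intros)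
  finally show ?thesis .
qed

text \<open>Chain rule for the composite of two transitions. The composite is known to equal the
  direct transition on the image of the triple overlap \<open>W\<close>, to which everything is
  therefore restricted.\<close>

lemma jac_cocycle:
  assumes c: "c \<in> A" "d \<in> A" "e \<in> A" and p: "p \<in> fst c" "p \<in> fst d" "p \<in> fst e"
    and ik: "i < n" "k < n"
  shows "jac c e p i k = (\<Sum>j<n. jac d e p i j * jac c d p j k)"
proof -
  define W where "W = fst c \<inter> fst d \<inter> fst e"
  have W: "openin X W" using c by (auto simp: W_def openin_Int)
  have oc: "openin (Euclidean_space n) (snd c ` W)" and od: "openin (Euclidean_space n) (snd d ` W)"
    by (rule openin_chart_image; use c W in \<open>auto simp: W_def\<close>)+
  have pW: "snd c p \<in> snd c ` W" using p by (simp add: W_def)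
  have "jac c e p i k = partial k (\<lambda>x. transition d e (transition c d x) i) (snd c p)"
    unfolding jac_def
    by (rule partial_cong[OF oc pW ik(2)]) (use c in \<open>auto simp: W_def\<close>)
  also have "\<dots> = (\<Sum>j<n. partial j (\<lambda>x. transition d e x i) (transition c d (snd c p)) *
      partial k (\<lambda>x. transition c d x j) (snd c p))"
  proof (rule partial_compose_map[OF oc od])
    show "transition c d x \<in> snd d ` W" if "x \<in> snd c ` W" for x
      using that c by (auto simp: W_def)
    show "smooth_on n (snd d ` W) (\<lambda>x. transition d e x i)"
      using W ik c by (intro smooth_on_transition_subset) (auto simp: W_def)
    show "smooth_on n (snd c ` W) (\<lambda>x. transition c d x j)" if "j < n" for j
      using W that c by (intro smooth_on_transition_subset) (auto simp: W_def)
  qed (use ik pW in auto)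
  finally show ?thesis using c p by (simp add: jac_def)
qed

lemma tangent_space_iff:
  "v \<in> tangent_space n A p \<longleftrightarrow>
    (\<forall>c i. c \<notin> A \<or> p \<notin> fst c \<or> n \<le> i \<longrightarrow> v c i = 0) \<and>
    (\<forall>c\<in>A. \<forall>d\<in>A. p \<in> fst c \<and> p \<in> fst d \<longrightarrow> (\<forall>i<n. v d i = (\<Sum>j<n. jac c d p i j * v c j)))"
  unfolding tangent_space_def jac_def by simp

lemma subspace_tangent_space: "subspace (tangent_space n A p)"
  unfolding subspace_def
proof (intro conjI ballI allI)
  show "0 \<in> tangent_space n A p" by (simp add: tangent_space_iff)
  show "v + w \<in> tangent_space n A p" if vw: "v \<in> tangent_space n A p" "w \<in> tangent_space n A p" for v w
    unfolding tangent_space_iff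
  proof (intro conjI allI impI ballI)
    show "(v + w) c i = 0" if "c \<notin> A \<or> p \<notin> fst c \<or> n \<le> i" for c i
    proof -
      have "v c i = 0" "w c i = 0" using vw that unfolding tangent_space_iff by blast+
      then show ?thesis by simp
    qed
    fix c d i assume "c \<in> A" "d \<in> A" "p \<in> fst c \<and> p \<in> fst d" "i < n"
    then have "v d i = (\<Sum>j<n. jac c d p i j * v c j)" "w d i = (\<Sum>j<n. jac c d p i j * w c j)"
      using vw unfolding tangent_space_iff by blast+
    then show "(v + w) d i = (\<Sum>j<n. jac c d p i j * (v + w) c j)"
      by (simp add: distrib_left sum.distrib)
  qed
  show "r *\<^sub>R v \<in> tangent_space n A p" if v: "v \<in> tangent_space n A p" for r v
    unfolding tangent_space_iff
  proof (intro conjI allI impI ballI)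
    show "(r *\<^sub>R v) c i = 0" if "c \<notin> A \<or> p \<notin> fst c \<or> n \<le> i" for c i
    proof -
      have "v c i = 0" using v that unfolding tangent_space_iff by blast
      then show ?thesis by (simp add: scaleR_fun_def)
    qed
    fix c d i assume "c \<in> A" "d \<in> A" "p \<in> fst c \<and> p \<in> fst d" "i < n"
    then have "v d i = (\<Sum>j<n. jac c d p i j * v c j)"
      using v unfolding tangent_space_iff by blast
    then show "(r *\<^sub>R v) d i = (\<Sum>j<n. jac c d p i j * (r *\<^sub>R v) c j)"
      by (simp add: scaleR_fun_def sum_distrib_left mult.left_commute)
  qed
qed

text \<open>Spreads components given in the chart c to all charts by Jacobian matrices; tangent
  vectors are produced from coordinate data in this way. The zeros are those demanded by
  \<open>tangent_space\<close>.\<close>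

definition tvec_of :: "'a chart \<Rightarrow> 'a \<Rightarrow> (nat \<Rightarrow> real) \<Rightarrow> 'a tvec" where
  "tvec_of c p a = (\<lambda>d i. if d \<in> A \<and> p \<in> fst d \<and> i < n then \<Sum>j<n. jac c d p i j * a j else 0)"

text \<open>The transformation law between two further charts d and e is the cocycle identity, after
  exchanging the order of summation.\<close>

lemma tvec_of_in_tangent_space:
  assumes c: "c \<in> A" "p \<in> fst c"
  shows "tvec_of c p a \<in> tangent_space n A p"
  unfolding tangent_space_iff
proof (intro conjI allI impI ballI)
  show "tvec_of c p a d i = 0" if "d \<notin> A \<or> p \<notin> fst d \<or> n \<le> i" for d i
    using that by (auto simp: tvec_of_def)
  fix d e i assume de: "d \<in> A" "e \<in> A" "p \<in> fst d \<and> p \<in> fst e" "i < n"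
  have "(\<Sum>j<n. jac d e p i j * tvec_of c p a d j) = (\<Sum>j<n. \<Sum>k<n. jac d e p i j * jac c d p j k * a k)"
    using de by (simp add: tvec_of_def sum_distrib_left mult.assoc)
  also have "\<dots> = (\<Sum>k<n. \<Sum>j<n. jac d e p i j * jac c d p j k * a k)"
    by (rule sum.swap)
  also have "\<dots> = (\<Sum>k<n. jac c e p i k * a k)"
    using jac_cocycle[of c d e p i] c de by (simp add: sum_distrib_right)
  finally show "tvec_of c p a e i = (\<Sum>j<n. jac d e p i j * tvec_of c p a d j)"
    using de by (simp add: tvec_of_def)
qed

lemma tvec_of_same_chart:
  assumes "c \<in> A" "p \<in> fst c" "i < n"
  shows "tvec_of c p a c i = a i"
proof -
  have "tvec_of c p a c i = (\<Sum>j<n. (if i = j then 1 else 0) * a j)"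
    using assms by (simp add: tvec_of_def jac_self)
  also have "\<dots> = (\<Sum>j<n. if i = j then a j else 0)" by (rule sum.cong) auto
  finally have "tvec_of c p a c i = (\<Sum>j<n. if i = j then a j else 0)" .
  then show ?thesis using assms by simp
qed

text \<open>The components in one chart determine those in every other by the transformation law;
  the remaining values are 0 by convention.\<close>

lemma tangent_eqI:
  assumes "v \<in> tangent_space n A p" "w \<in> tangent_space n A p" "c \<in> A" "p \<in> fst c"
    and "\<And>i. i < n \<Longrightarrow> v c i = w c i"
  shows "v = w"
proof (intro ext)
  fix d i
  show "v d i = w d i"
  proof (cases "d \<in> A \<and> p \<in> fst d \<and> i < n")
    case True
    then have "v d i = (\<Sum>j<n. jac c d p i j * v c j)" "w d i = (\<Sum>j<n. jac c d p i j * w c j)"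
      using assms(1-4) unfolding tangent_space_iff by blast+
    then show ?thesis using assms(5) by simp
  next
    case False
    then have "v d i = 0" "w d i = 0"
      using assms(1,2) unfolding tangent_space_iff by (metis leI)+
    then show ?thesis by simp
  qed
qed

lemma smooth_vector_field_subset:
  assumes "smooth_vector_field n A W V" "openin X W'" "W' \<subseteq> W"
  shows "smooth_vector_field n A W' V"
  unfolding smooth_vector_field_def
proof (intro conjI ballI allI impI)
  show "V p \<in> tangent_space n A p" if "p \<in> W'" for p
    using assms that unfolding smooth_vector_field_def by blast
  fix c i assume "c \<in> A" "i < n"
  then show "smooth_fun n A (W' \<inter> fst c) (\<lambda>p. V p c i)"
    using assms unfolding smooth_vector_field_def
    by (intro smooth_fun_subset[of "W \<inter> fst c" _ "W' \<inter> fst c"] openin_Int) auto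
qed

text \<open>The components in another chart d are sums of Jacobian entries times components in c,
  hence smooth; a single chart decides.\<close>

lemma smooth_vector_field_chart:
  assumes c: "c \<in> A" and W: "openin X W" "W \<subseteq> fst c"
    and V: "\<And>p. p \<in> W \<Longrightarrow> V p \<in> tangent_space n A p"
    and sm: "\<And>i. i < n \<Longrightarrow> smooth_fun n A W (\<lambda>p. V p c i)"
  shows "smooth_vector_field n A W V"
  unfolding smooth_vector_field_def
proof (intro conjI ballI allI impI V)
  fix d i assume d: "d \<in> A" and i: "i < n"
  have o: "openin X (W \<inter> fst d)" using W d by simp
  have "smooth_fun n A (W \<inter> fst d) (\<lambda>p. \<Sum>j<n. jac c d p i j * V p c j)"
  proof (intro smooth_fun_sum[OF o] smooth_fun_mult[OF o])
    fix j assume "j \<in> {..<n}"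
    then show "smooth_fun n A (W \<inter> fst d) (\<lambda>p. jac c d p i j)" "smooth_fun n A (W \<inter> fst d) (\<lambda>p. V p c j)"
      using W c d i o by (auto intro: smooth_fun_subset[OF smooth_fun_jac[of c d]] smooth_fun_subset[OF sm])
  qed simp
  moreover have "V p d i = (\<Sum>j<n. jac c d p i j * V p c j)" if "p \<in> W \<inter> fst d" for p
    using V[of p] that c d i W(2) unfolding tangent_space_iff by blast
  ultimately show "smooth_fun n A (W \<inter> fst d) (\<lambda>p. V p d i)"
    by (rule smooth_fun_eq[OF o])
qed

section \<open>Dual frames\<close>

lemma subspace_cotangent_space: "subspace (cotangent_space n A p)"
  unfolding subspace_def cotangent_space_def linear_functional_on_def
  by (auto simp: scaleR_fun_def algebra_simps)

lemma smooth_vector_field_add: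
  assumes W: "openin X W" and V: "smooth_vector_field n A W V" "smooth_vector_field n A W V'"
  shows "smooth_vector_field n A W (\<lambda>p. V p + V' p)"
  unfolding smooth_vector_field_def
proof (intro conjI ballI allI impI)
  show "V p + V' p \<in> tangent_space n A p" if "p \<in> W" for p
    using V that subspace_add[OF subspace_tangent_space] unfolding smooth_vector_field_def by blast
  fix c i assume "c \<in> A" "i < n"
  then show "smooth_fun n A (W \<inter> fst c) (\<lambda>p. (V p + V' p) c i)"
    using V W unfolding smooth_vector_field_def by (simp add: smooth_fun_add)
qed

lemma smooth_vector_field_scale:
  assumes W: "openin X W" and f: "smooth_fun n A W f" and V: "smooth_vector_field n A W V"
  shows "smooth_vector_field n A W (\<lambda>p. f p *\<^sub>R V p)"
  unfolding smooth_vector_field_def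
proof (intro conjI ballI allI impI)
  show "f p *\<^sub>R V p \<in> tangent_space n A p" if "p \<in> W" for p
    using V that subspace_scale[OF subspace_tangent_space] unfolding smooth_vector_field_def by blast
  fix c i assume ci: "c \<in> A" "i < n"
  then have "smooth_fun n A (W \<inter> fst c) f"
    using W by (intro smooth_fun_subset[OF f]) auto
  with ci show "smooth_fun n A (W \<inter> fst c) (\<lambda>p. (f p *\<^sub>R V p) c i)"
    using V W unfolding smooth_vector_field_def scaleR_fun_def by (simp add: smooth_fun_mult)
qed

lemma smooth_vector_field_zero:
  assumes "openin X W"
  shows "smooth_vector_field n A W (\<lambda>p. 0)"
  unfolding smooth_vector_field_def
proof (intro conjI ballI allI impI)
  show "0 \<in> tangent_space n A p" for p by (rule subspace_0[OF subspace_tangent_space])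
  show "smooth_fun n A (W \<inter> fst c) (\<lambda>p. 0 c i)" if "c \<in> A" for c i
    using that assms by (simp add: smooth_fun_const)
qed

lemma smooth_one_form_subset:
  "smooth_one_form X n A W \<alpha> \<Longrightarrow> W' \<subseteq> W \<Longrightarrow> smooth_one_form X n A W' \<alpha>"
  unfolding smooth_one_form_def by blast

lemma smooth_one_form_apply:
  "smooth_one_form X n A W \<alpha> \<Longrightarrow> smooth_vector_field n A W' V \<Longrightarrow> openin X W' \<Longrightarrow> W' \<subseteq> W \<Longrightarrow>
    smooth_fun n A W' (\<lambda>p. \<alpha> p (V p))"
  unfolding smooth_one_form_def by blast

lemma smooth_one_form_add:
  assumes \<alpha>: "smooth_one_form X n A W \<alpha>" "smooth_one_form X n A W \<alpha>'"
  shows "smooth_one_form X n A W (\<lambda>p. \<alpha> p + \<alpha>' p)"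
  using \<alpha> subspace_add[OF subspace_cotangent_space] unfolding smooth_one_form_def
  by (auto intro!: smooth_fun_add)

lemma smooth_one_form_scale:
  assumes f: "smooth_fun n A W f" and \<alpha>: "smooth_one_form X n A W \<alpha>"
  shows "smooth_one_form X n A W (\<lambda>p. f p *\<^sub>R \<alpha> p)"
  using \<alpha> subspace_scale[OF subspace_cotangent_space]
  unfolding smooth_one_form_def scaleR_fun_def
  by (auto intro!: smooth_fun_mult smooth_fun_subset[OF f])

lemma smooth_one_form_zero: "smooth_one_form X n A W (\<lambda>p. 0)"
  unfolding smooth_one_form_def
  by (auto simp: subspace_0[OF subspace_cotangent_space] intro!: smooth_fun_const)

lemma smooth_one_form_sum:
  assumes "finite I" "\<And>i. i \<in> I \<Longrightarrow> smooth_fun n A W (f i)" "\<And>i. i \<in> I \<Longrightarrow> smooth_one_form X n A W (\<alpha> i)"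
  shows "smooth_one_form X n A W (\<lambda>p. \<Sum>i\<in>I. f i p *\<^sub>R \<alpha> i p)"
  using assms
proof (induction I)
  case empty
  show ?case by (simp only: sum.empty) (rule smooth_one_form_zero)
next
  case (insert i I)
  then have "smooth_one_form X n A W (\<lambda>p. f i p *\<^sub>R \<alpha> i p + (\<Sum>i\<in>I. f i p *\<^sub>R \<alpha> i p))"
    by (intro smooth_one_form_add smooth_one_form_scale) auto
  then show ?case by (simp only: sum.insert[OF insert.hyps])
qed

section \<open>Local frames with their coframes\<close>

text \<open>The coframe is part of the data, so no matrix has to be inverted: the coefficients of a
  field V are \<open>\<sigma> i q (V q)\<close>, smooth by the very definition of a smooth
  one-form.\<close>

definition local_frame :: "'a set \<Rightarrow> (nat \<Rightarrow> 'a \<Rightarrow> 'a tvec) \<Rightarrow> (nat \<Rightarrow> 'a \<Rightarrow> 'a covec) \<Rightarrow> bool" where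
  "local_frame W t \<sigma> \<longleftrightarrow> openin X W \<and>
    (\<forall>i<n. smooth_vector_field n A W (t i)) \<and> (\<forall>i<n. smooth_one_form X n A W (\<sigma> i)) \<and>
    (\<forall>q\<in>W. \<forall>i<n. \<forall>j<n. \<sigma> i q (t j q) = (if i = j then 1 else 0)) \<and>
    (\<forall>q\<in>W. \<forall>v\<in>tangent_space n A q. v = (\<Sum>i<n. \<sigma> i q v *\<^sub>R t i q))"

lemma local_frameD:
  assumes "local_frame W t \<sigma>"
  shows "openin X W" "\<And>i. i < n \<Longrightarrow> smooth_vector_field n A W (t i)"
    "\<And>i. i < n \<Longrightarrow> smooth_one_form X n A W (\<sigma> i)"
    "\<And>q i j. q \<in> W \<Longrightarrow> i < n \<Longrightarrow> j < n \<Longrightarrow> \<sigma> i q (t j q) = (if i = j then 1 else 0)"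
    "\<And>q v. q \<in> W \<Longrightarrow> v \<in> tangent_space n A q \<Longrightarrow> (\<Sum>i<n. \<sigma> i q v *\<^sub>R t i q) = v"
    "\<And>q i. q \<in> W \<Longrightarrow> i < n \<Longrightarrow> t i q \<in> tangent_space n A q"
    "\<And>q i. q \<in> W \<Longrightarrow> i < n \<Longrightarrow> \<sigma> i q \<in> cotangent_space n A q"
    "\<And>q i. q \<in> W \<Longrightarrow> i < n \<Longrightarrow> linear_functional_on (tangent_space n A q) (\<sigma> i q)"
proof -
  show "\<sigma> i q \<in> cotangent_space n A q" if "q \<in> W" "i < n" for q i
    using assms that unfolding local_frame_def smooth_one_form_def by blast
  then show "linear_functional_on (tangent_space n A q) (\<sigma> i q)" if "q \<in> W" "i < n" for q i
    using that unfolding cotangent_space_def by blast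
  show "t i q \<in> tangent_space n A q" if "q \<in> W" "i < n" for q i
    using assms that unfolding local_frame_def smooth_vector_field_def by blast
  show "(\<Sum>i<n. \<sigma> i q v *\<^sub>R t i q) = v" if "q \<in> W" "v \<in> tangent_space n A q" for q v
    by (rule sym, use assms that in \<open>unfold local_frame_def, blast\<close>)
qed (use assms in \<open>auto simp: local_frame_def\<close>)

lemma local_frame_subset:
  "local_frame W t \<sigma> \<Longrightarrow> openin X W' \<Longrightarrow> W' \<subseteq> W \<Longrightarrow> local_frame W' t \<sigma>"
  unfolding local_frame_def
  by (meson smooth_vector_field_subset smooth_one_form_subset subsetD)

lemma coordinate_frame:
  assumes c: "c \<in> A"
  shows "\<exists>t \<sigma>. local_frame (fst c) t \<sigma>"
proof (intro exI)
  define t where "t j p = tvec_of c p (\<lambda>i. if i = j then 1 else 0)" for j p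
  \<comment> \<open>The i-th coordinate differential; the value 0 off the tangent space is what
    \<open>cotangent_space\<close> demands.\<close>
  define \<sigma> :: "nat \<Rightarrow> 'a \<Rightarrow> 'a covec"
    where "\<sigma> i p v = (if v \<in> tangent_space n A p then v c i else 0)" for i p v
  have tc: "t j p c i = (if i = j then 1 else 0)" if "p \<in> fst c" "i < n" for i j p
    using c that by (simp add: t_def tvec_of_same_chart)
  have tT: "t j p \<in> tangent_space n A p" if "p \<in> fst c" for j p
    using c that by (simp add: t_def tvec_of_in_tangent_space)
  show "local_frame (fst c) t \<sigma>"
    unfolding local_frame_def
  proof (intro conjI allI impI ballI)
    show "smooth_vector_field n A (fst c) (t j)" if "j < n" for j
    proof (rule smooth_vector_field_chart[OF c])
      show "smooth_fun n A (fst c) (\<lambda>p. t j p c i)" if "i < n" for i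
        using tc that
        by (intro smooth_fun_eq[OF openin_chart[OF c] smooth_fun_const[OF openin_chart[OF c]]])
    qed (use c tT in auto)
    show "smooth_one_form X n A (fst c) (\<sigma> i)" if "i < n" for i
      unfolding smooth_one_form_def
    proof (intro conjI ballI allI impI)
      show "\<sigma> i p \<in> cotangent_space n A p" for p
        using subspace_tangent_space[of p]
        by (auto simp: cotangent_space_def linear_functional_on_def \<sigma>_def scaleR_fun_def subspace_def)
      fix W' V assume "openin X W' \<and> W' \<subseteq> fst c \<and> smooth_vector_field n A W' V"
      then have *: "openin X W'" "W' \<subseteq> fst c" "smooth_vector_field n A W' V" by auto
      have "smooth_fun n A (W' \<inter> fst c) (\<lambda>p. V p c i)"
        using c that *(3) unfolding smooth_vector_field_def by blast
      moreover have "W' \<inter> fst c = W'" using *(2) by blast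
      moreover have "\<sigma> i p (V p) = V p c i" if "p \<in> W'" for p
        using *(3) that unfolding smooth_vector_field_def \<sigma>_def by simp
      ultimately show "smooth_fun n A W' (\<lambda>p. \<sigma> i p (V p))"
        using smooth_fun_eq[OF *(1), of "\<lambda>p. V p c i"] by simp
    qed
    show "\<sigma> i q (t j q) = (if i = j then 1 else 0)" if "q \<in> fst c" "i < n" for q i j
      using that tT tc by (simp add: \<sigma>_def)
    show "v = (\<Sum>i<n. \<sigma> i q v *\<^sub>R t i q)" if q: "q \<in> fst c" and v: "v \<in> tangent_space n A q" for q v
    proof (rule tangent_eqI[OF v _ c q])
      show "(\<Sum>i<n. \<sigma> i q v *\<^sub>R t i q) \<in> tangent_space n A q"
        using q tT by (intro subspace_sum[OF subspace_tangent_space] subspace_scale[OF subspace_tangent_space])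
      fix j assume j: "j < n"
      have "(\<Sum>i<n. \<sigma> i q v *\<^sub>R t i q) c j = (\<Sum>i<n. v c i * (if j = i then 1 else 0))"
        using j q v tc by (simp add: sum_fun_apply scaleR_fun_def \<sigma>_def)
      also have "\<dots> = (\<Sum>i<n. if j = i then v c i else 0)" by (rule sum.cong) auto
      also have "\<dots> = v c j" using j by simp
      finally show "v c j = (\<Sum>i<n. \<sigma> i q v *\<^sub>R t i q) c j" ..
    qed
  qed (use c in auto)
qed

text \<open>Serves to bring the vector that is to be replaced into the position wanted by
  \<open>local_frame_extend\<close>.\<close>

lemma local_frame_permute:
  assumes fr: "local_frame W t \<sigma>" and \<pi>: "\<pi> permutes {..<n}"
  shows "local_frame W (t \<circ> \<pi>) (\<sigma> \<circ> \<pi>)"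
  unfolding local_frame_def
proof (intro conjI allI impI ballI)
  have \<pi>n: "\<pi> i < n \<longleftrightarrow> i < n" for i using permutes_in_image[OF \<pi>, of i] by simp
  note D = local_frameD[OF fr]
  show "openin X W" by (rule D)
  show "smooth_vector_field n A W ((t \<circ> \<pi>) i)" "smooth_one_form X n A W ((\<sigma> \<circ> \<pi>) i)" if "i < n" for i
    using D(2,3) that \<pi>n by auto
  show "(\<sigma> \<circ> \<pi>) i q ((t \<circ> \<pi>) j q) = (if i = j then 1 else 0)" if "q \<in> W" "i < n" "j < n" for q i j
    using D(4) that \<pi>n permutes_inj[OF \<pi>] by (simp add: inj_eq)
  show "v = (\<Sum>i<n. (\<sigma> \<circ> \<pi>) i q v *\<^sub>R (t \<circ> \<pi>) i q)" if "q \<in> W" "v \<in> tangent_space n A q" for q v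
    using D(5)[OF that] sum.permute[OF \<pi>, of "\<lambda>i. \<sigma> i q v *\<^sub>R t i q"] by (simp add: comp_def)
qed

text \<open>One Gauss elimination step: where \<open>\<sigma> m s\<close> does not vanish, \<open>s\<close> can take the place of \<open>t m\<close>.\<close>

lemma local_frame_exchange:
  assumes fr: "local_frame W t \<sigma>" and m: "m < n" and s: "smooth_vector_field n A W s"
    and p: "p \<in> W" "\<sigma> m p (s p) \<noteq> 0"
  shows "\<exists>W' \<sigma>'. p \<in> W' \<and> W' \<subseteq> W \<and> local_frame W' (t(m := s)) \<sigma>'"
proof -
  note D = local_frameD[OF fr]
  define g where "g q = \<sigma> m q (s q)" for q
  define W' where "W' = {q \<in> W. g q \<noteq> 0}"
  have g: "smooth_fun n A W g"
    unfolding g_def by (rule smooth_one_form_apply[OF D(3)[OF m] s D(1)]) simp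
  then have W': "openin X W'" unfolding W'_def by (rule openin_smooth_fun_nonzero[OF D(1)])
  have W'W: "W' \<subseteq> W" by (auto simp: W'_def)
  have ig: "smooth_fun n A W' (\<lambda>q. inverse (g q))"
    using smooth_fun_subset[OF g W' W'W] by (rule smooth_fun_inverse[OF W']) (auto simp: W'_def)
  \<comment> \<open>Eliminating \<open>t m\<close> by means of the expansion of s gives the new
    coefficients: v has coefficient \<open>\<sigma> m q v / g q\<close> along s, and each other
    coefficient loses \<open>\<sigma> i q (s q)\<close> times that number.\<close>
  define \<sigma>' where "\<sigma>' i q = (if i = m then inverse (g q) *\<^sub>R \<sigma> m q
      else \<sigma> i q + (-1 * (\<sigma> i q (s q) * inverse (g q))) *\<^sub>R \<sigma> m q)" for i q
  have s': "smooth_vector_field n A W' s" using smooth_vector_field_subset[OF s W' W'W] .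
  have sT: "s q \<in> tangent_space n A q" if "q \<in> W" for q
    using s that unfolding smooth_vector_field_def by blast
  have "local_frame W' (t(m := s)) \<sigma>'"
    unfolding local_frame_def
  proof (intro conjI allI impI ballI W')
    show "smooth_vector_field n A W' ((t(m := s)) i)" if "i < n" for i
      using smooth_vector_field_subset[OF D(2)[OF that] W' W'W] s' by simp
    show "smooth_one_form X n A W' (\<sigma>' i)" if i: "i < n" for i
    proof (cases "i = m")
      case True
      then show ?thesis
        unfolding \<sigma>'_def using smooth_one_form_scale[OF ig smooth_one_form_subset[OF D(3)[OF m] W'W]] by simp
    next
      case False
      have "smooth_fun n A W' (\<lambda>q. -1 * (\<sigma> i q (s q) * inverse (g q)))"
        by (intro smooth_fun_mult W' smooth_fun_const ig smooth_one_form_apply[OF D(3)[OF i] s' _ W'W])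
      from smooth_one_form_add[OF smooth_one_form_subset[OF D(3)[OF i] W'W]
          smooth_one_form_scale[OF this smooth_one_form_subset[OF D(3)[OF m] W'W]]]
      show ?thesis unfolding \<sigma>'_def if_not_P[OF False] .
    qed
    fix q assume q: "q \<in> W'"
    then have qW: "q \<in> W" and gq: "g q \<noteq> 0" by (auto simp: W'_def)
    show "\<sigma>' i q ((t(m := s)) j q) = (if i = j then 1 else 0)" if ij: "i < n" "j < n" for i j
      using D(4)[OF qW ij(1) ij(2)] D(4)[OF qW m ij(2)] gq ij
      by (auto simp: \<sigma>'_def scaleR_fun_def g_def)
    fix v assume v: "v \<in> tangent_space n A q"
    have split: "(\<Sum>i<n. f i) = f m + (\<Sum>i\<in>{..<n} - {m}. f i)" for f :: "nat \<Rightarrow> 'a tvec"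
      using m by (subst sum.remove[of _ m]) auto
    define b where "b = \<sigma> m q v * inverse (g q)"
    have "(\<Sum>i<n. \<sigma>' i q v *\<^sub>R (t(m := s)) i q) =
        b *\<^sub>R s q + (\<Sum>i\<in>{..<n} - {m}. (\<sigma> i q v - b * \<sigma> i q (s q)) *\<^sub>R t i q)"
      by (subst split, rule arg_cong2[where f = "(+)"], simp add: \<sigma>'_def b_def scaleR_fun_def mult.commute, rule sum.cong)
        (simp_all add: \<sigma>'_def b_def scaleR_fun_def algebra_simps)
    also have "\<dots> = b *\<^sub>R s q + ((\<Sum>i\<in>{..<n} - {m}. \<sigma> i q v *\<^sub>R t i q)
        - b *\<^sub>R (\<Sum>i\<in>{..<n} - {m}. \<sigma> i q (s q) *\<^sub>R t i q))"
      by (simp add: scaleR_diff_left sum_subtractf scaleR_sum_right)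
    also have "(\<Sum>i\<in>{..<n} - {m}. \<sigma> i q v *\<^sub>R t i q) = v - \<sigma> m q v *\<^sub>R t m q"
      using D(5)[OF qW v] split[of "\<lambda>i. \<sigma> i q v *\<^sub>R t i q"] by (simp add: algebra_simps)
    also have "(\<Sum>i\<in>{..<n} - {m}. \<sigma> i q (s q) *\<^sub>R t i q) = s q - g q *\<^sub>R t m q"
      using D(5)[OF qW sT[OF qW]] split[of "\<lambda>i. \<sigma> i q (s q) *\<^sub>R t i q"] by (simp add: algebra_simps g_def)
    also have "b *\<^sub>R s q + ((v - \<sigma> m q v *\<^sub>R t m q) - b *\<^sub>R (s q - g q *\<^sub>R t m q)) = v"
    proof -
      have "b * g q = \<sigma> m q v" using gq by (simp add: b_def)
      then show ?thesis by (simp add: scaleR_diff_right del: plus_fun_apply minus_apply)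
    qed
    finally show "v = (\<Sum>i<n. \<sigma>' i q v *\<^sub>R (t(m := s)) i q)" ..
  qed
  moreover have "p \<in> W'" using p by (simp add: W'_def g_def)
  ultimately show ?thesis using W'W by blast
qed

text \<open>A Steinitz exchange near p: independence is assumed at p only, and the domain shrinks
  with each exchange. The bound \<open>r \<le> n\<close> is a by-product, since every step finds an
  index m with r \<le> m and m < n.\<close>

lemma local_frame_extend:
  assumes W: "openin X W" "p \<in> W"
    and "\<And>i. i < r \<Longrightarrow> smooth_vector_field n A W (s i)"
    and "inj_on (\<lambda>i. s i p) {..<r}" "independent ((\<lambda>i. s i p) ` {..<r})"
  shows "r \<le> n \<and> (\<exists>W' t \<sigma>. p \<in> W' \<and> W' \<subseteq> W \<and> local_frame W' t \<sigma> \<and> (\<forall>i<r. t i = s i))"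
  using assms(3-5)
proof (induction r)
  case 0
  obtain c where c: "c \<in> A" "p \<in> fst c" using chart_around W openin_subset by blast
  obtain t \<sigma> where "local_frame (fst c) t \<sigma>" using coordinate_frame[OF c(1)] by blast
  then have "local_frame (fst c \<inter> W) t \<sigma>" by (rule local_frame_subset) (use c W in auto)
  then show ?case
    using c W by (intro conjI exI[of _ "fst c \<inter> W"] exI[of _ t] exI[of _ \<sigma>]) auto
next
  case (Suc r)
  have eq: "(\<lambda>i. s i p) ` {..<Suc r} = insert (s r p) ((\<lambda>i. s i p) ` {..<r})"
    by (auto simp: lessThan_Suc)
  have notin: "s r p \<notin> (\<lambda>i. s i p) ` {..<r}"
    using Suc.prems(2) by (force simp: inj_on_def)
  have ind: "independent ((\<lambda>i. s i p) ` {..<r})" and nsp: "s r p \<notin> span ((\<lambda>i. s i p) ` {..<r})"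
    using Suc.prems(3) notin unfolding eq independent_insert by auto
  obtain W' t \<sigma> where rn: "r \<le> n" and W': "p \<in> W'" "W' \<subseteq> W" and fr: "local_frame W' t \<sigma>"
    and ts: "\<forall>i<r. t i = s i"
    using Suc.IH Suc.prems ind by (auto simp: inj_on_def)
  note D = local_frameD[OF fr]
  have sr: "smooth_vector_field n A W' (s r)"
    using Suc.prems(1)[of r] W' D(1) by (auto intro: smooth_vector_field_subset)
  then have srT: "s r p \<in> tangent_space n A p"
    using W' unfolding smooth_vector_field_def by blast
  \<comment> \<open>If all coefficients from index r on vanished at p, then \<open>s r p\<close>
    would be a combination of the earlier fields, against independence.\<close>
  have "\<exists>m<n. r \<le> m \<and> \<sigma> m p (s r p) \<noteq> 0"
  proof (rule ccontr)
    assume "\<not> ?thesis"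
    then have z: "\<sigma> i p (s r p) *\<^sub>R t i p \<in> span ((\<lambda>i. s i p) ` {..<r})" if "i < n" for i
      using ts that by (cases "i < r") (auto intro: span_scale span_base simp: span_zero)
    have "(\<Sum>i<n. \<sigma> i p (s r p) *\<^sub>R t i p) \<in> span ((\<lambda>i. s i p) ` {..<r})"
      using z by (intro span_sum) auto
    then show False using D(5)[OF W'(1) srT] nsp by simp
  qed
  then obtain m where m: "m < n" "r \<le> m" "\<sigma> m p (s r p) \<noteq> 0" by blast
  \<comment> \<open>Swapping r and m leaves the indices below r alone, so the fields already placed
    survive.\<close>
  define \<pi> where "\<pi> = Transposition.transpose r m"
  have "\<pi> permutes {..<n}" using m by (simp add: \<pi>_def permutes_swap_id)
  note fr' = local_frame_permute[OF fr this]
  have "(\<sigma> \<circ> \<pi>) r p (s r p) \<noteq> 0" using m by (simp add: \<pi>_def)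
  from local_frame_exchange[OF fr' _ sr W'(1) this] m
  obtain W'' \<sigma>' where W'': "p \<in> W''" "W'' \<subseteq> W'" "local_frame W'' ((t \<circ> \<pi>)(r := s r)) \<sigma>'" by auto
  have "((t \<circ> \<pi>)(r := s r)) i = s i" if "i < Suc r" for i
    using that m ts by (auto simp: \<pi>_def transpose_def)
  moreover have "Suc r \<le> n" "W'' \<subseteq> W" using m W''(2) W'(2) by auto
  ultimately show ?case using W''(1,3) by blast
qed

section \<open>Distributions and adapted frames\<close>

definition adapted_frame ::
  "('a \<times> 'a tvec) set \<Rightarrow> nat \<Rightarrow> 'a set \<Rightarrow> (nat \<Rightarrow> 'a \<Rightarrow> 'a tvec) \<Rightarrow> (nat \<Rightarrow> 'a \<Rightarrow> 'a covec) \<Rightarrow> bool" where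
  "adapted_frame F r W t \<sigma> \<longleftrightarrow>
    local_frame W t \<sigma> \<and> r \<le> n \<and> (\<forall>q\<in>W. F `` {q} = span ((\<lambda>i. t i q) ` {..<r}))"

lemma adapted_frame_exists:
  assumes F: "smooth_subbundle X (smooth_vector_field n A) k F" and p: "p \<in> topspace X"
  shows "\<exists>W t \<sigma>. p \<in> W \<and> adapted_frame F k W t \<sigma>"
proof -
  obtain W s where W: "openin X W" "p \<in> W" and s: "\<And>i. i < k \<Longrightarrow> smooth_vector_field n A W (s i)"
    and ind: "\<And>q. q \<in> W \<Longrightarrow> inj_on (\<lambda>i. s i q) {..<k}"
      "\<And>q. q \<in> W \<Longrightarrow> independent ((\<lambda>i. s i q) ` {..<k})"
      "\<And>q. q \<in> W \<Longrightarrow> span ((\<lambda>i. s i q) ` {..<k}) = F `` {q}"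
    using smooth_subbundle_frame[OF F p] by metis
  have kn: "k \<le> n" and ex: "\<exists>W' t \<sigma>. p \<in> W' \<and> W' \<subseteq> W \<and> local_frame W' t \<sigma> \<and> (\<forall>i<k. t i = s i)"
    using local_frame_extend[OF W s ind(1,2)[OF W(2)]] by simp_all
  from ex obtain W' t \<sigma> where W': "p \<in> W'" "W' \<subseteq> W" "local_frame W' t \<sigma>" and ts: "\<forall>i<k. t i = s i"
    by blast
  have "F `` {q} = span ((\<lambda>i. t i q) ` {..<k})" if "q \<in> W'" for q
  proof -
    have "(\<lambda>i. t i q) ` {..<k} = (\<lambda>i. s i q) ` {..<k}" using ts by (intro image_cong) auto
    then show ?thesis using ind(3) that W'(2) by auto
  qed
  then show ?thesis using W' kn unfolding adapted_frame_def by blast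
qed

text \<open>The covectors with indices from r to n - 1 cut out F: they vanish on the fibre, and a
  tangent vector killed by all of them is a combination of the first r frame vectors. Membership in
  F thus becomes a system of linear equations.\<close>

lemma adapted_frameD:
  assumes fr: "adapted_frame F r W t \<sigma>"
  shows "local_frame W t \<sigma>" "r \<le> n"
    "\<And>q. q \<in> W \<Longrightarrow> subspace (F `` {q})"
    "\<And>q v. q \<in> W \<Longrightarrow> (q, v) \<in> F \<Longrightarrow> v \<in> tangent_space n A q"
    "\<And>q i. q \<in> W \<Longrightarrow> i < r \<Longrightarrow> (q, t i q) \<in> F"
    "\<And>q v j. q \<in> W \<Longrightarrow> (q, v) \<in> F \<Longrightarrow> r \<le> j \<Longrightarrow> j < n \<Longrightarrow> \<sigma> j q v = 0"
    "\<And>q v. q \<in> W \<Longrightarrow> (q, v) \<in> F \<Longrightarrow> (\<Sum>i<r. \<sigma> i q v *\<^sub>R t i q) = v"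
    "\<And>q v. q \<in> W \<Longrightarrow> v \<in> tangent_space n A q \<Longrightarrow> (\<And>j. r \<le> j \<Longrightarrow> j < n \<Longrightarrow> \<sigma> j q v = 0) \<Longrightarrow> (q, v) \<in> F"
proof -
  show lf: "local_frame W t \<sigma>" and rn: "r \<le> n" using fr unfolding adapted_frame_def by auto
  note D = local_frameD[OF lf]
  have sp: "F `` {q} = span ((\<lambda>i. t i q) ` {..<r})" if "q \<in> W" for q
    using fr that unfolding adapted_frame_def by blast
  then show "subspace (F `` {q})" if "q \<in> W" for q using that by simp
  have tT: "t i q \<in> tangent_space n A q" if "q \<in> W" "i < r" for q i
    using D(6) that rn by simp
  then have "span ((\<lambda>i. t i q) ` {..<r}) \<subseteq> tangent_space n A q" if "q \<in> W" for q
    using that by (intro span_minimal subspace_tangent_space) auto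
  then show FT: "v \<in> tangent_space n A q" if "q \<in> W" "(q, v) \<in> F" for q v
    using sp that by blast
  have tF: "t i q \<in> F `` {q}" if "q \<in> W" "i < r" for q i
    unfolding sp[OF that(1)] using that(2) by (intro span_base) auto
  then show "(q, t i q) \<in> F" if "q \<in> W" "i < r" for q i using that by blast
  show \<sigma>0: "\<sigma> j q v = 0" if q: "q \<in> W" and v: "(q, v) \<in> F" and j: "r \<le> j" "j < n" for q v j
  proof -
    have "v \<in> F `` {q}" using v by blast
    then obtain a where a: "v = (\<Sum>i<r. a i *\<^sub>R t i q)"
      unfolding sp[OF q] span_image_finite[OF finite_lessThan] by blast
    have "\<sigma> j q v = (\<Sum>i<r. a i * \<sigma> j q (t i q))"
      unfolding a using tT q
      by (intro linear_functional_on_sum[OF subspace_tangent_space D(8)[OF q j(2)]]) auto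
    also have "\<dots> = 0" using D(4)[OF q j(2)] j by (intro sum.neutral) auto
    finally show ?thesis .
  qed
  have trunc: "(\<Sum>i<n. \<sigma> i q v *\<^sub>R t i q) = (\<Sum>i<r. \<sigma> i q v *\<^sub>R t i q)"
    if "\<And>j. r \<le> j \<Longrightarrow> j < n \<Longrightarrow> \<sigma> j q v = 0" for q v
    using rn that by (intro sum.mono_neutral_right) auto
  show "(\<Sum>i<r. \<sigma> i q v *\<^sub>R t i q) = v" if "q \<in> W" "(q, v) \<in> F" for q v
    using trunc[OF \<sigma>0[OF that]] D(5)[OF that(1) FT[OF that]] by metis
  show "(q, v) \<in> F" if q: "q \<in> W" and v: "v \<in> tangent_space n A q"
    and 0: "\<And>j. r \<le> j \<Longrightarrow> j < n \<Longrightarrow> \<sigma> j q v = 0" for q v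
  proof -
    have "v = (\<Sum>i<r. \<sigma> i q v *\<^sub>R t i q)" using trunc[OF 0] D(5)[OF q v] by metis
    then have "v \<in> F `` {q}"
      unfolding sp[OF q] span_image_finite[OF finite_lessThan] by (rule exI[of _ "\<lambda>i. \<sigma> i q v"])
    then show ?thesis by blast
  qed
qed

lemma adapted_frame_independent:
  assumes fr: "adapted_frame F r W t \<sigma>" and q: "q \<in> W"
  shows "inj_on (\<lambda>i. t i q) {..<r}" "independent ((\<lambda>i. t i q) ` {..<r})"
proof -
  note D = local_frameD[OF adapted_frameD(1)[OF fr]]
  have "r \<le> n" by (rule adapted_frameD(2)[OF fr])
  then have *: "\<And>i. i < r \<Longrightarrow> t i q \<in> tangent_space n A q"
      "\<And>j. j < r \<Longrightarrow> linear_functional_on (tangent_space n A q) (\<sigma> j q)"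
      "\<And>i j. i < r \<Longrightarrow> j < r \<Longrightarrow> \<sigma> j q (t i q) = (if j = i then 1 else 0)"
    using D(4,6,8) q by auto
  show "inj_on (\<lambda>i. t i q) {..<r}"
    by (rule dual_family_independent(1)[OF subspace_tangent_space, where l = "\<lambda>j. \<sigma> j q"]) (fact *)+
  show "independent ((\<lambda>i. t i q) ` {..<r})"
    by (rule dual_family_independent(2)[OF subspace_tangent_space, where l = "\<lambda>j. \<sigma> j q"]) (fact *)+
qed

lemma smooth_subbundle_adapted_frame:
  assumes "F \<subseteq> topspace X \<times> UNIV"
    and ex: "\<And>p. p \<in> topspace X \<Longrightarrow> \<exists>W t \<sigma>. p \<in> W \<and> adapted_frame F k W t \<sigma>"
  shows "smooth_subbundle X (smooth_vector_field n A) k F"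
  unfolding smooth_subbundle_def
proof (intro conjI ballI assms(1))
  fix p assume "p \<in> topspace X"
  then obtain W t \<sigma> where p: "p \<in> W" and fr: "adapted_frame F k W t \<sigma>" using ex by blast
  have W: "openin X W" and t: "\<forall>i<k. smooth_vector_field n A W (t i)"
    using local_frameD(1,2)[OF adapted_frameD(1)[OF fr]] adapted_frameD(2)[OF fr] by auto
  have "\<forall>q\<in>W. inj_on (\<lambda>i. t i q) {..<k} \<and> independent ((\<lambda>i. t i q) ` {..<k}) \<and>
               span ((\<lambda>i. t i q) ` {..<k}) = F `` {q}"
    using adapted_frame_independent[OF fr] fr unfolding adapted_frame_def by simp
  then show "\<exists>W s. openin X W \<and> p \<in> W \<and> (\<forall>i<k. smooth_vector_field n A W (s i)) \<and>
       (\<forall>q\<in>W. inj_on (\<lambda>i. s i q) {..<k} \<and> independent ((\<lambda>i. s i q) ` {..<k}) \<and>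
               span ((\<lambda>i. s i q) ` {..<k}) = F `` {q})"
    using W t p by blast
qed

lemma subbundle_base: "smooth_subbundle X sec k F \<Longrightarrow> (p, v) \<in> F \<Longrightarrow> p \<in> topspace X"
  unfolding smooth_subbundle_def by blast

lemma dim_subbundle_fibre:
  assumes F: "smooth_subbundle X (smooth_vector_field n A) k F" and p: "p \<in> topspace X"
  shows "dim (F `` {p}) = k"
proof -
  obtain W t \<sigma> where W: "p \<in> W" and fr: "adapted_frame F k W t \<sigma>"
    using adapted_frame_exists[OF F p] by blast
  have "F `` {p} = span ((\<lambda>i. t i p) ` {..<k})" using fr W unfolding adapted_frame_def by blast
  then have "dim (F `` {p}) = card ((\<lambda>i. t i p) ` {..<k})"
    using dim_eq_card_independent[OF adapted_frame_independent(2)[OF fr W]] by (simp add: dim_span)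
  then show ?thesis by (simp add: card_image[OF adapted_frame_independent(1)[OF fr W]])
qed

section \<open>From Dirac structures to two-forms\<close>

lemma almost_diracD:
  assumes "almost_dirac X n A L" "p \<in> topspace X"
  shows "subspace (L `` {p})" "L `` {p} \<subseteq> tangent_space n A p \<times> cotangent_space n A p"
    "\<And>u w. u \<in> L `` {p} \<Longrightarrow> w \<in> L `` {p} \<Longrightarrow> pairing u w = 0"
    "\<And>S. isotropic_subspace (tangent_space n A p \<times> cotangent_space n A p) S \<Longrightarrow> L `` {p} \<subseteq> S \<Longrightarrow> S = L `` {p}"
  using assms unfolding almost_dirac_def maximal_isotropic_def isotropic_subspace_def by blast+

lemma almost_dirac_base:
  assumes "almost_dirac X n A L" "(p, u) \<in> L"
  shows "p \<in> topspace X"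
  using assms subbundle_base[of _ _ L] unfolding almost_dirac_def by blast

lemma pr1_iff: "(p, v) \<in> pr1 L \<longleftrightarrow> (\<exists>\<alpha>. (p, v, \<alpha>) \<in> L)"
  unfolding pr1_def by force

lemma pr1_fibre: "pr1 L `` {p} = fst ` (L `` {p})"
  by (force simp: pr1_iff)

text \<open>Any covector that accompanies v in \<open>L\<close> may be chosen, because isotropy
  makes its restriction to \<open>pr1 L\<close> unique. The value 0 elsewhere follows the convention
  of \<open>two_forms_on\<close>.\<close>

definition form_of :: "('a \<times> 'a tvec \<times> 'a covec) set \<Rightarrow> 'a form2" where
  "form_of L = (\<lambda>p v w. if (p, v) \<in> pr1 L \<and> (p, w) \<in> pr1 L then (SOME \<alpha>. (p, v, \<alpha>) \<in> L) w else 0)"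

text \<open>The difference (0, \<alpha> - \<alpha>') lies in \<open>L\<close>; its pairing with some
  (w, \<beta>) in \<open>L\<close> vanishes, and this pairing is \<alpha> w - \<alpha>' w.\<close>

lemma almost_dirac_covector_unique:
  assumes L: "almost_dirac X n A L" and "(p, v, \<alpha>) \<in> L" "(p, v, \<alpha>') \<in> L" "(p, w) \<in> pr1 L"
  shows "\<alpha> w = \<alpha>' w"
proof -
  have p: "p \<in> topspace X" using almost_dirac_base assms by blast
  note D = almost_diracD[OF L p]
  obtain \<beta> where \<beta>: "(p, w, \<beta>) \<in> L" using assms(4) by (auto simp: pr1_iff)
  have "\<beta> \<in> cotangent_space n A p" using D(2) \<beta> by blast
  then have "\<beta> 0 = 0"
    using linear_functional_on_zero subspace_tangent_space unfolding cotangent_space_def by blast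
  moreover have "(v, \<alpha>) - (v, \<alpha>') \<in> L `` {p}" using assms by (intro subspace_diff[OF D(1)]) auto
  then have "pairing ((v, \<alpha>) - (v, \<alpha>')) (w, \<beta>) = 0" using \<beta> by (intro D(3)) auto
  ultimately show ?thesis by (simp add: pairing_def)
qed

lemma form_of_eq:
  assumes L: "almost_dirac X n A L" and "(p, v, \<alpha>) \<in> L" "(p, w) \<in> pr1 L"
  shows "form_of L p v w = \<alpha> w"
proof -
  have "(p, v, SOME \<alpha>. (p, v, \<alpha>) \<in> L) \<in> L"
    by (rule someI[where P = "\<lambda>\<alpha>. (p, v, \<alpha>) \<in> L", OF assms(2)])
  then have "(SOME \<alpha>. (p, v, \<alpha>) \<in> L) w = \<alpha> w"
    using almost_dirac_covector_unique[OF L _ assms(2,3)] by blast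
  then show ?thesis using assms by (auto simp: form_of_def pr1_iff)
qed

text \<open>Besides the frame of \<open>pr1 L\<close>, the covectors \<alpha> i lift it to
  \<open>L\<close>. The lift is what makes \<open>form_of L\<close> computable from smooth data,
  since the \<open>SOME\<close> in its definition carries no smoothness.\<close>

lemma pr1_adapted_frame:
  assumes L: "almost_dirac X n A L" and r: "\<And>p. p \<in> topspace X \<Longrightarrow> dim (pr1 L `` {p}) = r"
    and p: "p \<in> topspace X"
  shows "\<exists>W t \<sigma> \<alpha>. p \<in> W \<and> adapted_frame (pr1 L) r W t \<sigma> \<and>
    (\<forall>i<r. smooth_one_form X n A W (\<alpha> i) \<and> (\<forall>q\<in>W. (q, t i q, \<alpha> i q) \<in> L))"
proof -
  obtain k where k: "smooth_subbundle X (smooth_generalized_section X n A) k L"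
    using L unfolding almost_dirac_def by blast
  obtain W s where W: "openin X W" "p \<in> W"
    and s: "\<And>i. i < k \<Longrightarrow> smooth_generalized_section X n A W (s i)"
    and sp: "\<And>q. q \<in> W \<Longrightarrow> span ((\<lambda>i. s i q) ` {..<k}) = L `` {q}"
    by (rule smooth_subbundle_frame[OF k p], rule that, assumption+)
  define u where "u i q = fst (s i q)" for i q
  have pr1_span: "pr1 L `` {q} = span ((\<lambda>i. u i q) ` {..<k})" if "q \<in> W" for q
    unfolding pr1_fibre sp[OF that, symmetric] u_def
    by (simp add: linear_span_image[OF linear_fst, symmetric] image_image)
  \<comment> \<open>The fields \<open>u i\<close> span every fibre over \<open>W\<close> but may be
    dependent or coincide; \<open>B\<close> is a basis at the point p only.\<close>
  obtain B where B: "B \<subseteq> (\<lambda>i. u i p) ` {..<k}" "independent B"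
      "(\<lambda>i. u i p) ` {..<k} \<subseteq> span B" "card B = dim ((\<lambda>i. u i p) ` {..<k})"
    by (rule basis_exists)
  have "card B = r" using B(4) r[OF p] pr1_span[OF W(2)] by (simp add: dim_span)
  moreover have "finite B" using B(1) finite_subset by blast
  ultimately obtain h where h: "bij_betw h {..<r} B"
    using ex_bij_betw_nat_finite[of B] by (auto simp: atLeast0LessThan)
  have "\<forall>i<r. \<exists>j<k. h i = u j p" using h B(1) unfolding bij_betw_def by blast
  then obtain e where e: "\<And>i. i < r \<Longrightarrow> e i < k" "\<And>i. i < r \<Longrightarrow> h i = u (e i) p" by metis
  define s' where "s' i = u (e i)" for i
  have "\<And>i. i < r \<Longrightarrow> smooth_vector_field n A W (s' i)"
    using s e(1) unfolding smooth_generalized_section_def s'_def u_def by blast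
  moreover have "inj_on (\<lambda>i. s' i p) {..<r}"
    using h e(2) unfolding bij_betw_def s'_def by (simp add: inj_on_def)
  moreover have "(\<lambda>i. s' i p) ` {..<r} = B"
    using h e(2) unfolding bij_betw_def s'_def by (metis (no_types, lifting) image_cong lessThan_iff)
  ultimately have "r \<le> n \<and> (\<exists>W' t \<sigma>. p \<in> W' \<and> W' \<subseteq> W \<and> local_frame W' t \<sigma> \<and> (\<forall>i<r. t i = s' i))"
    using B(2) by (intro local_frame_extend[OF W]) auto
  then obtain W' t \<sigma> where rn: "r \<le> n" and W': "p \<in> W'" "W' \<subseteq> W" and fr: "local_frame W' t \<sigma>"
    and ts: "\<forall>i<r. t i = s' i" by blast
  note D = local_frameD[OF fr]
  have sL: "(q, s j q) \<in> L" if "q \<in> W" "j < k" for q j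
  proof -
    have "s j q \<in> L `` {q}" unfolding sp[OF that(1), symmetric] using that(2) by (intro span_base) auto
    then show ?thesis by blast
  qed
  have "pr1 L `` {q} = span ((\<lambda>i. t i q) ` {..<r})" if q: "q \<in> W'" for q
  proof -
    have qW: "q \<in> W" "q \<in> topspace X" using q W' W(1) openin_subset by blast+
    have *: "\<And>i. i < r \<Longrightarrow> t i q \<in> tangent_space n A q"
      "\<And>j. j < r \<Longrightarrow> linear_functional_on (tangent_space n A q) (\<sigma> j q)"
      "\<And>i j. i < r \<Longrightarrow> j < r \<Longrightarrow> \<sigma> j q (t i q) = (if j = i then 1 else 0)"
      using D(4,6,8) q rn by auto
    have inj: "inj_on (\<lambda>i. t i q) {..<r}"
      by (rule dual_family_independent(1)[OF subspace_tangent_space, where l = "\<lambda>j. \<sigma> j q"]) (fact *)+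
    have ind: "independent ((\<lambda>i. t i q) ` {..<r})"
      by (rule dual_family_independent(2)[OF subspace_tangent_space, where l = "\<lambda>j. \<sigma> j q"]) (fact *)+
    \<comment> \<open>Constancy of the rank enters here: r independent vectors inside a space of
      dimension r span it, at every q of \<open>W'\<close>.\<close>
    have "span ((\<lambda>i. t i q) ` {..<r}) = span ((\<lambda>i. u i q) ` {..<k})"
    proof (rule independent_card_eq_dim_span[OF _ ind])
      show "(\<lambda>i. t i q) ` {..<r} \<subseteq> span ((\<lambda>i. u i q) ` {..<k})"
        using ts e(1) by (auto simp: s'_def intro!: span_base)
      show "card ((\<lambda>i. t i q) ` {..<r}) = dim (span ((\<lambda>i. u i q) ` {..<k}))"
        using r[OF qW(2)] pr1_span[OF qW(1)] card_image[OF inj] by simp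
    qed simp
    then show ?thesis using pr1_span[OF qW(1)] by simp
  qed
  then have "adapted_frame (pr1 L) r W' t \<sigma>" using fr rn unfolding adapted_frame_def by blast
  moreover have "smooth_one_form X n A W' (\<lambda>q. snd (s (e i) q))" if "i < r" for i
    using s[OF e(1)[OF that]] W'(2) unfolding smooth_generalized_section_def
    by (auto intro: smooth_one_form_subset)
  moreover have "(q, t i q, snd (s (e i) q)) \<in> L" if "i < r" "q \<in> W'" for i q
    using sL[of q "e i"] e(1)[OF that(1)] ts that W'(2) by (auto simp: s'_def u_def)
  ultimately show ?thesis using W'(1)
    by (intro exI[of _ W'] exI[of _ t] exI[of _ \<sigma>] exI[of _ "\<lambda>i q. snd (s (e i) q)"]) simp
qed

lemma pr1_subbundle:
  assumes L: "almost_dirac X n A L" and r: "\<And>p. p \<in> topspace X \<Longrightarrow> dim (pr1 L `` {p}) = r"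
  shows "smooth_subbundle X (smooth_vector_field n A) r (pr1 L)"
proof (rule smooth_subbundle_adapted_frame)
  show "pr1 L \<subseteq> topspace X \<times> UNIV" using almost_dirac_base[OF L] by (auto simp: pr1_iff)
  show "\<exists>W t \<sigma>. p \<in> W \<and> adapted_frame (pr1 L) r W t \<sigma>" if "p \<in> topspace X" for p
    using pr1_adapted_frame[OF L r that] by blast
qed

text \<open>Linearity in the second argument is that of a single covector; linearity in the first
  comes from \<open>L\<close> being a subspace fibrewise, as sums and multiples of lifts are again
  lifts. The form is alternating because the pairing of (v, \<alpha>) with itself is twice \<alpha>
  v.\<close>

lemma form_of_bilinear:
  assumes L: "almost_dirac X n A L" and p: "p \<in> topspace X" and v: "v \<in> pr1 L `` {p}"
  shows "form_of L p v v = 0" "linear_functional_on (pr1 L `` {p}) (\<lambda>w. form_of L p v w)"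
    "linear_functional_on (pr1 L `` {p}) (\<lambda>w. form_of L p w v)"
proof -
  note D = almost_diracD[OF L p]
  obtain \<alpha> where \<alpha>: "(p, v, \<alpha>) \<in> L" using v by (auto simp: pr1_iff)
  have "pairing (v, \<alpha>) (v, \<alpha>) = 0" using \<alpha> by (intro D(3)) auto
  then show "form_of L p v v = 0" using form_of_eq[OF L \<alpha>] v by (simp add: pairing_def)
  have sub: "subspace (pr1 L `` {p})"
    unfolding pr1_fibre by (rule linear_subspace_image[OF linear_fst D(1)])
  have "linear_functional_on (tangent_space n A p) \<alpha>"
    using D(2) \<alpha> unfolding cotangent_space_def by blast
  moreover have FT: "pr1 L `` {p} \<subseteq> tangent_space n A p" using D(2) by (auto simp: pr1_iff)
  ultimately have "linear_functional_on (pr1 L `` {p}) \<alpha>" by (rule linear_functional_on_subset)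
  moreover have "form_of L p v w = \<alpha> w" if "w \<in> pr1 L `` {p}" for w
    using form_of_eq[OF L \<alpha>] that by simp
  ultimately show "linear_functional_on (pr1 L `` {p}) (\<lambda>w. form_of L p v w)"
    using subspace_add[OF sub] subspace_scale[OF sub] unfolding linear_functional_on_def
    by (simp del: Image_singleton_iff)
  have vF: "(p, v) \<in> pr1 L" using v by simp
  show "linear_functional_on (pr1 L `` {p}) (\<lambda>w. form_of L p w v)"
    unfolding linear_functional_on_def
  proof (intro conjI ballI allI)
    fix w assume "w \<in> pr1 L `` {p}"
    then obtain \<beta> where \<beta>: "(p, w, \<beta>) \<in> L" by (auto simp: pr1_iff)
    have "c *\<^sub>R (w, \<beta>) \<in> L `` {p}" for c using \<beta> by (intro subspace_scale[OF D(1)]) auto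
    then have "(p, c *\<^sub>R w, c *\<^sub>R \<beta>) \<in> L" for c by (simp add: scaleR_prod_def)
    from form_of_eq[OF L this vF] form_of_eq[OF L \<beta> vF]
    show "form_of L p (c *\<^sub>R w) v = c * form_of L p w v" for c by (simp add: scaleR_fun_def)
    fix w' assume "w' \<in> pr1 L `` {p}"
    then obtain \<gamma> where \<gamma>: "(p, w', \<gamma>) \<in> L" by (auto simp: pr1_iff)
    have "(w, \<beta>) + (w', \<gamma>) \<in> L `` {p}" using \<beta> \<gamma> by (intro subspace_add[OF D(1)]) auto
    then have "(p, w + w', \<beta> + \<gamma>) \<in> L" by (simp only: add_Pair Image_singleton_iff)
    from form_of_eq[OF L this vF] form_of_eq[OF L \<beta> vF] form_of_eq[OF L \<gamma> vF]
    show "form_of L p (w + w') v = form_of L p w v + form_of L p w' v" by simp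
  qed
qed

text \<open>Smoothness rests on a local formula: expand the first field in the adapted frame and
  evaluate the lifted covectors on the second.\<close>

lemma form_of_two_form:
  assumes L: "almost_dirac X n A L" and r: "\<And>p. p \<in> topspace X \<Longrightarrow> dim (pr1 L `` {p}) = r"
  shows "form_of L \<in> two_forms_on X n A (pr1 L)"
  unfolding two_forms_on_def mem_Collect_eq
proof (intro conjI allI ballI impI)
  show "form_of L p v w = 0" if "(p, v) \<notin> pr1 L \<or> (p, w) \<notin> pr1 L" for p v w
    using that by (auto simp: form_of_def)
next
  fix p v assume "p \<in> topspace X" "v \<in> pr1 L `` {p}"
  note form_of_bilinear[OF L this]
  then show "form_of L p v v = 0" "linear_functional_on (pr1 L `` {p}) (\<lambda>w. form_of L p v w)"
    "linear_functional_on (pr1 L `` {p}) (\<lambda>w. form_of L p w v)" by auto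
next
  fix W V V' assume "openin X W \<and> smooth_vector_field n A W V \<and> smooth_vector_field n A W V' \<and>
    (\<forall>p\<in>W. (p, V p) \<in> pr1 L \<and> (p, V' p) \<in> pr1 L)"
  then have W: "openin X W" and V: "smooth_vector_field n A W V" "smooth_vector_field n A W V'"
    and VF: "\<And>p. p \<in> W \<Longrightarrow> (p, V p) \<in> pr1 L" "\<And>p. p \<in> W \<Longrightarrow> (p, V' p) \<in> pr1 L" by auto
  show "smooth_fun n A W (\<lambda>p. form_of L p (V p) (V' p))"
  proof (rule smooth_fun_local[OF W])
    fix p assume p: "p \<in> W"
    then have "p \<in> topspace X" using W openin_subset by blast
    then obtain U t \<sigma> \<alpha> where U: "p \<in> U" and fr: "adapted_frame (pr1 L) r U t \<sigma>"
      and \<alpha>: "\<And>i. i < r \<Longrightarrow> smooth_one_form X n A U (\<alpha> i)"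
      and \<alpha>L: "\<And>i q. i < r \<Longrightarrow> q \<in> U \<Longrightarrow> (q, t i q, \<alpha> i q) \<in> L"
      using pr1_adapted_frame[OF L r] by metis
    note E = adapted_frameD[OF fr]
    note D = local_frameD[OF E(1)]
    define Y where "Y = W \<inter> U"
    have Y: "openin X Y" "Y \<subseteq> W" "Y \<subseteq> U" using W D(1) by (auto simp: Y_def)
    have VY: "smooth_vector_field n A Y V" "smooth_vector_field n A Y V'"
      using smooth_vector_field_subset[OF _ Y(1,2)] V by auto
    have "smooth_fun n A Y (\<lambda>q. \<Sum>i<r. \<sigma> i q (V q) * \<alpha> i q (V' q))"
    proof (intro smooth_fun_sum[OF Y(1)] smooth_fun_mult[OF Y(1)])
      fix i assume i: "i \<in> {..<r}"
      then have "smooth_one_form X n A U (\<sigma> i)" using D(3) E(2) by simp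
      then show "smooth_fun n A Y (\<lambda>q. \<sigma> i q (V q))"
        by (rule smooth_one_form_apply[OF _ VY(1) Y(1,3)])
      show "smooth_fun n A Y (\<lambda>q. \<alpha> i q (V' q))"
        using i by (intro smooth_one_form_apply[OF \<alpha> VY(2) Y(1,3)]) auto
    qed simp
    moreover have "form_of L q (V q) (V' q) = (\<Sum>i<r. \<sigma> i q (V q) * \<alpha> i q (V' q))" if "q \<in> Y" for q
    proof -
      have q: "q \<in> W" "q \<in> U" "q \<in> topspace X" using that Y openin_subset by blast+
      have "form_of L q (V q) (V' q) = form_of L q (\<Sum>i<r. \<sigma> i q (V q) *\<^sub>R t i q) (V' q)"
        using E(7)[OF q(2) VF(1)[OF q(1)]] by simp
      also have "\<dots> = (\<Sum>i<r. \<sigma> i q (V q) * form_of L q (t i q) (V' q))"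
        using VF(2)[OF q(1)] E(5)[OF q(2)]
        by (intro linear_functional_on_sum[OF E(3)[OF q(2)] form_of_bilinear(3)[OF L q(3)]]) auto
      also have "\<dots> = (\<Sum>i<r. \<sigma> i q (V q) * \<alpha> i q (V' q))"
        using form_of_eq[OF L \<alpha>L[OF _ q(2)] VF(2)[OF q(1)]] by simp
      finally show ?thesis .
    qed
    ultimately have "smooth_fun n A Y (\<lambda>q. form_of L q (V q) (V' q))" by (rule smooth_fun_eq[OF Y(1)])
    then show "\<exists>W'. openin X W' \<and> p \<in> W' \<and> smooth_fun n A W' (\<lambda>q. form_of L q (V q) (V' q))"
      using Y(1) p U by (intro exI[of _ Y]) (auto simp: Y_def)
  qed
qed

section \<open>From two-forms to Dirac structures\<close>

lemma two_formD:
  assumes "\<Omega> \<in> two_forms_on X n A F"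
  shows "\<And>p v w. (p, v) \<notin> F \<or> (p, w) \<notin> F \<Longrightarrow> \<Omega> p v w = 0"
    "\<And>p v. p \<in> topspace X \<Longrightarrow> (p, v) \<in> F \<Longrightarrow> \<Omega> p v v = 0"
    "\<And>p v. p \<in> topspace X \<Longrightarrow> (p, v) \<in> F \<Longrightarrow> linear_functional_on (F `` {p}) (\<lambda>w. \<Omega> p v w)"
    "\<And>p v. p \<in> topspace X \<Longrightarrow> (p, v) \<in> F \<Longrightarrow> linear_functional_on (F `` {p}) (\<lambda>w. \<Omega> p w v)"
    "\<And>W V V'. openin X W \<Longrightarrow> smooth_vector_field n A W V \<Longrightarrow> smooth_vector_field n A W V' \<Longrightarrow>
      (\<And>p. p \<in> W \<Longrightarrow> (p, V p) \<in> F) \<Longrightarrow> (\<And>p. p \<in> W \<Longrightarrow> (p, V' p) \<in> F) \<Longrightarrow>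
      smooth_fun n A W (\<lambda>p. \<Omega> p (V p) (V' p))"
  using assms unfolding two_forms_on_def by simp_all

text \<open>Polarisation of \<Omega>(v + w, v + w) = 0.\<close>

lemma two_form_skew:
  assumes \<Omega>: "\<Omega> \<in> two_forms_on X n A F" and p: "p \<in> topspace X" "subspace (F `` {p})"
    and vw: "(p, v) \<in> F" "(p, w) \<in> F"
  shows "\<Omega> p v w = - \<Omega> p w v"
proof -
  note T = two_formD[OF \<Omega>]
  have s: "(p, v + w) \<in> F" using subspace_add[OF p(2), of v w] vw by simp
  have "0 = \<Omega> p (v + w) (v + w)" using T(2)[OF p(1) s] by simp
  also have "\<dots> = \<Omega> p (v + w) v + \<Omega> p (v + w) w"
    using T(3)[OF p(1) s] vw unfolding linear_functional_on_def by blast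
  also have "\<Omega> p (v + w) v = \<Omega> p v v + \<Omega> p w v"
    using T(4)[OF p(1) vw(1)] vw unfolding linear_functional_on_def by blast
  also have "\<Omega> p (v + w) w = \<Omega> p v w + \<Omega> p w w"
    using T(4)[OF p(1) vw(2)] vw unfolding linear_functional_on_def by blast
  finally show ?thesis using T(2)[OF p(1)] vw by simp
qed

text \<open>The graph of \<Omega> over F enlarged by the annihilator of F, since \<alpha> is
  prescribed on F only.\<close>

definition dirac_of :: "('a \<times> 'a tvec) set \<Rightarrow> 'a form2 \<Rightarrow> ('a \<times> 'a tvec \<times> 'a covec) set" where
  "dirac_of F \<Omega> = {(p, v, \<alpha>). (p, v) \<in> F \<and> \<alpha> \<in> cotangent_space n A p \<and> (\<forall>w. (p, w) \<in> F \<longrightarrow> \<alpha> w = \<Omega> p v w)}"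

lemma dirac_of_iff:
  "(p, v, \<alpha>) \<in> dirac_of F \<Omega> \<longleftrightarrow>
    (p, v) \<in> F \<and> \<alpha> \<in> cotangent_space n A p \<and> (\<forall>w. (p, w) \<in> F \<longrightarrow> \<alpha> w = \<Omega> p v w)"
  by (simp add: dirac_of_def)

text \<open>This covector extends \<Omega>(v, _) from F by 0 on the complementary frame vectors; its
  coefficients are smooth when v varies along a smooth section of F.\<close>

lemma frame_covector_in_dirac_of:
  assumes \<Omega>: "\<Omega> \<in> two_forms_on X n A F" and fr: "adapted_frame F k W t \<sigma>"
    and q: "q \<in> W" "q \<in> topspace X" and v: "(q, v) \<in> F"
  shows "(q, v, \<Sum>j<k. \<Omega> q v (t j q) *\<^sub>R \<sigma> j q) \<in> dirac_of F \<Omega>"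
  unfolding dirac_of_iff
proof (intro conjI allI impI v)
  note E = adapted_frameD[OF fr]
  note D = local_frameD[OF E(1)]
  show "(\<Sum>j<k. \<Omega> q v (t j q) *\<^sub>R \<sigma> j q) \<in> cotangent_space n A q"
    using D(7)[OF q(1)] E(2)
    by (intro subspace_sum[OF subspace_cotangent_space] subspace_scale[OF subspace_cotangent_space]) auto
  fix w assume w: "(q, w) \<in> F"
  have "\<Omega> q v w = \<Omega> q v (\<Sum>j<k. \<sigma> j q w *\<^sub>R t j q)" using E(7)[OF q(1) w] by simp
  also have "\<dots> = (\<Sum>j<k. \<sigma> j q w * \<Omega> q v (t j q))"
    using E(5)[OF q(1)]
    by (intro linear_functional_on_sum[OF E(3)[OF q(1)] two_formD(3)[OF \<Omega> q(2) v]]) auto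
  finally show "(\<Sum>j<k. \<Omega> q v (t j q) *\<^sub>R \<sigma> j q) w = \<Omega> q v w"
    by (simp add: sum_fun_apply scaleR_fun_def mult.commute)
qed

lemma annihilator_in_dirac_of:
  assumes \<Omega>: "\<Omega> \<in> two_forms_on X n A F" and fr: "adapted_frame F k W t \<sigma>"
    and q: "q \<in> W" "q \<in> topspace X" and j: "k \<le> j" "j < n"
  shows "(q, 0, \<sigma> j q) \<in> dirac_of F \<Omega>"
  unfolding dirac_of_iff
proof (intro conjI allI impI)
  note E = adapted_frameD[OF fr]
  note D = local_frameD[OF E(1)]
  show "(q, 0) \<in> F" using subspace_0[OF E(3)[OF q(1)]] by simp
  show "\<sigma> j q \<in> cotangent_space n A q" using D(7) q j by blast
  fix w assume w: "(q, w) \<in> F"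
  have "\<Omega> q 0 w = 0" using linear_functional_on_zero[OF two_formD(4)[OF \<Omega> q(2) w] E(3)[OF q(1)]] .
  then show "\<sigma> j q w = \<Omega> q 0 w" using E(6)[OF q(1) w j] by simp
qed

lemma subspace_dirac_of:
  assumes \<Omega>: "\<Omega> \<in> two_forms_on X n A F" and p: "p \<in> topspace X" "subspace (F `` {p})"
  shows "subspace (dirac_of F \<Omega> `` {p})"
  unfolding subspace_def
proof (intro conjI ballI allI)
  note lin = two_formD(4)[OF \<Omega> p(1)]
  have F0: "(p, 0) \<in> F" using subspace_0[OF p(2)] by simp
  have "(p, 0, 0) \<in> dirac_of F \<Omega>"
    using F0 linear_functional_on_zero[OF lin p(2)] subspace_0[OF subspace_cotangent_space]
    by (simp add: dirac_of_iff)
  then show "0 \<in> dirac_of F \<Omega> `` {p}" by (simp add: zero_prod_def)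
  fix x assume x: "x \<in> dirac_of F \<Omega> `` {p}"
  obtain v \<alpha> where xv: "x = (v, \<alpha>)" by (rule prod.exhaust)
  have v: "(p, v) \<in> F" "\<alpha> \<in> cotangent_space n A p" "\<And>w. (p, w) \<in> F \<Longrightarrow> \<alpha> w = \<Omega> p v w"
    using x unfolding xv Image_singleton_iff dirac_of_iff by auto
  show "c *\<^sub>R x \<in> dirac_of F \<Omega> `` {p}" for c
  proof -
    have "(p, c *\<^sub>R v) \<in> F" using subspace_scale[OF p(2), of v c] v by simp
    moreover have "(c *\<^sub>R \<alpha>) w = \<Omega> p (c *\<^sub>R v) w" if "(p, w) \<in> F" for w
      using lin[OF that] v(1) v(3)[OF that] unfolding linear_functional_on_def by (simp add: scaleR_fun_def)
    ultimately show ?thesis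
      using subspace_scale[OF subspace_cotangent_space v(2)]
      unfolding xv scaleR_Pair Image_singleton_iff dirac_of_iff by blast
  qed
  fix y assume y: "y \<in> dirac_of F \<Omega> `` {p}"
  obtain v' \<alpha>' where yv: "y = (v', \<alpha>')" by (rule prod.exhaust)
  have v': "(p, v') \<in> F" "\<alpha>' \<in> cotangent_space n A p" "\<And>w. (p, w) \<in> F \<Longrightarrow> \<alpha>' w = \<Omega> p v' w"
    using y unfolding yv Image_singleton_iff dirac_of_iff by auto
  have "(p, v + v') \<in> F" using subspace_add[OF p(2), of v v'] v v' by simp
  moreover have "(\<alpha> + \<alpha>') w = \<Omega> p (v + v') w" if "(p, w) \<in> F" for w
    using lin[OF that] v(1) v(3)[OF that] v'(1) v'(3)[OF that] unfolding linear_functional_on_def by simp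
  ultimately show "x + y \<in> dirac_of F \<Omega> `` {p}"
    using subspace_add[OF subspace_cotangent_space v(2) v'(2)]
    unfolding xv yv add_Pair Image_singleton_iff dirac_of_iff by blast
qed

lemma isotropic_dirac_of:
  assumes F: "smooth_subbundle X (smooth_vector_field n A) k F"
    and \<Omega>: "\<Omega> \<in> two_forms_on X n A F" and p: "p \<in> topspace X"
  shows "isotropic_subspace (tangent_space n A p \<times> cotangent_space n A p) (dirac_of F \<Omega> `` {p})"
proof -
  obtain W t \<sigma> where W: "p \<in> W" and fr: "adapted_frame F k W t \<sigma>"
    using adapted_frame_exists[OF F p] by blast
  note E = adapted_frameD[OF fr]
  have "dirac_of F \<Omega> `` {p} \<subseteq> tangent_space n A p \<times> cotangent_space n A p"
    using E(4)[OF W] by (auto simp: dirac_of_iff)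
  moreover have "pairing u w = 0" if "u \<in> dirac_of F \<Omega> `` {p}" "w \<in> dirac_of F \<Omega> `` {p}" for u w
    using that two_form_skew[OF \<Omega> p E(3)[OF W], of "fst u" "fst w"]
    by (cases u, cases w) (auto simp: dirac_of_iff pairing_def)
  ultimately show ?thesis
    using subspace_dirac_of[OF \<Omega> p E(3)[OF W]] unfolding isotropic_subspace_def by blast
qed

text \<open>Testing against the annihilators (0, \<sigma> j) forces v into F; testing against lifts
  (w, \<beta>) of all w in F forces \<alpha> to agree with \<Omega>(v, _) there, by skew
  symmetry.\<close>

lemma maximal_isotropic_dirac_of:
  assumes F: "smooth_subbundle X (smooth_vector_field n A) k F"
    and \<Omega>: "\<Omega> \<in> two_forms_on X n A F" and p: "p \<in> topspace X"
  shows "maximal_isotropic (tangent_space n A p \<times> cotangent_space n A p) (dirac_of F \<Omega> `` {p})"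
  unfolding maximal_isotropic_def
proof (intro conjI allI impI isotropic_dirac_of[OF assms])
  obtain W t \<sigma> where W: "p \<in> W" and fr: "adapted_frame F k W t \<sigma>"
    using adapted_frame_exists[OF F p] by blast
  note E = adapted_frameD[OF fr]
  fix S assume "isotropic_subspace (tangent_space n A p \<times> cotangent_space n A p) S \<and> dirac_of F \<Omega> `` {p} \<subseteq> S"
  then have ST: "S \<subseteq> tangent_space n A p \<times> cotangent_space n A p"
    and iso: "\<And>u w. u \<in> S \<Longrightarrow> w \<in> S \<Longrightarrow> pairing u w = 0"
    and sub: "dirac_of F \<Omega> `` {p} \<subseteq> S"
    unfolding isotropic_subspace_def by auto
  have "(p, v, \<alpha>) \<in> dirac_of F \<Omega>" if S: "(v, \<alpha>) \<in> S" for v \<alpha>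
  proof -
    have vT: "v \<in> tangent_space n A p" and \<alpha>T: "\<alpha> \<in> cotangent_space n A p" using ST S by auto
    have \<alpha>0: "\<alpha> 0 = 0"
      using linear_functional_on_zero \<alpha>T subspace_tangent_space unfolding cotangent_space_def by blast
    have vF: "(p, v) \<in> F"
    proof (rule E(8)[OF W vT])
      fix j assume "k \<le> j" "j < n"
      from annihilator_in_dirac_of[OF \<Omega> fr W p this] sub have "(0, \<sigma> j p) \<in> S" by blast
      from iso[OF S this] show "\<sigma> j p v = 0" by (simp add: pairing_def \<alpha>0)
    qed
    have "\<alpha> w = \<Omega> p v w" if w: "(p, w) \<in> F" for w
    proof -
      obtain \<beta> where \<beta>: "(p, w, \<beta>) \<in> dirac_of F \<Omega>"
        using frame_covector_in_dirac_of[OF \<Omega> fr W p w] by blast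
      then have "(w, \<beta>) \<in> S" using sub by blast
      from iso[OF S this] have "\<alpha> w + \<beta> v = 0" by (simp add: pairing_def)
      moreover have "\<beta> v = \<Omega> p w v" using \<beta> vF by (simp add: dirac_of_iff)
      ultimately show ?thesis using two_form_skew[OF \<Omega> p E(3)[OF W] vF w] by simp
    qed
    then show ?thesis using vF \<alpha>T by (simp add: dirac_of_iff)
  qed
  then show "S = dirac_of F \<Omega> `` {p}" using sub by auto
qed

text \<open>The rank is n for every k: there are k lifts of frame vectors of F and n - k
  annihilating covectors. Independence and spanning both follow from a dual family on the
  fibre.\<close>

lemma dirac_of_subbundle:
  assumes F: "smooth_subbundle X (smooth_vector_field n A) k F" and \<Omega>: "\<Omega> \<in> two_forms_on X n A F"
  shows "smooth_subbundle X (smooth_generalized_section X n A) n (dirac_of F \<Omega>)"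
  unfolding smooth_subbundle_def
proof (intro conjI ballI)
  show "dirac_of F \<Omega> \<subseteq> topspace X \<times> UNIV"
    using subbundle_base[OF F] by (auto simp: dirac_of_iff)
  fix p assume p: "p \<in> topspace X"
  obtain W t \<sigma> where W: "p \<in> W" and fr: "adapted_frame F k W t \<sigma>"
    using adapted_frame_exists[OF F p] by blast
  note E = adapted_frameD[OF fr]
  note D = local_frameD[OF E(1)]
  define s where "s i q = (if i < k then (t i q, \<Sum>j<k. \<Omega> q (t i q) (t j q) *\<^sub>R \<sigma> j q) else (0, \<sigma> i q))" for i q
  \<comment> \<open>Dual to \<open>s\<close>: below k read a coefficient of the vector part, from k
    on evaluate the covector part on a complementary frame vector.\<close>
  define l where "l j q u = (if j < k then \<sigma> j q (fst u) else snd u (t j q))"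
    for j q and u :: "'a tvec \<times> 'a covec"
  have "smooth_generalized_section X n A W (s i)" if i: "i < n" for i
  proof (cases "i < k")
    case True
    have "smooth_one_form X n A W (\<lambda>q. \<Sum>j<k. \<Omega> q (t i q) (t j q) *\<^sub>R \<sigma> j q)"
    proof (rule smooth_one_form_sum)
      fix j assume "j \<in> {..<k}"
      then have j: "j < k" "j < n" using E(2) by auto
      show "smooth_one_form X n A W (\<sigma> j)" using D(3) j by blast
      show "smooth_fun n A W (\<lambda>q. \<Omega> q (t i q) (t j q))"
        by (rule two_formD(5)[OF \<Omega> D(1) D(2)[OF i] D(2)[OF j(2)]]) (use E(5) True j in auto)
    qed simp
    then show ?thesis using D(2)[OF i] True by (simp add: smooth_generalized_section_def s_def)
  next
    case False
    have "smooth_vector_field n A W (\<lambda>q. fst (s i q))"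
      using smooth_vector_field_zero[OF D(1)] by (simp only: s_def False if_False fst_conv)
    moreover have "smooth_one_form X n A W (\<lambda>q. snd (s i q))"
      using D(3)[OF i] by (simp add: s_def False)
    ultimately show ?thesis by (simp add: smooth_generalized_section_def)
  qed
  moreover have "inj_on (\<lambda>i. s i q) {..<n} \<and> independent ((\<lambda>i. s i q) ` {..<n}) \<and>
      span ((\<lambda>i. s i q) ` {..<n}) = dirac_of F \<Omega> `` {q}" if q: "q \<in> W" for q
  proof -
    let ?S = "dirac_of F \<Omega> `` {q}"
    have qX: "q \<in> topspace X" using q D(1) openin_subset by blast
    have S: "subspace ?S" by (rule subspace_dirac_of[OF \<Omega> qX E(3)[OF q]])
    have sS: "s i q \<in> ?S" if "i < n" for i
      using frame_covector_in_dirac_of[OF \<Omega> fr q qX E(5)[OF q, of i]]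
        annihilator_in_dirac_of[OF \<Omega> fr q qX, of i] that by (simp add: s_def)
    have ST: "u \<in> ?S \<Longrightarrow> fst u \<in> tangent_space n A q" for u
      using E(4)[OF q] by (cases u) (auto simp: dirac_of_iff)
    have lin: "linear_functional_on ?S (l j q)" if j: "j < n" for j
      using D(8)[OF q j] ST unfolding l_def linear_functional_on_def by (simp add: scaleR_fun_def)
    have dual: "l j q (s i q) = (if j = i then 1 else 0)" if ij: "i < n" "j < n" for i j
    proof -
      have "\<sigma> j q 0 = 0" using linear_functional_on_zero[OF D(8)[OF q ij(2)] subspace_tangent_space] .
      \<comment> \<open>The lifts have no component along the annihilators, because they were
        extended by 0 on the complementary frame vectors.\<close>
      moreover have "(\<Sum>m<k. \<Omega> q (t i q) (t m q) *\<^sub>R \<sigma> m q) (t j q) = 0" if "\<not> j < k"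
        using that D(4)[OF q _ ij(2)] E(2)
        by (simp add: sum_fun_apply scaleR_fun_def sum.neutral)
      ultimately show ?thesis using D(4)[OF q ij(2,1)] D(4)[OF q ij] by (auto simp: l_def s_def)
    qed
    have sep: "u = 0" if u: "u \<in> ?S" and 0: "\<And>j. j < n \<Longrightarrow> l j q u = 0" for u
    proof -
      obtain v \<alpha> where uv: "u = (v, \<alpha>)" by (rule prod.exhaust)
      have v: "(q, v) \<in> F" and \<alpha>: "\<alpha> \<in> cotangent_space n A q" and \<alpha>\<Omega>: "\<And>w. (q, w) \<in> F \<Longrightarrow> \<alpha> w = \<Omega> q v w"
        using u unfolding uv Image_singleton_iff dirac_of_iff by auto
      have "\<sigma> j q v = 0" if "j < k" for j using 0[of j] that E(2) by (simp add: l_def uv)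
      then have v0: "v = 0" using E(7)[OF q v] by simp
      have \<alpha>t: "\<alpha> (t j q) = 0" if j: "j < n" for j
      proof (cases "j < k")
        case True
        then have tF: "(q, t j q) \<in> F" using E(5) q by blast
        then show ?thesis
          using \<alpha>\<Omega>[OF tF] v0 linear_functional_on_zero[OF two_formD(4)[OF \<Omega> qX tF] E(3)[OF q]] by simp
      next
        case False
        then show ?thesis using 0[OF j] by (simp add: l_def uv)
      qed
      \<comment> \<open>Covectors are compared as functions on all of \<open>'a tvec\<close>, so
        their values off the tangent space count as well.\<close>
      have "\<alpha> w = 0" for w
      proof (cases "w \<in> tangent_space n A q")
        case True
        have "\<alpha> w = \<alpha> (\<Sum>j<n. \<sigma> j q w *\<^sub>R t j q)" using D(5)[OF q True] by simp
        also have "\<dots> = (\<Sum>j<n. \<sigma> j q w * \<alpha> (t j q))"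
          using \<alpha> D(6)[OF q] unfolding cotangent_space_def
          by (intro linear_functional_on_sum[OF subspace_tangent_space]) auto
        also have "\<dots> = 0" using \<alpha>t by simp
        finally show ?thesis .
      next
        case False
        then show ?thesis using \<alpha> unfolding cotangent_space_def by blast
      qed
      then have "\<alpha> = 0" by (simp add: fun_eq_iff)
      then show ?thesis by (simp only: uv v0 zero_prod_def)
    qed
    show ?thesis
      using dual_family_independent[OF S, of n "\<lambda>i. s i q" "\<lambda>j. l j q"] sS lin dual
        dual_family_span[OF S, of n "\<lambda>i. s i q" "\<lambda>j. l j q"] sep by blast
  qed
  ultimately show "\<exists>W s. openin X W \<and> p \<in> W \<and> (\<forall>i<n. smooth_generalized_section X n A W (s i)) \<and>
    (\<forall>q\<in>W. inj_on (\<lambda>i. s i q) {..<n} \<and> independent ((\<lambda>i. s i q) ` {..<n}) \<and>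
       span ((\<lambda>i. s i q) ` {..<n}) = dirac_of F \<Omega> `` {q})"
    using D(1) W by (intro exI[of _ W] exI[of _ s]) simp
qed

lemma pr1_dirac_of:
  assumes F: "smooth_subbundle X (smooth_vector_field n A) k F" and \<Omega>: "\<Omega> \<in> two_forms_on X n A F"
  shows "pr1 (dirac_of F \<Omega>) = F"
proof -
  have "\<exists>\<alpha>. (p, v, \<alpha>) \<in> dirac_of F \<Omega>" if v: "(p, v) \<in> F" for p v
  proof -
    have p: "p \<in> topspace X" using subbundle_base[OF F v] .
    obtain W t \<sigma> where "p \<in> W" "adapted_frame F k W t \<sigma>"
      using adapted_frame_exists[OF F p] by blast
    then show ?thesis using frame_covector_in_dirac_of[OF \<Omega> _ _ p v] by blast
  qed
  then show ?thesis by (auto simp: pr1_iff dirac_of_iff)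
qed

lemma regular_almost_dirac_dirac_of:
  assumes F: "smooth_subbundle X (smooth_vector_field n A) k F" and \<Omega>: "\<Omega> \<in> two_forms_on X n A F"
  shows "regular_almost_dirac X n A (dirac_of F \<Omega>)"
  unfolding regular_almost_dirac_def almost_dirac_def pr1_dirac_of[OF assms]
  using dirac_of_subbundle[OF assms] maximal_isotropic_dirac_of[OF assms] dim_subbundle_fibre[OF F] by blast

lemma form_of_dirac_of:
  assumes F: "smooth_subbundle X (smooth_vector_field n A) k F" and \<Omega>: "\<Omega> \<in> two_forms_on X n A F"
  shows "form_of (dirac_of F \<Omega>) = \<Omega>"
proof (intro ext)
  have L: "almost_dirac X n A (dirac_of F \<Omega>)"
    using regular_almost_dirac_dirac_of[OF assms] unfolding regular_almost_dirac_def by blast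
  fix p v w
  show "form_of (dirac_of F \<Omega>) p v w = \<Omega> p v w"
  proof (cases "(p, v) \<in> F \<and> (p, w) \<in> F")
    case True
    then have "(p, v) \<in> pr1 (dirac_of F \<Omega>)" unfolding pr1_dirac_of[OF assms] by blast
    then obtain \<alpha> where \<alpha>: "(p, v, \<alpha>) \<in> dirac_of F \<Omega>" by (auto simp only: pr1_iff)
    then have "form_of (dirac_of F \<Omega>) p v w = \<alpha> w"
      using True by (intro form_of_eq[OF L]) (simp_all add: pr1_dirac_of[OF assms])
    then show ?thesis using \<alpha> True by (simp add: dirac_of_iff)
  next
    case False
    then show ?thesis using two_formD(1)[OF \<Omega>] unfolding form_of_def pr1_dirac_of[OF assms] by auto
  qed
qed

lemma dirac_of_form_of:
  assumes L: "almost_dirac X n A L" and r: "\<And>p. p \<in> topspace X \<Longrightarrow> dim (pr1 L `` {p}) = r"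
  shows "dirac_of (pr1 L) (form_of L) = L"
proof -
  have F: "smooth_subbundle X (smooth_vector_field n A) r (pr1 L)" by (rule pr1_subbundle[OF L]) (rule r)
  have \<Omega>: "form_of L \<in> two_forms_on X n A (pr1 L)" by (rule form_of_two_form[OF L]) (rule r)
  have eq: "dirac_of (pr1 L) (form_of L) `` {p} = L `` {p}" for p
  proof (cases "p \<in> topspace X")
    case True
    note D = almost_diracD[OF L True]
    have "L `` {p} \<subseteq> dirac_of (pr1 L) (form_of L) `` {p}"
    proof
      fix u assume u: "u \<in> L `` {p}"
      obtain v \<alpha> where uv: "u = (v, \<alpha>)" by (rule prod.exhaust)
      have vL: "(p, v, \<alpha>) \<in> L" using u uv by simp
      then have "(p, v) \<in> pr1 L" "\<alpha> \<in> cotangent_space n A p" using D(2) by (auto simp: pr1_iff)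
      then have "(p, v, \<alpha>) \<in> dirac_of (pr1 L) (form_of L)"
        using form_of_eq[OF L vL] unfolding dirac_of_iff by simp
      then show "u \<in> dirac_of (pr1 L) (form_of L) `` {p}" by (simp add: uv)
    qed
    then show ?thesis by (rule D(4)[OF isotropic_dirac_of[OF F \<Omega> True]])
  next
    \<comment> \<open>Over a point outside \<open>topspace X\<close> both fibres are empty.\<close>
    case False
    then show ?thesis
      using almost_dirac_base[OF L] subbundle_base[OF F] by (auto simp: dirac_of_iff)
  qed
  have "(p, u) \<in> dirac_of (pr1 L) (form_of L) \<longleftrightarrow> (p, u) \<in> L" for p u
    using arg_cong[OF eq[of p], of "\<lambda>S. u \<in> S"] by simp
  then show ?thesis by (intro set_eqI) (simp only: split_paired_all)
qed

lemma dirac_correspondence: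
  "bij_betw (\<lambda>L. (pr1 L, form_of L)) {L. regular_almost_dirac X n A L}
     {(F, \<Omega>). regular_distribution X n A F \<and> \<Omega> \<in> two_forms_on X n A F}"
proof (rule bij_betw_byWitness[where f' = "\<lambda>(F, \<Omega>). dirac_of F \<Omega>"])
  show "\<forall>L\<in>{L. regular_almost_dirac X n A L}. (case (pr1 L, form_of L) of (F, \<Omega>) \<Rightarrow> dirac_of F \<Omega>) = L"
  proof
    fix L assume "L \<in> {L. regular_almost_dirac X n A L}"
    then obtain r where "almost_dirac X n A L" "\<And>p. p \<in> topspace X \<Longrightarrow> dim (pr1 L `` {p}) = r"
      unfolding regular_almost_dirac_def by auto
    from dirac_of_form_of[OF this] show "(case (pr1 L, form_of L) of (F, \<Omega>) \<Rightarrow> dirac_of F \<Omega>) = L"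
      by simp
  qed
  show "\<forall>x\<in>{(F, \<Omega>). regular_distribution X n A F \<and> \<Omega> \<in> two_forms_on X n A F}.
      (pr1 (case x of (F, \<Omega>) \<Rightarrow> dirac_of F \<Omega>), form_of (case x of (F, \<Omega>) \<Rightarrow> dirac_of F \<Omega>)) = x"
    unfolding regular_distribution_def by (auto simp: pr1_dirac_of form_of_dirac_of)
  show "(\<lambda>L. (pr1 L, form_of L)) ` {L. regular_almost_dirac X n A L} \<subseteq>
      {(F, \<Omega>). regular_distribution X n A F \<and> \<Omega> \<in> two_forms_on X n A F}"
    unfolding regular_almost_dirac_def regular_distribution_def
    by (auto intro!: exI pr1_subbundle form_of_two_form)
  show "(\<lambda>(F, \<Omega>). dirac_of F \<Omega>) ` {(F, \<Omega>). regular_distribution X n A F \<and> \<Omega> \<in> two_forms_on X n A F} \<subseteq>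
      {L. regular_almost_dirac X n A L}"
    unfolding regular_distribution_def by (auto intro: regular_almost_dirac_dirac_of)
qed

section \<open>Partitions of unity and a smooth projection onto a distribution\<close>

text \<open>The support sits in a closed coordinate cube. Its preimage \<open>K\<close> in
  \<open>X\<close> is compact, hence closed because \<open>X\<close> is Hausdorff, and closedness
  makes the extension by 0 smooth beyond the chart.\<close>

lemma smooth_bump_exists:
  assumes W: "openin X W" and p: "p \<in> W"
  shows "\<exists>\<psi> V K. smooth_fun n A (topspace X) \<psi> \<and> openin X V \<and> p \<in> V \<and> closedin X K \<and> K \<subseteq> W \<and>
    (\<forall>q\<in>V. \<psi> q = 1) \<and> (\<forall>q\<in>topspace X - K. \<psi> q = 0)"
proof -
  obtain c where c: "c \<in> A" "p \<in> fst c" using chart_around p W openin_subset by blast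
  define x where "x = snd c p"
  have "openin (Euclidean_space n) (snd c ` (fst c \<inter> W))" "x \<in> snd c ` (fst c \<inter> W)"
    using openin_chart_inter_image c W p by (auto simp: x_def)
  then obtain e where e: "e > 0"
      "\<And>y. (\<forall>i\<ge>n. y i = 0) \<and> (\<forall>i<n. \<bar>y i - x i\<bar> < e) \<Longrightarrow> y \<in> snd c ` (fst c \<inter> W)"
    using Euclidean_space_open_box by blast
  have oc: "openin (Euclidean_space n) (snd c ` fst c)" using c by (simp add: openin_chart_image)
  have zero: "snd c q i = 0" if "q \<in> fst c" "i \<ge> n" for q i
    using openin_Euclidean_space_zero[OF oc _ that(2)] that(1) by blast
  \<comment> \<open>Half the radius keeps the closed cube inside the open one.\<close>
  define r where "r = e / 2"
  have r: "0 < r" "r < e" using e(1) by (auto simp: r_def)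
  define B where "B = (\<Pi>\<^sub>E i\<in>UNIV. if i < n then {x i - r..x i + r} else {0})"
  have B_iff: "y \<in> B \<longleftrightarrow> (\<forall>i\<ge>n. y i = 0) \<and> (\<forall>i<n. \<bar>y i - x i\<bar> \<le> r)" for y
  proof -
    have "y i \<in> (if i < n then {x i - r..x i + r} else {0}) \<longleftrightarrow>
        (i \<ge> n \<longrightarrow> y i = 0) \<and> (i < n \<longrightarrow> \<bar>y i - x i\<bar> \<le> r)" for i
      by (cases "i < n") (auto simp: abs_le_iff)
    then show ?thesis by (auto simp only: B_def PiE_UNIV_domain Pi_iff)
  qed
  have "compactin (powertop_real UNIV) B"
    unfolding B_def compactin_PiE by auto
  then have cB: "compactin (Euclidean_space n) B"
    unfolding Euclidean_space_def compactin_subtopology using B_iff by blast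
  have Bsub: "B \<subseteq> snd c ` (fst c \<inter> W)"
  proof
    fix y assume "y \<in> B"
    then show "y \<in> snd c ` (fst c \<inter> W)"
      unfolding B_iff using r(2) by (intro e(2)) force
  qed
  define g where "g = inv_into (fst c) (snd c)"
  have g: "g (snd c q) = q" if "q \<in> fst c" for q using c that by (simp add: g_def)
  define K where "K = g ` B"
  have K_iff: "q \<in> K \<longleftrightarrow> q \<in> fst c \<and> snd c q \<in> B" for q
    using Bsub g unfolding K_def by (auto simp: image_iff) (metis IntD1 image_iff subsetD)
  have KW: "K \<subseteq> W" using Bsub g unfolding K_def by (auto simp: image_subset_iff)
  \<comment> \<open>Continuity of the inverse chart as a map into \<open>X\<close> carries
    compactness of \<open>B\<close> over to \<open>K\<close>.\<close>
  have "continuous_map (subtopology (Euclidean_space n) (snd c ` fst c)) X g"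
    unfolding continuous_map_def
  proof (intro conjI allI impI)
    have top: "topspace (subtopology (Euclidean_space n) (snd c ` fst c)) = snd c ` fst c"
      using openin_subset[OF oc] by auto
    show "g \<in> topspace (subtopology (Euclidean_space n) (snd c ` fst c)) \<rightarrow> topspace X"
      unfolding top using g openin_subset[OF openin_chart[OF c(1)]] by auto
    fix U assume U: "openin X U"
    have "{y \<in> snd c ` fst c. g y \<in> U} = snd c ` (fst c \<inter> U)" using g by auto
    then show "openin (subtopology (Euclidean_space n) (snd c ` fst c))
        {y \<in> topspace (subtopology (Euclidean_space n) (snd c ` fst c)). g y \<in> U}"
      unfolding top using openin_chart_inter_image[OF c(1) U] openin_open_subtopology[OF oc] by auto
  qed
  moreover have "compactin (subtopology (Euclidean_space n) (snd c ` fst c)) B"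
    using cB Bsub unfolding compactin_subtopology by blast
  ultimately have "compactin X K" unfolding K_def by (rule image_compactin[rotated])
  moreover have "Hausdorff_space X" using mfd unfolding smooth_manifold_def by blast
  ultimately have K: "closedin X K" by (rule compactin_imp_closedin[rotated])
  have "r\<^sup>2 / 2 > 0" using r by simp
  then obtain \<theta> :: "real \<Rightarrow> real" where \<theta>: "\<And>u. u \<le> 0 \<Longrightarrow> \<theta> u = 0" "\<And>u. u \<ge> r\<^sup>2 / 2 \<Longrightarrow> \<theta> u = 1"
      "\<And>n V f. openin (Euclidean_space n) V \<Longrightarrow> smooth_on n V f \<Longrightarrow> smooth_on n V (\<lambda>x. \<theta> (f x))"
    using smooth_cutoff_exists[of "r\<^sup>2 / 2"] by blast
  \<comment> \<open>Squares replace absolute values, which are not smooth. A factor vanishes when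
    the distance in its coordinate is at least r, and is 1 when that distance is at most r/2, since
    r^2 - r^2/4 exceeds the threshold r^2/2.\<close>
  define h where "h y = (\<Prod>i<n. \<theta> (r\<^sup>2 - (y i - x i) * (y i - x i)))" for y
  define \<psi> where "\<psi> q = (if q \<in> fst c then h (snd c q) else 0)" for q
  have \<psi>0: "\<psi> q = 0" if nK: "q \<notin> K" for q
  proof (cases "q \<in> fst c")
    case True
    then obtain i where i: "i < n" "\<bar>snd c q i - x i\<bar> > r"
      using nK zero unfolding K_iff B_iff by force
    have "r * r \<le> \<bar>snd c q i - x i\<bar> * \<bar>snd c q i - x i\<bar>" using i(2) r(1) by (intro mult_mono) auto
    then have "\<theta> (r\<^sup>2 - (snd c q i - x i) * (snd c q i - x i)) = 0"
      by (intro \<theta>(1)) (simp add: power2_eq_square flip: abs_mult)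
    then have "h (snd c q) = 0" unfolding h_def using i(1) by (intro prod_zero) auto
    then show ?thesis by (simp add: \<psi>_def)
  qed (simp add: \<psi>_def)
  have "smooth_fun n A (topspace X) \<psi>"
  proof (rule smooth_fun_local[OF openin_topspace])
    fix q assume q: "q \<in> topspace X"
    show "\<exists>W'. openin X W' \<and> q \<in> W' \<and> smooth_fun n A W' \<psi>"
    proof (cases "q \<in> fst c")
      case True
      have "smooth_on n (snd c ` fst c) h"
        unfolding h_def
        by (intro smooth_on_prod[OF oc] \<theta>(3)[OF oc] smooth_on_diff[OF oc] smooth_on_mult[OF oc]
            smooth_on_const[OF oc] smooth_on_coordinate[OF oc]) auto
      then have "smooth_on n (snd c ` fst c) (\<lambda>y. \<psi> (inv_into (fst c) (snd c) y))"
        by (rule smooth_on_eq[OF oc]) (use c in \<open>auto simp: \<psi>_def\<close>)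
      then have "smooth_fun n A (fst c) \<psi>" using c by (intro smooth_fun_chart[OF c(1)]) auto
      then show ?thesis using True c by (intro exI[of _ "fst c"]) simp
    next
      case False
      have o: "openin X (topspace X - K)" using K by blast
      have "smooth_fun n A (topspace X - K) \<psi>"
        by (rule smooth_fun_eq[OF o smooth_fun_const[OF o, of 0]]) (simp add: \<psi>0)
      then show ?thesis using o q False K_iff by blast
    qed
  qed
  moreover define T where "T = {y. \<forall>i\<ge>n. y i = 0} \<inter> (\<Inter>i\<in>{..<n}. {y. \<bar>y i - x i\<bar> < r / 2})"
  have "open {y :: nat \<Rightarrow> real. \<bar>y i - x i\<bar> < r / 2}" for i
    by (intro open_Collect_less continuous_intros continuous_on_product_then_coordinatewise[OF continuous_on_id])
  then have "openin (Euclidean_space n) T"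
    unfolding T_def Euclidean_space_eq_top_of_set by (intro openin_open_Int open_INT) auto
  then have "openin X {q \<in> fst c. snd c q \<in> T}" by (rule openin_chart_preimage[OF c(1)])
  moreover have "p \<in> {q \<in> fst c. snd c q \<in> T}" using c zero r(1) by (simp add: T_def x_def)
  moreover have "\<psi> q = 1" if q: "q \<in> {q \<in> fst c. snd c q \<in> T}" for q
  proof -
    have "\<theta> (r\<^sup>2 - (snd c q i - x i) * (snd c q i - x i)) = 1" if i: "i < n" for i
    proof (rule \<theta>(2))
      have "\<bar>snd c q i - x i\<bar> < r / 2" using q i by (simp add: T_def)
      then have "\<bar>snd c q i - x i\<bar> * \<bar>snd c q i - x i\<bar> \<le> (r / 2) * (r / 2)"
        using r(1) by (intro mult_mono) auto
      then have "(snd c q i - x i) * (snd c q i - x i) \<le> r\<^sup>2 / 4"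
        by (simp add: power2_eq_square)
      then show "r\<^sup>2 / 2 \<le> r\<^sup>2 - (snd c q i - x i) * (snd c q i - x i)"
        using zero_le_power2[of r] by linarith
    qed
    then have "h (snd c q) = 1" unfolding h_def by (intro prod.neutral) auto
    then show ?thesis using q by (simp add: \<psi>_def)
  qed
  ultimately show ?thesis using K KW \<psi>0
    by (intro exI[of _ \<psi>] exI[of _ "{q \<in> fst c. snd c q \<in> T}"] exI[of _ K]) simp
qed

text \<open>With \<open>\<psi> k = 1\<close> on the k-th set of a countable cover, the functions
  \<open>\<psi> k * (\<Prod>i<k. 1 - \<psi> i)\<close> telescope to sum 1, and all those of index greater than k vanish on that
  set; so no locally finite refinement of the cover is needed.\<close>

lemma smooth_partition_of_unity:
  assumes W: "\<And>p. p \<in> topspace X \<Longrightarrow> openin X (W p) \<and> p \<in> W p" and ne: "topspace X \<noteq> {}"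
  obtains a :: "nat \<Rightarrow> 'a" and \<rho> :: "nat \<Rightarrow> 'a \<Rightarrow> real" and K :: "nat \<Rightarrow> 'a set"
  where "\<And>k. a k \<in> topspace X" "\<And>k. smooth_fun n A (topspace X) (\<rho> k)" "\<And>k. closedin X (K k)"
    "\<And>k. K k \<subseteq> W (a k)" "\<And>k q. q \<in> topspace X \<Longrightarrow> q \<notin> K k \<Longrightarrow> \<rho> k q = 0"
    "\<And>q. q \<in> topspace X \<Longrightarrow> \<exists>V m. openin X V \<and> q \<in> V \<and>
       (\<forall>x\<in>V. (\<forall>k\<ge>m. \<rho> k x = 0) \<and> (\<Sum>k<m. \<rho> k x) = 1)"
proof -
  \<comment> \<open>The three objects are packed into one tuple so that a single choice function
    provides a compatible triple for each p.\<close>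
  define good where "good p z = (case z of (\<psi>, V, K) \<Rightarrow> smooth_fun n A (topspace X) \<psi> \<and> openin X V \<and> p \<in> V \<and>
     closedin X K \<and> K \<subseteq> W p \<and> (\<forall>q\<in>V. \<psi> q = 1) \<and> (\<forall>q\<in>topspace X - K. \<psi> q = 0))"
    for p and z :: "('a \<Rightarrow> real) \<times> 'a set \<times> 'a set"
  have "\<forall>p\<in>topspace X. \<exists>z. good p z"
    unfolding good_def split_paired_Ex prod.case by (intro ballI smooth_bump_exists) (use W in auto)
  then obtain z where z: "\<And>p. p \<in> topspace X \<Longrightarrow> good p (z p)" unfolding bchoice_iff by blast
  define \<psi> where "\<psi> p = fst (z p)" for p
  define V where "V p = fst (snd (z p))" for p
  define K where "K p = snd (snd (z p))" for p
  have b: "smooth_fun n A (topspace X) (\<psi> p) \<and> openin X (V p) \<and>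
      p \<in> V p \<and> closedin X (K p) \<and> K p \<subseteq> W p \<and> (\<forall>q\<in>V p. \<psi> p q = 1) \<and> (\<forall>q\<in>topspace X - K p. \<psi> p q = 0)"
    if "p \<in> topspace X" for p
    using z[OF that] by (simp add: good_def \<psi>_def V_def K_def case_prod_beta)
  have "Lindelof_space X"
    using mfd second_countable_imp_Lindelof_space unfolding smooth_manifold_def by blast
  moreover have "\<forall>U\<in>V ` topspace X. openin X U" using b by blast
  moreover have "\<Union>(V ` topspace X) = topspace X" using b openin_subset by blast
  ultimately obtain \<V> where \<V>: "countable \<V>" "\<V> \<subseteq> V ` topspace X" "\<Union>\<V> = topspace X"
    unfolding Lindelof_space_def by metis
  obtain C where C: "countable C" "C \<subseteq> topspace X" "\<V> = V ` C"
    using \<V>(1,2) by (metis countable_subset_image)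
  have "C \<noteq> {}" using C(3) \<V>(3) ne by (metis Union_empty image_empty)
  \<comment> \<open>The enumeration repeats points when \<open>C\<close> is finite; the telescoping
    identity holds for any sequence.\<close>
  define a where "a = from_nat_into C"
  have ran: "range a = C" using range_from_nat_into[OF \<open>C \<noteq> {}\<close> C(1)] by (simp add: a_def)
  then have aX: "a k \<in> topspace X" for k using C(2) by blast
  define \<rho> where "\<rho> k q = \<psi> (a k) q * (\<Prod>i<k. 1 - \<psi> (a i) q)" for k q
  have tele: "(\<Sum>k<m. \<rho> k q) = 1 - (\<Prod>i<m. 1 - \<psi> (a i) q)" for m q
    by (induction m) (auto simp: \<rho>_def algebra_simps)
  show thesis
  proof (rule that[of a \<rho> "\<lambda>k. K (a k)"])
    show "smooth_fun n A (topspace X) (\<rho> k)" for k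
      unfolding \<rho>_def
      by (intro smooth_fun_mult[OF openin_topspace] smooth_fun_prod[OF openin_topspace]
          smooth_fun_diff[OF openin_topspace] smooth_fun_const[OF openin_topspace]) (use b aX in auto)
    show "\<rho> k q = 0" if "q \<in> topspace X" "q \<notin> K (a k)" for k q
      using b[OF aX[of k]] that by (simp add: \<rho>_def)
    fix q assume "q \<in> topspace X"
    then obtain j where j: "q \<in> V (a j)" using \<V>(3) C(3) ran by blast
    have "\<psi> (a j) x = 1" if "x \<in> V (a j)" for x using b[OF aX[of j]] that by blast
    \<comment> \<open>The product in \<open>\<rho> j\<close> stops before j, so
      \<open>\<rho> j\<close> itself may survive on \<open>V (a j)\<close>; vanishing starts at
      \<open>Suc j\<close>.\<close>
    then have z: "(\<Prod>i<k. 1 - \<psi> (a i) x) = 0" if "x \<in> V (a j)" "k \<ge> Suc j" for x k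
      using that by (intro prod_zero bexI[of _ j]) auto
    have "(\<forall>k\<ge>Suc j. \<rho> k x = 0) \<and> (\<Sum>k<Suc j. \<rho> k x) = 1" if "x \<in> V (a j)" for x
    proof
      show "\<forall>k\<ge>Suc j. \<rho> k x = 0" using z[OF that] by (simp add: \<rho>_def del: prod_zero_iff)
      show "(\<Sum>k<Suc j. \<rho> k x) = 1" unfolding tele z[OF that order.refl] by simp
    qed
    then show "\<exists>V m. openin X V \<and> q \<in> V \<and> (\<forall>x\<in>V. (\<forall>k\<ge>m. \<rho> k x = 0) \<and> (\<Sum>k<m. \<rho> k x) = 1)"
      using j b[OF aX[of j]] by blast
  qed (use b aX in auto)
qed

section \<open>Gluing vector fields and projections\<close>

lemma smooth_vector_field_eq:
  assumes W: "openin X W" and V: "smooth_vector_field n A W V" and eq: "\<And>p. p \<in> W \<Longrightarrow> V' p = V p"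
  shows "smooth_vector_field n A W V'"
  unfolding smooth_vector_field_def
proof (intro conjI ballI allI impI)
  show "V' p \<in> tangent_space n A p" if "p \<in> W" for p
    using V that eq unfolding smooth_vector_field_def by simp
  fix c i assume c: "c \<in> A" and "i < n"
  then have "smooth_fun n A (W \<inter> fst c) (\<lambda>p. V p c i)" using V unfolding smooth_vector_field_def by blast
  then show "smooth_fun n A (W \<inter> fst c) (\<lambda>p. V' p c i)"
    by (rule smooth_fun_eq[rotated]) (use c W eq in auto)
qed

lemma smooth_vector_field_local:
  assumes W: "openin X W"
    and loc: "\<And>p. p \<in> W \<Longrightarrow> \<exists>W'. openin X W' \<and> p \<in> W' \<and> smooth_vector_field n A W' V"
  shows "smooth_vector_field n A W V"
  unfolding smooth_vector_field_def
proof (intro conjI ballI allI impI)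
  show "V p \<in> tangent_space n A p" if "p \<in> W" for p
    using loc[OF that] unfolding smooth_vector_field_def by blast
  fix c i assume c: "c \<in> A" and i: "i < n"
  show "smooth_fun n A (W \<inter> fst c) (\<lambda>p. V p c i)"
  proof (rule smooth_fun_local)
    show "openin X (W \<inter> fst c)" using c W by simp
    fix p assume p: "p \<in> W \<inter> fst c"
    then obtain W' where "openin X W'" "p \<in> W'" "smooth_vector_field n A W' V" using loc by blast
    then show "\<exists>W'. openin X W' \<and> p \<in> W' \<and> smooth_fun n A W' (\<lambda>p. V p c i)"
      using c i p by (intro exI[of _ "W' \<inter> fst c"]) (simp add: smooth_vector_field_def)
  qed
qed

lemma smooth_vector_field_sum:
  assumes W: "openin X W" and "finite I" "\<And>i. i \<in> I \<Longrightarrow> smooth_vector_field n A W (V i)"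
  shows "smooth_vector_field n A W (\<lambda>p. \<Sum>i\<in>I. V i p)"
  using assms(2,3)
proof (induction I)
  case empty
  show ?case by (simp only: sum.empty) (rule smooth_vector_field_zero[OF W])
next
  case (insert i I)
  then have "smooth_vector_field n A W (\<lambda>p. V i p + (\<Sum>i\<in>I. V i p))"
    by (intro smooth_vector_field_add[OF W]) auto
  then show ?case by (simp only: sum.insert[OF insert.hyps])
qed

definition frame_projection ::
  "nat \<Rightarrow> (nat \<Rightarrow> 'a \<Rightarrow> 'a tvec) \<Rightarrow> (nat \<Rightarrow> 'a \<Rightarrow> 'a covec) \<Rightarrow> 'a \<Rightarrow> 'a tvec \<Rightarrow> 'a tvec" where
  "frame_projection r t \<sigma> q v = (\<Sum>i<r. \<sigma> i q v *\<^sub>R t i q)"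

lemma frame_projection:
  assumes fr: "adapted_frame F r W t \<sigma>"
  shows "\<And>q v. q \<in> W \<Longrightarrow> frame_projection r t \<sigma> q v \<in> F `` {q}"
    "\<And>q v. q \<in> W \<Longrightarrow> (q, v) \<in> F \<Longrightarrow> frame_projection r t \<sigma> q v = v"
    "\<And>q v w. q \<in> W \<Longrightarrow> v \<in> tangent_space n A q \<Longrightarrow> w \<in> tangent_space n A q \<Longrightarrow>
      frame_projection r t \<sigma> q (v + w) = frame_projection r t \<sigma> q v + frame_projection r t \<sigma> q w"
    "\<And>q v c. q \<in> W \<Longrightarrow> v \<in> tangent_space n A q \<Longrightarrow>
      frame_projection r t \<sigma> q (c *\<^sub>R v) = c *\<^sub>R frame_projection r t \<sigma> q v"
    "\<And>Y V. openin X Y \<Longrightarrow> Y \<subseteq> W \<Longrightarrow> smooth_vector_field n A Y V \<Longrightarrow>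
      smooth_vector_field n A Y (\<lambda>q. frame_projection r t \<sigma> q (V q))"
proof -
  note E = adapted_frameD[OF fr]
  note D = local_frameD[OF E(1)]
  show "frame_projection r t \<sigma> q v \<in> F `` {q}" if "q \<in> W" for q v
    unfolding frame_projection_def using E(5)[OF that]
    by (intro subspace_sum[OF E(3)[OF that]] subspace_scale[OF E(3)[OF that]]) auto
  show "frame_projection r t \<sigma> q v = v" if "q \<in> W" "(q, v) \<in> F" for q v
    unfolding frame_projection_def using E(7)[OF that] .
  have lin: "linear_functional_on (tangent_space n A q) (\<sigma> i q)" if "q \<in> W" "i \<in> {..<r}" for q i
    using D(8) that E(2) by simp
  show "frame_projection r t \<sigma> q (v + w) = frame_projection r t \<sigma> q v + frame_projection r t \<sigma> q w"
    if "q \<in> W" "v \<in> tangent_space n A q" "w \<in> tangent_space n A q" for q v w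
  proof -
    have "\<sigma> i q (v + w) *\<^sub>R t i q = \<sigma> i q v *\<^sub>R t i q + \<sigma> i q w *\<^sub>R t i q" if "i \<in> {..<r}" for i
      using lin[OF \<open>q \<in> W\<close> that] \<open>v \<in> _\<close> \<open>w \<in> _\<close>
      unfolding linear_functional_on_def by (metis scaleR_add_left)
    then show ?thesis unfolding frame_projection_def sum.distrib[symmetric] by (rule sum.cong[OF refl])
  qed
  show "frame_projection r t \<sigma> q (c *\<^sub>R v) = c *\<^sub>R frame_projection r t \<sigma> q v"
    if "q \<in> W" "v \<in> tangent_space n A q" for q v c
  proof -
    have "\<sigma> i q (c *\<^sub>R v) *\<^sub>R t i q = c *\<^sub>R \<sigma> i q v *\<^sub>R t i q" if "i \<in> {..<r}" for i
      using lin[OF \<open>q \<in> W\<close> that] \<open>v \<in> _\<close> unfolding linear_functional_on_def by (metis scaleR_scaleR)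
    then show ?thesis unfolding frame_projection_def scaleR_sum_right by (rule sum.cong[OF refl])
  qed
  show "smooth_vector_field n A Y (\<lambda>q. frame_projection r t \<sigma> q (V q))"
    if Y: "openin X Y" "Y \<subseteq> W" and V: "smooth_vector_field n A Y V" for Y V
    unfolding frame_projection_def
  proof (rule smooth_vector_field_sum[OF Y(1)])
    fix i assume "i \<in> {..<r}"
    then have i: "i < n" using E(2) by simp
    show "smooth_vector_field n A Y (\<lambda>q. \<sigma> i q (V q) *\<^sub>R t i q)"
      by (intro smooth_vector_field_scale[OF Y(1)] smooth_one_form_apply[OF D(3)[OF i] V Y]
          smooth_vector_field_subset[OF D(2)[OF i] Y])
  qed simp
qed

text \<open>P acts on vectors at each point, and its smoothness is expressed through its effect on
  smooth fields, which is the form needed to substitute P into a 2-form.\<close>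

lemma smooth_projection_exists:
  assumes F: "smooth_subbundle X (smooth_vector_field n A) k F"
  shows "\<exists>P. (\<forall>p\<in>topspace X. \<forall>v\<in>tangent_space n A p. (p, P p v) \<in> F \<and>
        (\<forall>w\<in>tangent_space n A p. P p (v + w) = P p v + P p w) \<and> (\<forall>c. P p (c *\<^sub>R v) = c *\<^sub>R P p v)) \<and>
    (\<forall>p v. (p, v) \<in> F \<longrightarrow> P p v = v) \<and>
    (\<forall>W V. openin X W \<and> smooth_vector_field n A W V \<longrightarrow> smooth_vector_field n A W (\<lambda>p. P p (V p)))"
proof (cases "topspace X = {}")
  \<comment> \<open>Without points there is no sequence of centres for the partition of
    unity.\<close>
  case True
  then show ?thesis by (intro exI[of _ "\<lambda>p v. v"]) simp
next
  case False
  have "\<forall>p\<in>topspace X. \<exists>W t \<sigma>. p \<in> W \<and> adapted_frame F k W t \<sigma>"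
    using adapted_frame_exists[OF F] by blast
  then obtain U t \<sigma> where fr: "\<And>p. p \<in> topspace X \<Longrightarrow> p \<in> U p \<and> adapted_frame F k (U p) (t p) (\<sigma> p)"
    unfolding bchoice_iff by blast
  then have U: "openin X (U p) \<and> p \<in> U p" if "p \<in> topspace X" for p
    using local_frameD(1)[OF adapted_frameD(1)] that by blast
  obtain a :: "nat \<Rightarrow> 'a" and \<rho> :: "nat \<Rightarrow> 'a \<Rightarrow> real" and K :: "nat \<Rightarrow> 'a set"
    where aX: "\<And>i. a i \<in> topspace X" and \<rho>: "\<And>i. smooth_fun n A (topspace X) (\<rho> i)"
    and K: "\<And>i. closedin X (K i)" "\<And>i. K i \<subseteq> U (a i)"
    and \<rho>0: "\<And>i q. q \<in> topspace X \<Longrightarrow> q \<notin> K i \<Longrightarrow> \<rho> i q = 0"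
    and loc: "\<And>q. q \<in> topspace X \<Longrightarrow> \<exists>V m. openin X V \<and> q \<in> V \<and>
       (\<forall>x\<in>V. (\<forall>i\<ge>m. \<rho> i x = 0) \<and> (\<Sum>i<m. \<rho> i x) = 1)"
    by (rule smooth_partition_of_unity[of U], rule U, assumption, rule False, rule that, assumption+)
  define L where "L i = frame_projection k (t (a i)) (\<sigma> (a i))" for i
  note L = frame_projection[OF fr[OF aX, THEN conjunct2], folded L_def]
  \<comment> \<open>Summing over the nonzero weights makes P independent of the local bound m and
    keeps out the points where \<open>L i\<close> is uncontrolled: a nonzero weight puts q into
    \<open>U (a i)\<close>.\<close>
  define P where "P q v = (\<Sum>i | \<rho> i q \<noteq> 0. \<rho> i q *\<^sub>R L i q v)" for q v
  have inU: "q \<in> U (a i)" if "q \<in> topspace X" "\<rho> i q \<noteq> 0" for q i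
    using \<rho>0[of q i] K(2)[of i] that by blast
  have supp: "{i. \<rho> i q \<noteq> 0} \<subseteq> {..<m}" if "\<forall>i\<ge>m. \<rho> i q = 0" for q m
    using that by (auto simp: not_le[symmetric])
  have "(q, P q v) \<in> F" if q: "q \<in> topspace X" for q v
  proof -
    obtain W t \<sigma> where "q \<in> W" "adapted_frame F k W t \<sigma>"
      using adapted_frame_exists[OF F q] by blast
    then have S: "subspace (F `` {q})" using adapted_frameD(3) by blast
    have "P q v \<in> F `` {q}" unfolding P_def
    proof (intro subspace_sum[OF S] subspace_scale[OF S])
      fix i assume "i \<in> {i. \<rho> i q \<noteq> 0}"
      then show "L i q v \<in> F `` {q}" using L(1) inU[OF q] by blast
    qed
    then show ?thesis by simp
  qed
  moreover have "P q (v + w) = P q v + P q w"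
    if q: "q \<in> topspace X" and v: "v \<in> tangent_space n A q" "w \<in> tangent_space n A q" for q v w
  proof -
    have "\<rho> i q *\<^sub>R L i q (v + w) = \<rho> i q *\<^sub>R L i q v + \<rho> i q *\<^sub>R L i q w" if "i \<in> {i. \<rho> i q \<noteq> 0}" for i
    proof -
      have "\<rho> i q \<noteq> 0" using that by simp
      from L(3)[OF inU[OF q this] v] show ?thesis by (simp only: scaleR_add_right)
    qed
    then show ?thesis unfolding P_def sum.distrib[symmetric] by (rule sum.cong[OF refl])
  qed
  moreover have "P q (c *\<^sub>R v) = c *\<^sub>R P q v"
    if q: "q \<in> topspace X" and v: "v \<in> tangent_space n A q" for q v c
  proof -
    have "\<rho> i q *\<^sub>R L i q (c *\<^sub>R v) = c *\<^sub>R \<rho> i q *\<^sub>R L i q v" if "i \<in> {i. \<rho> i q \<noteq> 0}" for i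
    proof -
      have "\<rho> i q \<noteq> 0" using that by simp
      from L(4)[OF inU[OF q this] v] show ?thesis by (simp only: scaleR_left_commute)
    qed
    then show ?thesis unfolding P_def scaleR_sum_right by (rule sum.cong[OF refl])
  qed
  moreover have "P q v = v" if v: "(q, v) \<in> F" for q v
  proof -
    have q: "q \<in> topspace X" using subbundle_base[OF F v] .
    obtain m where m: "\<forall>i\<ge>m. \<rho> i q = 0" "(\<Sum>i<m. \<rho> i q) = 1" using loc[OF q] by blast
    have "P q v = (\<Sum>i | \<rho> i q \<noteq> 0. \<rho> i q *\<^sub>R v)"
      unfolding P_def using L(2)[OF inU[OF q] v] by (intro sum.cong) auto
    also have "\<dots> = (\<Sum>i | \<rho> i q \<noteq> 0. \<rho> i q) *\<^sub>R v" by (simp only: scaleR_sum_left)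
    also have "(\<Sum>i | \<rho> i q \<noteq> 0. \<rho> i q) = (\<Sum>i<m. \<rho> i q)"
      using supp[OF m(1)] by (intro sum.mono_neutral_left) auto
    finally show ?thesis using m(2) by simp
  qed
  moreover have "smooth_vector_field n A W (\<lambda>p. P p (V p))"
    if W: "openin X W" and V: "smooth_vector_field n A W V" for W V
  proof (rule smooth_vector_field_local[OF W])
    fix q assume q: "q \<in> W"
    then have "q \<in> topspace X" using W openin_subset by blast
    then obtain Z m where Z: "openin X Z" "q \<in> Z" and m: "\<And>x. x \<in> Z \<Longrightarrow> \<forall>i\<ge>m. \<rho> i x = 0"
      using loc by meson
    define Y where "Y = W \<inter> Z"
    have Y: "openin X Y" "Y \<subseteq> W" "Y \<subseteq> topspace X" "q \<in> Y"
      using W Z q openin_subset[OF W] by (auto simp: Y_def openin_Int)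
    have VY: "smooth_vector_field n A Y V" using smooth_vector_field_subset[OF V Y(1,2)] .
    have \<rho>Y: "smooth_fun n A Y' (\<rho> i)" if "openin X Y'" for Y' i
      using smooth_fun_subset[OF \<rho> that] openin_subset[OF that] by blast
    have "smooth_vector_field n A Y (\<lambda>x. \<rho> i x *\<^sub>R L i x (V x))" for i
    proof (rule smooth_vector_field_local[OF Y(1)])
      fix x assume x: "x \<in> Y"
      show "\<exists>W'. openin X W' \<and> x \<in> W' \<and> smooth_vector_field n A W' (\<lambda>x. \<rho> i x *\<^sub>R L i x (V x))"
      proof (cases "x \<in> U (a i)")
        case True
        define Y' where "Y' = Y \<inter> U (a i)"
        have Y': "openin X Y'" "Y' \<subseteq> Y" "Y' \<subseteq> U (a i)" "x \<in> Y'"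
          using Y U[OF aX] x True by (auto simp: Y'_def openin_Int)
        have "smooth_vector_field n A Y' (\<lambda>x. \<rho> i x *\<^sub>R L i x (V x))"
          by (intro smooth_vector_field_scale[OF Y'(1) \<rho>Y[OF Y'(1)]] L(5)[OF Y'(1,3)]
              smooth_vector_field_subset[OF VY Y'(1,2)])
        then show ?thesis using Y' by blast
      next
        case False
        \<comment> \<open>A point outside \<open>U (a i)\<close> lies outside the closed set
          \<open>K i\<close>, so the weight vanishes on a whole neighbourhood and the term is the
          zero field there, whatever \<open>L i\<close> does.\<close>
        define Y' where "Y' = Y - K i"
        have Y': "openin X Y'" "Y' \<subseteq> topspace X" "x \<in> Y'"
          using Y(1,3) K x False by (auto simp: Y'_def openin_diff)
        have "smooth_vector_field n A Y' (\<lambda>x. \<rho> i x *\<^sub>R L i x (V x))"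
        proof (rule smooth_vector_field_eq[OF Y'(1) smooth_vector_field_zero[OF Y'(1)]])
          fix y assume "y \<in> Y'"
          then have "\<rho> i y = 0" using \<rho>0 Y'(2) by (auto simp: Y'_def)
          then show "\<rho> i y *\<^sub>R L i y (V y) = 0" by simp
        qed
        then show ?thesis using Y' by blast
      qed
    qed
    then have "smooth_vector_field n A Y (\<lambda>x. \<Sum>i<m. \<rho> i x *\<^sub>R L i x (V x))"
      by (intro smooth_vector_field_sum[OF Y(1)]) auto
    moreover have "P x (V x) = (\<Sum>i<m. \<rho> i x *\<^sub>R L i x (V x))" if "x \<in> Y" for x
      unfolding P_def using supp[OF m, of x] that
      by (intro sum.mono_neutral_left) (auto simp: Y_def)
    ultimately have "smooth_vector_field n A Y (\<lambda>x. P x (V x))" by (rule smooth_vector_field_eq[OF Y(1)])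
    then show "\<exists>W'. openin X W' \<and> q \<in> W' \<and> smooth_vector_field n A W' (\<lambda>p. P p (V p))"
      using Y(1,4) by blast
  qed
  ultimately show ?thesis by (intro exI[of _ P]) simp
qed

section \<open>Extension of forms\<close>

text \<open>The pulled back form is smooth because P turns arbitrary smooth fields into smooth
  fields with values in F, the only ones on which \<Omega> is known to be smooth. Restriction
  returns \<Omega> because P fixes F and \<Omega> is 0 off F.\<close>

lemma two_form_extension_exists:
  assumes F: "smooth_subbundle X (smooth_vector_field n A) k F" and \<Omega>: "\<Omega> \<in> two_forms_on X n A F"
  shows "\<exists>\<Omega>' \<in> two_forms_on X n A (tangent_bundle X n A). restrict_form \<Omega>' F = \<Omega>"
proof -
  let ?T = "tangent_space n A"
  note O = two_formD[OF \<Omega>]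
  from smooth_projection_exists[OF F]
  obtain P where *: "\<forall>p\<in>topspace X. \<forall>v\<in>?T p. (p, P p v) \<in> F \<and>
        (\<forall>w\<in>?T p. P p (v + w) = P p v + P p w) \<and> (\<forall>c. P p (c *\<^sub>R v) = c *\<^sub>R P p v)"
    and Pid: "\<forall>p v. (p, v) \<in> F \<longrightarrow> P p v = v"
    and Psm: "\<forall>W V. openin X W \<and> smooth_vector_field n A W V \<longrightarrow> smooth_vector_field n A W (\<lambda>p. P p (V p))"
    by (elim exE conjE) (rule that)
  have PF: "(p, P p v) \<in> F" if "p \<in> topspace X" "v \<in> ?T p" for p v using * that by blast
  have Padd: "P p (v + w) = P p v + P p w" if "p \<in> topspace X" "v \<in> ?T p" "w \<in> ?T p" for p v w
    using * that by blast
  have Pscale: "P p (c *\<^sub>R v) = c *\<^sub>R P p v" if "p \<in> topspace X" "v \<in> ?T p" for p v c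
    using * that by blast
  have Psmooth: "smooth_vector_field n A W (\<lambda>p. P p (V p))"
    if "openin X W" "smooth_vector_field n A W V" for W V
    using Psm that by blast
  define \<Omega>' where "\<Omega>' p v w =
    (if (p, v) \<in> tangent_bundle X n A \<and> (p, w) \<in> tangent_bundle X n A then \<Omega> p (P p v) (P p w) else 0)" for p v w
  have tb: "(p, v) \<in> tangent_bundle X n A \<longleftrightarrow> p \<in> topspace X \<and> v \<in> ?T p" for p v
    by (simp add: tangent_bundle_def)
  have \<Omega>'_eq: "\<Omega>' p v w = \<Omega> p (P p v) (P p w)" if "p \<in> topspace X" "v \<in> ?T p" "w \<in> ?T p" for p v w
    using that by (simp add: \<Omega>'_def tb)
  have "\<Omega>' \<in> two_forms_on X n A (tangent_bundle X n A)"
    unfolding two_forms_on_def mem_Collect_eq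
  proof (intro conjI allI ballI impI)
    show "\<Omega>' p v w = 0" if "(p, v) \<notin> tangent_bundle X n A \<or> (p, w) \<notin> tangent_bundle X n A" for p v w
      using that by (auto simp: \<Omega>'_def)
  next
    fix p v assume p: "p \<in> topspace X" and "v \<in> tangent_bundle X n A `` {p}"
    then have v: "v \<in> ?T p" by (simp add: tb)
    have fib: "tangent_bundle X n A `` {p} = ?T p" using p by (auto simp: tb)
    show "\<Omega>' p v v = 0" using \<Omega>'_eq[OF p v v] O(2)[OF p PF[OF p v]] by simp
    note add = subspace_add[OF subspace_tangent_space] and scale = subspace_scale[OF subspace_tangent_space]
    have PFi: "w \<in> ?T p \<Longrightarrow> P p w \<in> F `` {p}" for w using PF[OF p] by simp
    show "linear_functional_on (tangent_bundle X n A `` {p}) (\<lambda>w. \<Omega>' p v w)"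
      using O(3)[OF p PF[OF p v]] PFi unfolding fib linear_functional_on_def
      by (simp add: \<Omega>'_eq p v add scale Padd Pscale del: plus_fun_apply)
    show "linear_functional_on (tangent_bundle X n A `` {p}) (\<lambda>w. \<Omega>' p w v)"
      using O(4)[OF p PF[OF p v]] PFi unfolding fib linear_functional_on_def
      by (simp add: \<Omega>'_eq p v add scale Padd Pscale del: plus_fun_apply)
  next
    fix W V V' assume *: "openin X W \<and> smooth_vector_field n A W V \<and> smooth_vector_field n A W V' \<and>
      (\<forall>p\<in>W. (p, V p) \<in> tangent_bundle X n A \<and> (p, V' p) \<in> tangent_bundle X n A)"
    then have W: "openin X W" and V: "smooth_vector_field n A W V" "smooth_vector_field n A W V'"
      and VT: "\<And>p. p \<in> W \<Longrightarrow> (p, V p) \<in> tangent_bundle X n A" "\<And>p. p \<in> W \<Longrightarrow> (p, V' p) \<in> tangent_bundle X n A"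
      by auto
    have "smooth_fun n A W (\<lambda>p. \<Omega> p (P p (V p)) (P p (V' p)))"
      by (rule O(5)[OF W Psmooth[OF W V(1)] Psmooth[OF W V(2)]]) (use VT PF tb in auto)
    then show "smooth_fun n A W (\<lambda>p. \<Omega>' p (V p) (V' p))"
      by (rule smooth_fun_eq[OF W]) (use VT in \<open>simp add: \<Omega>'_def\<close>)
  qed
  moreover have "restrict_form \<Omega>' F p v w = \<Omega> p v w" for p v w
  proof (cases "(p, v) \<in> F \<and> (p, w) \<in> F")
    case True
    have p: "p \<in> topspace X" using subbundle_base[OF F] True by blast
    obtain W t \<sigma> where "p \<in> W" "adapted_frame F k W t \<sigma>" using adapted_frame_exists[OF F p] by blast
    then have "v \<in> ?T p" "w \<in> ?T p" using adapted_frameD(4) True by blast+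
    then show ?thesis using True p Pid by (simp add: restrict_form_def \<Omega>'_eq)
  next
    case False
    then show ?thesis using O(1) by (auto simp: restrict_form_def)
  qed
  then have "restrict_form \<Omega>' F = \<Omega>" by (intro ext)
  ultimately show ?thesis by blast
qed

end

text \<open>A bare bijection between two sets would only compare their cardinalities. The clauses on
  \<Phi> determine it: F is the projection of L, and the form takes on F the values of the covectors
  in L, while it is 0 elsewhere by \<open>two_forms_on\<close>.\<close>

theorem proposition3p1:
  fixes X :: "'a topology" and n :: nat and A :: "'a chart set"
  assumes "smooth_manifold X n A"
  shows "(\<exists>\<Phi>. bij_betw \<Phi> {L. regular_almost_dirac X n A L}
              {(F, \<Omega>\<^sub>F). regular_distribution X n A F \<and> \<Omega>\<^sub>F \<in> two_forms_on X n A F} \<and>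
            (\<forall>L F \<Omega>\<^sub>F. regular_almost_dirac X n A L \<and> \<Phi> L = (F, \<Omega>\<^sub>F) \<longrightarrow>
               F = pr1 L \<and>
               (\<forall>p v \<alpha> w. (p, v, \<alpha>) \<in> L \<and> (p, w) \<in> F \<longrightarrow> \<Omega>\<^sub>F p v w = \<alpha> w)))
       \<and> (\<forall>F \<Omega>\<^sub>F. regular_distribution X n A F \<and> \<Omega>\<^sub>F \<in> two_forms_on X n A F \<longrightarrow>
            (\<exists>\<Omega> \<in> two_forms_on X n A (tangent_bundle X n A). restrict_form \<Omega> F = \<Omega>\<^sub>F))"
proof -
  interpret smooth_mfd X n A by unfold_locales (rule assms)
  show ?thesis
  proof (intro conjI exI[of _ "\<lambda>L. (pr1 L, form_of L)"] allI impI)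
    show "bij_betw (\<lambda>L. (pr1 L, form_of L)) {L. regular_almost_dirac X n A L}
        {(F, \<Omega>\<^sub>F). regular_distribution X n A F \<and> \<Omega>\<^sub>F \<in> two_forms_on X n A F}"
      by (rule dirac_correspondence)
  next
    fix L F \<Omega>\<^sub>F assume *: "regular_almost_dirac X n A L \<and> (pr1 L, form_of L) = (F, \<Omega>\<^sub>F)"
    then show "F = pr1 L" by simp
    fix p v \<alpha> w assume "(p, v, \<alpha>) \<in> L \<and> (p, w) \<in> F"
    then show "\<Omega>\<^sub>F p v w = \<alpha> w"
      using * form_of_eq[of L p v \<alpha> w] unfolding regular_almost_dirac_def by auto
  next
    fix F \<Omega>\<^sub>F assume "regular_distribution X n A F \<and> \<Omega>\<^sub>F \<in> two_forms_on X n A F"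
    then show "\<exists>\<Omega> \<in> two_forms_on X n A (tangent_bundle X n A). restrict_form \<Omega> F = \<Omega>\<^sub>F"
      using two_form_extension_exists unfolding regular_distribution_def by blast
  qed
qed

end
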